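(* Let $T_0$ be a nondegenerate closed triangle in the Euclidean plane. On $T_0$ there exists a unique geodesic distance $d_\infty(x,y)$ such that, for every $n\ge 0$, each edge of each triangle in the $n$-th barycentric subdivision $B^n(T_0)$ is a geodesic of length $2^{-n}$. The metric space $(T_0,d_\infty)$ has the following properties: (1) $(T_0,d_\infty)$ is a compact metric space homeomorphic to $T_0$ with the usual Euclidean metric $|x-y|$; (2) for every $n\ge 0$ and every triangle in $B^n(T_0)$, the distance $d_\infty(x,y)$ from any vertex $x$ of that triangle to any point $y$ on the opposite side of that triangle is $2^{-n}$; (3) there are infinitely many geodesics between any two distinct points; (4) $(T_0,d_\infty)$ is a self-similar set built with $6$ contracting similitudes with contraction ratios $\tfrac12$; (5) the Hausdorff dimension and the self-similarity dimension of $(T_0,d_\infty)$ are both equal to $\frac{\log 6}{\log 2}$.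
   Context: Barycentric subdivision: for a nondegenerate closed triangle $T=[v_0,v_1,v_2]$ in the plane, let $b=\frac13(v_0+v_1+v_2)$ be its barycenter. $B(T)$ denotes the collection of the six closed triangles $[v,m,b]$, where $v$ is a vertex of $T$ and $m$ is the midpoint of a side of $T$ containing $v$. For a collection $C$ of triangles, $B(C)=\bigcup_{c\in C}B(c)$; $B^0(T_0)=\{T_0\}$ and $B^n(T_0)=B(B^{n-1}(T_0))$. A geodesic distance on a set is a metric for which any two points are joined by a geodesic, i.e. by a path whose length equals the distance between its endpoints. A self-similar set built with contracting similitudes $f_1,\dots,f_6$ of ratio $r$ is a nonempty compact metric space $(Y,d)$ with $Y=\bigcup_i f_i(Y)$ and $d(f_i(x),f_i(y))=r\,d(x,y)$; its self-similarity dimension is the number $s$ with $6r^s=1$.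
   Formalization: Uniqueness is proved among geodesic distances for which any two points are joined by a geodesic that is also continuous in the Euclidean topology; without this it fails (transpose two points lying on no edge). The distance constructed satisfies this condition. *)

theory Defs
  imports "HOL-Analysis.Analysis"
begin

section \<open>Barycentric subdivision\<close>

text \<open>
  A nondegenerate closed triangle is represented by the set \<open>t\<close> of its three vertices; the closed
  triangle itself is \<open>convex hull t\<close>, its edges are the segments \<open>convex hull {u, w}\<close> for distinct
  \<open>u, w \<in> t\<close>, and the side opposite to \<open>u \<in> t\<close> is \<open>convex hull (t - {u})\<close>.
\<close>

definition barycenter :: "(real^2) set \<Rightarrow> real^2" where
  "barycenter t = (1 / 3) *\<^sub>R (\<Sum>v\<in>t. v)"

definition bary_subdivide :: "(real^2) set \<Rightarrow> (real^2) set set" where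
  "bary_subdivide t = {{v, midpoint v w, barycenter t} | v w. v \<in> t \<and> w \<in> t \<and> v \<noteq> w}"

definition bary_subdivision :: "nat \<Rightarrow> (real^2) set \<Rightarrow> (real^2) set set" where
  "bary_subdivision n t = ((\<lambda>C. \<Union>c\<in>C. bary_subdivide c) ^^ n) {t}"


section \<open>Length and geodesics\<close>

text \<open>The supremum is over all finite increasing sequences of parameters in \<open>[0,1]\<close>.\<close>

definition path_length :: "('a \<Rightarrow> 'a \<Rightarrow> real) \<Rightarrow> (real \<Rightarrow> 'a) \<Rightarrow> ennreal" where
  "path_length d g =
     (SUP ts\<in>{ts. sorted ts \<and> set ts \<subseteq> {0..1}}.
        ennreal (\<Sum>i<length ts - 1. d (g (ts ! i)) (g (ts ! Suc i))))"

definition geodesic_path ::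
    "'a set \<Rightarrow> ('a \<Rightarrow> 'a \<Rightarrow> real) \<Rightarrow> (real \<Rightarrow> 'a) \<Rightarrow> 'a \<Rightarrow> 'a \<Rightarrow> bool" where
  "geodesic_path M d g x y \<longleftrightarrow>
     pathin (Metric_space.mtopology M d) g \<and> g 0 = x \<and> g 1 = y \<and>
     path_length d g = ennreal (d x y)"

text \<open>
  A path in a subset \<open>T\<close> of the plane is continuous for the plane topology (this is \<open>path g\<close>); that
  it has its values in \<open>T\<close> and is continuous for \<open>d\<close> is part of \<open>geodesic_path\<close>. The condition
  \<open>path g\<close> is the only link between \<open>d\<close> and the plane topology. Without it no distance can be
  characterised by its values along the edges of all subdivisions: these edges do not cover the
  triangle, and transporting a distance along a permutation of the triangle that only moves points
  lying on no edge would preserve everything else.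
\<close>

definition geodesic_distance :: "(real^2) set \<Rightarrow> (real^2 \<Rightarrow> real^2 \<Rightarrow> real) \<Rightarrow> bool" where
  "geodesic_distance T d \<longleftrightarrow>
     Metric_space T d \<and>
     (\<forall>x\<in>T. \<forall>y\<in>T. \<exists>g. path g \<and> geodesic_path T d g x y)"

definition edges_geodesic :: "(real^2) set \<Rightarrow> (real^2 \<Rightarrow> real^2 \<Rightarrow> real) \<Rightarrow> bool" where
  "edges_geodesic t d \<longleftrightarrow>
     (\<forall>n. \<forall>c\<in>bary_subdivision n t. \<forall>u\<in>c. \<forall>w\<in>c. u \<noteq> w \<longrightarrow>
        geodesic_path (convex hull t) d (linepath u w) u w \<and>
        path_length d (linepath u w) = ennreal ((1 / 2) ^ n))"

text \<open>
  Geodesics that differ only by their parametrisation are identified by passing to their images,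
  since otherwise every pair of distinct points would trivially have infinitely many.
\<close>

definition geodesic_images :: "'a set \<Rightarrow> ('a \<Rightarrow> 'a \<Rightarrow> real) \<Rightarrow> 'a \<Rightarrow> 'a \<Rightarrow> 'a set set" where
  "geodesic_images M d x y = {g ` {0..1} | g. geodesic_path M d g x y}"


section \<open>Self-similar sets\<close>

definition self_similar_set ::
    "'a set \<Rightarrow> ('a \<Rightarrow> 'a \<Rightarrow> real) \<Rightarrow> nat \<Rightarrow> (nat \<Rightarrow> 'a \<Rightarrow> 'a) \<Rightarrow> real \<Rightarrow> bool" where
  "self_similar_set Y d N f r \<longleftrightarrow>
     Metric_space Y d \<and> Y \<noteq> {} \<and> compact_space (Metric_space.mtopology Y d) \<and>
     0 < r \<and> r < 1 \<and>
     Y = (\<Union>i<N. f i ` Y) \<and>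
     (\<forall>i<N. \<forall>x\<in>Y. \<forall>y\<in>Y. d (f i x) (f i y) = r * d x y)"

definition self_similarity_dimension :: "nat \<Rightarrow> real \<Rightarrow> real" where
  "self_similarity_dimension N r = (THE s. real N * r powr s = 1)"


section \<open>Hausdorff dimension\<close>

definition set_diam :: "('a \<Rightarrow> 'a \<Rightarrow> real) \<Rightarrow> 'a set \<Rightarrow> real" where
  "set_diam d U = (if U = {} then 0 else (SUP (x, y)\<in>U \<times> U. d x y))"

text \<open>
  \<open>set_diam\<close> is only applied to the \<open>d\<close>-bounded sets of a \<open>\<delta>\<close>-cover, so the real supremum is the
  diameter.
\<close>

definition delta_covers :: "'a set \<Rightarrow> ('a \<Rightarrow> 'a \<Rightarrow> real) \<Rightarrow> real \<Rightarrow> (nat \<Rightarrow> 'a set) set" where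
  "delta_covers M d \<delta> =
     {U. M = (\<Union>i. U i) \<and> (\<forall>i. \<forall>x\<in>U i. \<forall>y\<in>U i. d x y \<le> \<delta>)}"

definition hausdorff_measure :: "real \<Rightarrow> 'a set \<Rightarrow> ('a \<Rightarrow> 'a \<Rightarrow> real) \<Rightarrow> ennreal" where
  "hausdorff_measure s M d =
     (SUP \<delta>\<in>{0<..}. INF U\<in>delta_covers M d \<delta>. \<Sum>i. ennreal (set_diam d (U i) powr s))"

text \<open>
  Only \<open>s > 0\<close> is used, which does not affect the infimum and avoids the convention
  \<open>0 powr 0 = 0\<close>. The infimum of the empty set is \<open>\<infinity>\<close>.
\<close>

definition hausdorff_dimension :: "'a set \<Rightarrow> ('a \<Rightarrow> 'a \<Rightarrow> real) \<Rightarrow> ereal" where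
  "hausdorff_dimension M d = Inf (ereal ` {s. 0 < s \<and> hausdorff_measure s M d = 0})"

end

theory Submission
  imports Defs
begin

text \<open>
  The barycentric subdivision of the triangle \<open>T\<close> is generated by six affine maps \<open>A l\<close>, one for
  each order \<open>l\<close> of the three vertices: \<open>A l\<close> maps \<open>T\<close> to the child that consists of the points
  whose barycentric coordinates have this order. The triangles of level \<open>n\<close> are the cells
  \<open>Aw w ` T\<close> for words \<open>w\<close> of length \<open>n\<close>, and two of them meet only along a common face
  (\<open>Aw_unique\<close>).

  Existence. Let \<open>dd x y\<close> be the supremum of \<open>\<bar>F x - F y\<bar>\<close> over all continuous functions \<open>F\<close>
  that vary by at most \<open>2\<^sup>-\<^sup>n\<close> along every edge of level \<open>n\<close>. The edges are then at most as long
  as prescribed. That they are not shorter, and that points are separated, follows from explicit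
  functions of this kind, which model the distance from a vertex. Such functions restrict to
  cells and unfold from \<open>T\<close> to its children, so the maps \<open>A l\<close> are similitudes of ratio \<open>1/2\<close>
  (\<open>dd_A\<close>). Since the condition on \<open>F\<close> is local, \<open>dd\<close> is a length metric (\<open>Lip_chain_dist\<close>), and
  by compactness it is geodesic.

  Uniqueness. Let \<open>d\<close> be any distance with the required properties. A geodesic between points of
  the skeleton of level \<open>n\<close> can be followed from cell to cell, so a lower bound for \<open>d\<close> on the
  skeleton has to be checked on the boundary of single cells only (\<open>skeleton_Lip\<close>,
  \<open>skeleton_cross\<close>). First this shows that \<open>d\<close> takes the constant value \<open>2\<^sup>-\<^sup>n\<close> between a vertex
  of a cell and the opposite side: leaving the star of the vertex and entering the star of the
  midpoint of an opposite half side accounts for this length up to half of the error made for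
  smaller cells, so the error is zero (\<open>opposite_eq\<close>). On the boundary of a cell \<open>d\<close> thus
  dominates the differences of barycentric coordinates. Therefore a function on the vertices of
  level \<open>n\<close> that varies by at most \<open>2\<^sup>-\<^sup>n\<close> along the edges bounds \<open>d\<close> from below after affine
  interpolation (\<open>interp_Lip\<close>). For another distance \<open>e\<close> of this kind and a vertex \<open>u\<close>, the
  function \<open>e u\<close> yields \<open>e \<le> d\<close> on the vertices, and equality follows by symmetry. It extends to
  all points, because the continuity of geodesics provides vertices close to every point
  (\<open>vertex_approx\<close>).

  Geodesics. Interpolation also shows that points at distances \<open>\<alpha>\<close> and \<open>\<beta>\<close> from a common vertex
  on two sides of \<open>T\<close> are at distance at least \<open>min 1 (\<alpha> + \<beta>)\<close> (\<open>two_sides_ge\<close>). So some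
  geodesic between them passes through that vertex or through the barycenter, and any two
  distinct points are joined by a geodesic that contains an edge of a subdivision
  (\<open>edge_between_distinct\<close>). Such an edge can be replaced by a detour of equal length through a
  barycenter. Doing this in one of infinitely many disjoint parts of a geodesic gives infinitely
  many geodesics.

  Dimension. The \<open>6\<^sup>n\<close> cells of level \<open>n\<close> have diameters of order \<open>2\<^sup>-\<^sup>n\<close>, which bounds the
  dimension from above. Cells of the same level touch, but all except a small fraction of them
  avoid the boundary of \<open>T\<close>. Iterating only those gives a Cantor set with separated pieces,
  whose dimension is as close to \<open>log 6 / log 2\<close> as desired.
\<close>

section \<open>Words and barycentric coordinates\<close>

definition cross2 :: "real^2 \<Rightarrow> real^2 \<Rightarrow> real" where
  "cross2 u w = u $ 1 * w $ 2 - u $ 2 * w $ 1"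

text \<open>
  A triple \<open>(x, y, z)\<close> stands for the child whose vertices are, in this order, the vertex \<open>x\<close>,
  the midpoint of the vertices \<open>x\<close> and \<open>y\<close>, and the barycenter. Its points are those whose
  barycentric coordinates decrease along \<open>x\<close>, \<open>y\<close>, \<open>z\<close>.
\<close>
definition Perms :: "(nat \<times> nat \<times> nat) set" where
  "Perms = {(0,1,2), (0,2,1), (1,0,2), (1,2,0), (2,0,1), (2,1,0)}"

definition words :: "nat \<Rightarrow> (nat \<times> nat \<times> nat) list set" where
  "words n = {w. length w = n \<and> set w \<subseteq> Perms}"

lemma words_0 [simp]: "words 0 = {[]}"
  by (auto simp: words_def)

lemma words_Nil [simp]: "[] \<in> words n \<longleftrightarrow> n = 0"
  by (auto simp: words_def)

lemma words_Cons: "l # w \<in> words n \<longleftrightarrow> l \<in> Perms \<and> (\<exists>m. n = Suc m \<and> w \<in> words m)"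
  by (auto simp: words_def)

lemma words_append: "w \<in> words n \<Longrightarrow> w' \<in> words m \<Longrightarrow> w @ w' \<in> words (n + m)"
  by (auto simp: words_def)

lemma words_snoc: "w \<in> words n \<Longrightarrow> l \<in> Perms \<Longrightarrow> w @ [l] \<in> words (Suc n)"
  by (auto simp: words_def)

lemma words_Suc_snocE:
  assumes "w \<in> words (Suc n)"
  obtains u l where "w = u @ [l]" "u \<in> words n" "l \<in> Perms"
proof -
  have "w \<noteq> []" using assms by auto
  then have "w = butlast w @ [last w]" by simp
  moreover have "butlast w \<in> words n" "last w \<in> Perms"
    using assms \<open>w \<noteq> []\<close> by (auto simp: words_def dest: in_set_butlastD)
  ultimately show ?thesis using that by blast
qed

lemma words_Suc_ConsE:
  assumes "w \<in> words (Suc n)"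
  obtains u l where "w = l # u" "u \<in> words n" "l \<in> Perms"
  using assms by (cases w) (auto simp: words_Cons)

lemma words_splitE:
  assumes "w \<in> words (n + m)"
  obtains u u' where "w = u @ u'" "u \<in> words n" "u' \<in> words m"
proof -
  have "w = take n w @ drop n w" "take n w \<in> words n" "drop n w \<in> words m"
    using assms by (auto simp: words_def dest: in_set_takeD in_set_dropD)
  then show ?thesis using that by blast
qed

lemma finite_Perms [simp]: "finite Perms" and card_Perms: "card Perms = 6"
  by (auto simp: Perms_def)

lemma finite_words [simp]: "finite (words n)"
  using finite_lists_length_eq[OF finite_Perms, of n] by (simp add: words_def conj_commute)

lemma card_words: "card (words n) = 6 ^ n"
  using card_lists_length_eq[OF finite_Perms, of n] card_Perms by (simp add: words_def conj_commute)

lemma less_3_cases: "a < (3::nat) \<longleftrightarrow> a = 0 \<or> a = 1 \<or> a = 2"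
  by auto

locale plane_triangle =
  fixes v0 v1 v2 :: "real^2"
  assumes nondegenerate: "\<not> collinear {v0, v1, v2}"
begin

definition vtx :: "nat \<Rightarrow> real^2" where
  "vtx a = (if a = 0 then v0 else if a = 1 then v1 else v2)"

text \<open>Barycentric coordinates by Cramer's rule; an index above \<open>1\<close> stands for \<open>2\<close>.\<close>
definition bc :: "nat \<Rightarrow> real^2 \<Rightarrow> real" where
  "bc a x =
     (let D = cross2 (v1 - v0) (v2 - v0);
          s = cross2 (x - v0) (v2 - v0) / D; t = cross2 (v1 - v0) (x - v0) / D
      in if a = 0 then 1 - s - t else if a = 1 then s else t)"

definition G :: "real^2" where "G = (1/3) *\<^sub>R (v0 + v1 + v2)"

definition T :: "(real^2) set" where "T = {x. \<forall>a<3. bc a x \<ge> 0}"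

definition bdry :: "(real^2) set" where "bdry = {x \<in> T. \<exists>a<3. bc a x = 0}"

text \<open>
  The affine map of \<open>T\<close> onto its child \<open>l\<close> that respects the order of the vertices.
\<close>
definition A :: "nat \<times> nat \<times> nat \<Rightarrow> real^2 \<Rightarrow> real^2" where
  "A l p = (case l of (x, y, z) \<Rightarrow>
     bc 0 p *\<^sub>R vtx x + bc 1 p *\<^sub>R midpoint (vtx x) (vtx y) + bc 2 p *\<^sub>R G)"

text \<open>A word is read from the outside: its first letter is a child of \<open>T\<close>.\<close>
primrec Aw :: "(nat \<times> nat \<times> nat) list \<Rightarrow> real^2 \<Rightarrow> real^2" where
  "Aw [] x = x"
| "Aw (l # w) x = A l (Aw w x)"

lemma Aw_append: "Aw (w @ w') x = Aw w (Aw w' x)"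
  by (induction w) auto

lemma cross2_nonzero: "cross2 (v1 - v0) (v2 - v0) \<noteq> 0"
proof
  assume D: "cross2 (v1 - v0) (v2 - v0) = 0"
  have "v2 \<noteq> v0" using nondegenerate by (auto simp: insert_commute)
  then consider "(v2 - v0) $ 1 \<noteq> 0" | "(v2 - v0) $ 2 \<noteq> 0"
    by (auto simp: vec_eq_iff forall_2)
  then obtain c where c: "v1 - v0 = c *\<^sub>R (v2 - v0)"
  proof cases
    case 1
    have "v1 - v0 = ((v1 - v0) $ 1 / (v2 - v0) $ 1) *\<^sub>R (v2 - v0)"
      using 1 D by (simp add: vec_eq_iff forall_2 cross2_def nonzero_eq_divide_eq mult.commute)
    then show ?thesis using that by blast
  next
    case 2
    have "v1 - v0 = ((v1 - v0) $ 2 / (v2 - v0) $ 2) *\<^sub>R (v2 - v0)"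
      using 2 D by (simp add: vec_eq_iff forall_2 cross2_def nonzero_eq_divide_eq mult.commute)
    then show ?thesis using that by blast
  qed
  have "v1 = c *\<^sub>R v2 + (1 - c) *\<^sub>R v0"
    using c by (simp add: algebra_simps)
  then have "collinear {v2, v1, v0}" by (subst collinear_3_expand) blast
  then show False using nondegenerate by (simp add: insert_commute)
qed

lemma bc_sum: "bc 0 x + bc 1 x + bc 2 x = 1"
  by (simp add: bc_def Let_def)

lemma bc_vtx [simp]:
  "bc 0 v0 = 1" "bc (Suc 0) v0 = 0" "bc 2 v0 = 0"
  "bc 0 v1 = 0" "bc (Suc 0) v1 = 1" "bc 2 v1 = 0"
  "bc 0 v2 = 0" "bc (Suc 0) v2 = 0" "bc 2 v2 = 1"
  using cross2_nonzero by (auto simp: bc_def Let_def cross2_def)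

lemma bc_affine:
  assumes "r + s + t = 1"
  shows "bc a (r *\<^sub>R x + s *\<^sub>R y + t *\<^sub>R z) = r * bc a x + s * bc a y + t * bc a z"
proof -
  have r: "r = 1 - s - t" using assms by simp
  have "cross2 (r *\<^sub>R x + s *\<^sub>R y + t *\<^sub>R z - v0) u
      = r * cross2 (x - v0) u + s * cross2 (y - v0) u + t * cross2 (z - v0) u" for u
    unfolding r by (simp add: cross2_def algebra_simps)
  moreover have "cross2 u (r *\<^sub>R x + s *\<^sub>R y + t *\<^sub>R z - v0)
      = r * cross2 u (x - v0) + s * cross2 u (y - v0) + t * cross2 u (z - v0)" for u
    unfolding r by (simp add: cross2_def algebra_simps)
  ultimately show ?thesis
    unfolding r by (simp add: bc_def Let_def add_divide_distrib) (simp add: algebra_simps)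
qed

lemma bc_pt [simp]:
  assumes "r + s + t = 1"
  shows "bc 0 (r *\<^sub>R v0 + s *\<^sub>R v1 + t *\<^sub>R v2) = r"
    "bc (Suc 0) (r *\<^sub>R v0 + s *\<^sub>R v1 + t *\<^sub>R v2) = s"
    "bc 2 (r *\<^sub>R v0 + s *\<^sub>R v1 + t *\<^sub>R v2) = t"
  by (simp_all add: bc_affine[OF assms])

lemma bc_recompose: "bc 0 x *\<^sub>R v0 + bc 1 x *\<^sub>R v1 + bc 2 x *\<^sub>R v2 = x"
proof -
  let ?D = "cross2 (v1 - v0) (v2 - v0)"
  let ?s = "cross2 (x - v0) (v2 - v0)" and ?t = "cross2 (v1 - v0) (x - v0)"
  have "?D *\<^sub>R (x - v0) = ?s *\<^sub>R (v1 - v0) + ?t *\<^sub>R (v2 - v0)"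
    by (simp add: vec_eq_iff forall_2 cross2_def) (simp add: algebra_simps)
  then have "x - v0 = (1 / ?D) *\<^sub>R (?s *\<^sub>R (v1 - v0) + ?t *\<^sub>R (v2 - v0))"
  proof -
    assume "?D *\<^sub>R (x - v0) = ?s *\<^sub>R (v1 - v0) + ?t *\<^sub>R (v2 - v0)"
    then have "(1 / ?D) *\<^sub>R ?D *\<^sub>R (x - v0) = (1 / ?D) *\<^sub>R (?s *\<^sub>R (v1 - v0) + ?t *\<^sub>R (v2 - v0))"
      by (rule arg_cong)
    then show ?thesis using cross2_nonzero by simp
  qed
  then have "x = v0 + (?s / ?D) *\<^sub>R (v1 - v0) + (?t / ?D) *\<^sub>R (v2 - v0)"
    by (simp add: scaleR_add_right algebra_simps)
  then show ?thesis
    by (simp add: bc_def Let_def algebra_simps)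
qed

lemma bc_eqI:
  assumes "bc 1 x = bc 1 y" "bc 2 x = bc 2 y"
  shows "x = y"
  using bc_recompose[of x] bc_recompose[of y] bc_sum[of x] bc_sum[of y] assms
  by (metis add_right_cancel)

lemma continuous_on_bc [continuous_intros]: "continuous_on S (bc a)"
proof -
  have "continuous_on S (\<lambda>x. cross2 (x - v0) (v2 - v0))" "continuous_on S (\<lambda>x. cross2 (v1 - v0) (x - v0))"
    unfolding cross2_def by (intro continuous_intros)+
  then show ?thesis
    unfolding bc_def Let_def using cross2_nonzero
    by (cases "a = 0"; cases "a = 1") (auto intro!: continuous_intros)
qed

lemma vtx_eq [simp]: "vtx 0 = v0" "vtx (Suc 0) = v1" "vtx 2 = v2"
  by (auto simp: vtx_def)

lemma bc_vtx': "a < 3 \<Longrightarrow> b < 3 \<Longrightarrow> bc a (vtx b) = (if a = b then 1 else 0)"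
  by (auto simp: less_3_cases)

lemma T_iff: "x \<in> T \<longleftrightarrow> bc 0 x \<ge> 0 \<and> bc 1 x \<ge> 0 \<and> bc 2 x \<ge> 0"
  by (auto simp: T_def less_3_cases)

lemma bc_nonneg: "x \<in> T \<Longrightarrow> a < 3 \<Longrightarrow> bc a x \<ge> 0"
  by (auto simp: T_def)

lemma bc_le_1: "x \<in> T \<Longrightarrow> a < 3 \<Longrightarrow> bc a x \<le> 1"
  using bc_sum[of x] by (auto simp: T_iff less_3_cases)

lemma vtx_in_T [simp]: "vtx a \<in> T" "v0 \<in> T" "v1 \<in> T" "v2 \<in> T"
  by (auto simp: T_iff vtx_def)

lemma bc_G [simp]: "bc 0 G = 1/3" "bc (Suc 0) G = 1/3" "bc 2 G = 1/3"
proof -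
  have G: "G = (1/3) *\<^sub>R v0 + (1/3) *\<^sub>R v1 + (1/3) *\<^sub>R v2"
    by (simp add: G_def scaleR_add_right)
  show "bc 0 G = 1/3" "bc (Suc 0) G = 1/3" "bc 2 G = 1/3"
    unfolding G by simp_all
qed

lemma G_in_T [simp]: "G \<in> T"
  by (simp add: T_iff)

lemma bc_midpoint: "bc a (midpoint x y) = (bc a x + bc a y) / 2"
proof -
  have "midpoint x y = (1/2) *\<^sub>R x + (1/2) *\<^sub>R y + 0 *\<^sub>R y"
    by (simp add: midpoint_def scaleR_add_right)
  then show ?thesis using bc_affine[of "1/2" "1/2" 0 a x y y] by simp
qed

lemma bc_A:
  assumes "(x, y, z) \<in> Perms"
  shows "bc x (A (x, y, z) p) = bc 0 p + bc 1 p / 2 + bc 2 p / 3"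
    "bc y (A (x, y, z) p) = bc 1 p / 2 + bc 2 p / 3"
    "bc z (A (x, y, z) p) = bc 2 p / 3"
  using assms bc_affine[OF bc_sum, of _ p "vtx x" "midpoint (vtx x) (vtx y)" G]
  by (auto simp: Perms_def A_def bc_midpoint)

lemma A_affine:
  assumes "r + s + t = 1"
  shows "A l (r *\<^sub>R x + s *\<^sub>R y + t *\<^sub>R z) = r *\<^sub>R A l x + s *\<^sub>R A l y + t *\<^sub>R A l z"
  by (cases l) (simp only: A_def prod.case bc_affine[OF assms], simp add: algebra_simps)

lemma Aw_affine:
  assumes "r + s + t = 1"
  shows "Aw w (r *\<^sub>R x + s *\<^sub>R y + t *\<^sub>R z) = r *\<^sub>R Aw w x + s *\<^sub>R Aw w y + t *\<^sub>R Aw w z"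
  by (induction w) (auto simp: A_affine[OF assms])

lemma Aw_expand: "Aw w x = bc 0 x *\<^sub>R Aw w v0 + bc 1 x *\<^sub>R Aw w v1 + bc 2 x *\<^sub>R Aw w v2"
  using Aw_affine[OF bc_sum[of x], of w v0 v1 v2] by (simp only: bc_recompose)

lemma Aw_midpoint: "Aw w (midpoint x y) = midpoint (Aw w x) (Aw w y)"
proof -
  have "midpoint x y = (1/2) *\<^sub>R x + (1/2) *\<^sub>R y + 0 *\<^sub>R y" for x y :: "real^2"
    by (simp add: midpoint_def scaleR_add_right)
  then show ?thesis using Aw_affine[of "1/2" "1/2" 0 w x y y] by simp
qed

lemma Aw_linepath: "Aw w (linepath x y s) = linepath (Aw w x) (Aw w y) s"
  using Aw_affine[of "1 - s" s 0 w x y y] by (simp add: linepath_def)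

lemma bc_linepath: "bc a (linepath x y s) = (1 - s) * bc a x + s * bc a y"
  using bc_affine[of "1 - s" s 0 a x y y] by (simp add: linepath_def)

lemma continuous_on_A: "continuous_on S (A l)"
  by (cases l) (auto simp: A_def intro!: continuous_intros)

lemma continuous_on_Aw [continuous_intros]: "continuous_on S (Aw w)"
proof (induction w)
  case Nil
  then show ?case by (simp add: continuous_on_id)
next
  case (Cons l w)
  have "continuous_on S (A l \<circ> Aw w)"
    by (rule continuous_on_compose[OF Cons continuous_on_A])
  then show ?case by (simp add: o_def)
qed

lemma A_vtx:
  "A (x, y, z) v0 = vtx x" "A (x, y, z) v1 = midpoint (vtx x) (vtx y)" "A (x, y, z) v2 = G"
  by (simp_all add: A_def)

lemma third_vertex:
  assumes "x < 3" "y < 3" "x \<noteq> y"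
  obtains z where "(x, y, z) \<in> Perms"
proof -
  have "(x, y, 3 - x - y) \<in> Perms"
    using assms unfolding less_3_cases by (elim disjE) (simp_all add: Perms_def)
  then show ?thesis using that by blast
qed

lemma Perms_less3: "(x, y, z) \<in> Perms \<Longrightarrow> x < 3 \<and> y < 3 \<and> z < 3"
  by (auto simp: Perms_def)

lemma Perms_distinct: "(x, y, z) \<in> Perms \<Longrightarrow> x \<noteq> y \<and> y \<noteq> z \<and> x \<noteq> z"
  by (auto simp: Perms_def)

lemma Perms_cover: "(x, y, z) \<in> Perms \<Longrightarrow> a < 3 \<Longrightarrow> a = x \<or> a = y \<or> a = z"
  by (auto simp: Perms_def)

lemma Perms_all3: "(x, y, z) \<in> Perms \<Longrightarrow> (\<forall>a<3. Q a) \<longleftrightarrow> Q x \<and> Q y \<and> Q z"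
  by (metis Perms_cover Perms_less3)

lemma Perms_iff: "(x, y, z) \<in> Perms \<longleftrightarrow> x < 3 \<and> y < 3 \<and> z < 3 \<and> x \<noteq> y \<and> y \<noteq> z \<and> x \<noteq> z"
  by (auto simp: Perms_def less_3_cases)

lemma bc_sum_Perms: "(x, y, z) \<in> Perms \<Longrightarrow> bc x p + bc y p + bc z p = 1"
  using bc_sum[of p] by (auto simp: Perms_def)

lemma A_in_T: assumes "l \<in> Perms" "p \<in> T" shows "A l p \<in> T"
proof -
  obtain x y z where l: "l = (x, y, z)" by (cases l)
  show ?thesis
    using assms bc_A[of x y z p] unfolding l T_def
    by (subst mem_Collect_eq, subst Perms_all3[of x y z]) (auto simp: less_3_cases)
qed

lemma Aw_in_T: "w \<in> words n \<Longrightarrow> p \<in> T \<Longrightarrow> Aw w p \<in> T"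
  by (induction w arbitrary: n) (auto simp: words_Cons intro: A_in_T)

text \<open>
  Sorting the barycentric coordinates of a point finds the child that contains it.
\<close>
lemma A_sortedE:
  assumes "(x, y, z) \<in> Perms" "bc x q \<ge> bc y q" "bc y q \<ge> bc z q" "bc z q \<ge> 0"
  obtains p where "p \<in> T" "q = A (x, y, z) p"
    "bc 0 p = bc x q - bc y q" "bc 1 p = 2 * (bc y q - bc z q)" "bc 2 p = 3 * bc z q"
proof -
  let ?r = "bc x q - bc y q" and ?s = "2 * (bc y q - bc z q)" and ?t = "3 * bc z q"
  define p where "p = ?r *\<^sub>R v0 + ?s *\<^sub>R v1 + ?t *\<^sub>R v2"
  have sum: "?r + ?s + ?t = 1" using bc_sum_Perms[OF assms(1), of q] by simp
  have bc: "bc 0 p = ?r" "bc 1 p = ?s" "bc 2 p = ?t"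
    unfolding p_def using bc_pt[OF sum] by simp_all
  have "bc a q = bc a (A (x, y, z) p)" if "a < 3" for a
  proof -
    have "a = x \<or> a = y \<or> a = z" using Perms_cover assms(1) that by blast
    then show ?thesis
      using bc_A[OF assms(1), of p] bc by (auto simp: algebra_simps)
  qed
  then have "q = A (x, y, z) p" by (intro bc_eqI) auto
  moreover have "p \<in> T" using bc assms by (auto simp: T_iff)
  ultimately show ?thesis using that bc by blast
qed

lemma T_cover:
  assumes "q \<in> T"
  obtains l p where "l \<in> Perms" "p \<in> T" "q = A l p"
proof -
  have "\<exists>x y z. (x, y, z) \<in> Perms \<and> bc x q \<ge> bc y q \<and> bc y q \<ge> bc z q"
    unfolding Perms_def by (smt (verit, best) insertI1 insertI2)
  then obtain x y z where xyz: "(x, y, z) \<in> Perms" "bc x q \<ge> bc y q" "bc y q \<ge> bc z q" by blast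
  then have "bc z q \<ge> 0" using assms Perms_less3 bc_nonneg by blast
  then show ?thesis using A_sortedE[OF xyz] that xyz by metis
qed

lemma T_cover_words:
  assumes "q \<in> T"
  obtains w p where "w \<in> words n" "p \<in> T" "q = Aw w p"
proof -
  have "\<exists>w p. w \<in> words n \<and> p \<in> T \<and> q = Aw w p"
    using assms
  proof (induction n arbitrary: q)
    case 0
    then show ?case by auto
  next
    case (Suc n)
    from T_cover[OF Suc.prems] obtain l p where l: "l \<in> Perms" "p \<in> T" "q = A l p" by blast
    from Suc.IH[OF l(2)] obtain w p' where "w \<in> words n" "p' \<in> T" "p = Aw w p'" by blast
    then have "l # w \<in> words (Suc n) \<and> p' \<in> T \<and> q = Aw (l # w) p'"
      using l by (auto simp: words_Cons)
    then show ?case by blast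
  qed
  then show ?thesis using that by blast
qed

text \<open>
  The coordinates of a point, read from the largest to the smallest, determine its coordinates
  in the child, and they determine the order of the vertices up to ties, which occur where a
  coordinate in the child vanishes.
\<close>
lemma A_unique:
  assumes P: "(x, y, z) \<in> Perms" "(x', y', z') \<in> Perms" and T: "p \<in> T" "p' \<in> T"
    and eq: "A (x, y, z) p = A (x', y', z') p'"
  shows "p = p'" "bc 0 p > 0 \<Longrightarrow> x = x'" "bc 1 p > 0 \<Longrightarrow> z = z'"
proof -
  define f where "f a = bc a (A (x, y, z) p)" for a
  note e1 = bc_A[OF P(1), of p, folded f_def] and e2 = bc_A[OF P(2), of p', folded eq, folded f_def]
  have pos: "bc 0 p \<ge> 0" "bc 1 p \<ge> 0" "bc 2 p \<ge> 0" "bc 0 p' \<ge> 0" "bc 1 p' \<ge> 0" "bc 2 p' \<ge> 0"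
    using T by (auto simp: T_iff)
  have m: "x' = x \<or> x' = y \<or> x' = z" "z' = x \<or> z' = y \<or> z' = z"
      "x = x' \<or> x = y' \<or> x = z'" "z = x' \<or> z = y' \<or> z = z'"
    using Perms_cover Perms_less3 P by blast+
  have o1: "f x \<ge> f y" "f y \<ge> f z" "f x \<ge> f z" and o2: "f x' \<ge> f y'" "f y' \<ge> f z'" "f x' \<ge> f z'"
    using e1 e2 pos by linarith+
  have "f x' \<le> f x" using m(1) o1 by (elim disjE) simp_all
  moreover have "f x \<le> f x'" using m(3) o2 by (elim disjE) simp_all
  moreover have "f z' \<ge> f z" using m(2) o1 by (elim disjE) simp_all
  moreover have "f z \<ge> f z'" using m(4) o2 by (elim disjE) simp_all
  ultimately have "f x = f x'" "f z = f z'" by linarith+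
  moreover have "f x + f y + f z = f x' + f y' + f z'"
    using bc_sum_Perms[OF P(1)] bc_sum_Perms[OF P(2)] by (simp add: f_def)
  ultimately have f: "f x = f x'" "f y = f y'" "f z = f z'" by linarith+
  have "bc 2 p = bc 2 p'" "bc 1 p = bc 1 p'" using f e1 e2 by linarith+
  then show "p = p'" by (intro bc_eqI)
  show "x = x'" if "bc 0 p > 0"
  proof -
    have "f y < f x" "f z < f x" using that e1 pos by linarith+
    then show ?thesis using m(1) f(1) by fastforce
  qed
  show "z = z'" if "bc 1 p > 0"
  proof -
    have "f z < f y" "f z < f x" using that e1 pos by linarith+
    then show ?thesis using m(2) f(3) by fastforce
  qed
qed

lemma Aw_snoc: "Aw (u @ [l]) p = Aw u (A l p)"
  by (simp add: Aw_append)

lemma Aw_G: "Aw w G = (1/3) *\<^sub>R (Aw w v0 + Aw w v1 + Aw w v2)"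
  by (subst Aw_expand) (simp add: scaleR_add_right)

text \<open>
  The coordinates in a child are multiples of consecutive differences of the sorted coordinates
  in its parent, and a difference is positive only where the order is unambiguous. Hence two
  cells of the same level meet only in a common face and induce the same barycentric coordinates
  on it.
\<close>
lemma Aw_unique:
  assumes "w \<in> words n" "w' \<in> words n" "p \<in> T" "p' \<in> T" "Aw w p = Aw w' p'"
  shows "p = p' \<and> (\<forall>a<3. bc a p > 0 \<longrightarrow> Aw w (vtx a) = Aw w' (vtx a))"
  using assms
proof (induction n arbitrary: w w' p p')
  case 0
  then show ?case by simp
next
  case (Suc n)
  obtain u l where w: "w = u @ [l]" "u \<in> words n" "l \<in> Perms"
    using words_Suc_snocE Suc.prems(1) by blast
  obtain u' l' where w': "w' = u' @ [l']" "u' \<in> words n" "l' \<in> Perms"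
    using words_Suc_snocE Suc.prems(2) by blast
  obtain x y z x' y' z' where l: "l = (x, y, z)" "l' = (x', y', z')" by (cases l, cases l')
  note P = w(3)[unfolded l] w'(3)[unfolded l]
  have IH: "A l p = A l' p'" "\<And>a. a < 3 \<Longrightarrow> bc a (A l p) > 0 \<Longrightarrow> Aw u (vtx a) = Aw u' (vtx a)"
    using Suc.IH[OF w(2) w'(2), of "A l p" "A l' p'"] Suc.prems w w' A_in_T by (auto simp: Aw_snoc)
  note un = A_unique[OF P Suc.prems(3,4) IH(1)[unfolded l]]
  note bcA = bc_A[OF P(1), of p, folded l]
  have pos: "bc 0 p \<ge> 0" "bc 1 p \<ge> 0" "bc 2 p \<ge> 0"
    using Suc.prems(3) by (auto simp: T_iff)
  note lt = Perms_less3[OF P(1)] Perms_less3[OF P(2)]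
  have "Aw w (vtx 0) = Aw w' (vtx 0)" if "bc 0 p > 0"
  proof -
    have "bc x (A l p) > 0" using bcA pos that by linarith
    then show ?thesis using un(2)[OF that] IH(2) lt w w' l by (simp add: Aw_snoc A_vtx)
  qed
  moreover have "Aw w (vtx 1) = Aw w' (vtx 1)" if "bc 1 p > 0"
  proof -
    have xy: "x' = x \<and> y' = y \<or> x' = y \<and> y' = x"
      using un(3)[OF that] P by (auto simp: Perms_def)
    have "bc x (A l p) > 0" "bc y (A l p) > 0" using bcA pos that by linarith+
    then have "Aw u (vtx x) = Aw u' (vtx x)" "Aw u (vtx y) = Aw u' (vtx y)" using IH(2) lt by auto
    then show ?thesis using xy w w' l by (auto simp: Aw_snoc A_vtx Aw_midpoint midpoint_sym)
  qed
  moreover have "Aw w (vtx 2) = Aw w' (vtx 2)" if "bc 2 p > 0"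
  proof -
    have *: "bc x (A l p) > 0" "bc y (A l p) > 0" "bc z (A l p) > 0" using bcA pos that by linarith+
    have "\<forall>a<3. bc a (A l p) > 0" by (subst Perms_all3[OF P(1)]) (simp add: *)
    then have "Aw u (vtx a) = Aw u' (vtx a)" if "a < 3" for a using IH(2) that by blast
    from this[of 0] this[of 1] this[of 2] have "Aw u G = Aw u' G" by (simp add: Aw_G)
    then show ?thesis using w w' l by (simp add: Aw_snoc A_vtx)
  qed
  ultimately show ?case using un(1) by (auto simp: less_3_cases)
qed

lemma Aw_inj:
  assumes "w \<in> words n" "p \<in> T" "p' \<in> T" "Aw w p = Aw w p'"
  shows "p = p'"
  using Aw_unique[of w n w p p'] assms by blast

lemma inj_on_Aw: "w \<in> words n \<Longrightarrow> inj_on (Aw w) T"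
  using Aw_inj by (meson inj_onI)

definition tri :: "(real^2) set" where "tri = {v0, v1, v2}"

lemma tri_eq: "tri = vtx ` {..<3}"
  by (auto simp: tri_def image_iff less_3_cases vtx_def)

lemma tri_subset_T: "tri \<subseteq> T"
  by (auto simp: tri_def)

lemma hull_Aw: "convex hull (Aw w ` tri) = Aw w ` T"
proof -
  have "Aw w ` tri = {Aw w v0, Aw w v1, Aw w v2}" by (auto simp: tri_def)
  then have eq: "convex hull (Aw w ` tri) = {r *\<^sub>R Aw w v0 + s *\<^sub>R Aw w v1 + t *\<^sub>R Aw w v2 | r s t.
      0 \<le> r \<and> 0 \<le> s \<and> 0 \<le> t \<and> r + s + t = 1}"
    by (simp add: convex_hull_3)
  show ?thesis
  proof (intro equalityI subsetI)
    fix q assume "q \<in> convex hull (Aw w ` tri)"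
    then obtain r s t where q: "q = r *\<^sub>R Aw w v0 + s *\<^sub>R Aw w v1 + t *\<^sub>R Aw w v2"
        "0 \<le> r" "0 \<le> s" "0 \<le> t" "r + s + t = 1" unfolding eq by blast
    have "q = Aw w (r *\<^sub>R v0 + s *\<^sub>R v1 + t *\<^sub>R v2)" using q Aw_affine by simp
    moreover have "r *\<^sub>R v0 + s *\<^sub>R v1 + t *\<^sub>R v2 \<in> T" using q by (simp add: T_iff)
    ultimately show "q \<in> Aw w ` T" by blast
  next
    fix q assume "q \<in> Aw w ` T"
    then obtain p where p: "p \<in> T" "q = Aw w p" by blast
    then show "q \<in> convex hull (Aw w ` tri)"
      unfolding eq using Aw_expand[of w p] bc_sum[of p] by (auto simp: T_iff)
  qed
qed

lemma hull_tri: "convex hull tri = T"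
  using hull_Aw[of "[]"] by simp

lemma compact_T: "compact T"
  unfolding hull_tri[symmetric] tri_def by (simp add: finite_imp_compact_convex_hull)

lemma compact_cell: "compact (Aw w ` T)"
  by (rule compact_continuous_image[OF continuous_on_Aw compact_T])

lemma closed_cell: "closed (Aw w ` T)"
  by (rule compact_imp_closed[OF compact_cell])

definition side :: "nat \<Rightarrow> nat \<Rightarrow> real \<Rightarrow> real^2" where
  "side a b s = linepath (vtx a) (vtx b) s"

lemma bc_side:
  assumes "a < 3" "b < 3" "c < 3"
  shows "bc c (side a b s) = (1 - s) * (if c = a then 1 else 0) + s * (if c = b then 1 else 0)"
  using assms by (simp add: side_def bc_linepath bc_vtx')

lemma side_in_T: "a < 3 \<Longrightarrow> b < 3 \<Longrightarrow> 0 \<le> s \<Longrightarrow> s \<le> 1 \<Longrightarrow> side a b s \<in> T"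
  by (auto simp: T_def bc_side)

lemma side_in_bdry:
  assumes "a < 3" "b < 3" "0 \<le> s" "s \<le> 1"
  shows "side a b s \<in> bdry"
proof -
  obtain c where "c < 3" "c \<noteq> a" "c \<noteq> b"
    by (metis less_3_cases numeral_2_eq_2 One_nat_def n_not_Suc_n zero_neq_numeral zero_neq_one)
  then show ?thesis using side_in_T[OF assms] bc_side[of a b c s] assms by (auto simp: bdry_def)
qed

lemma side_0 [simp]: "side a b 0 = vtx a" and side_1 [simp]: "side a b 1 = vtx b"
  by (simp_all add: side_def linepath_def)

lemma side_rev: "side a b s = side b a (1 - s)"
  by (simp add: side_def linepath_def)

lemma bdry_subset_T: "bdry \<subseteq> T"
  by (auto simp: bdry_def)

lemma vtx_in_bdry [simp]: "vtx a \<in> bdry"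
  by (auto simp: bdry_def vtx_def intro: exI[of _ 0] exI[of _ 1])

lemma Aw_side: "Aw w (side a b s) = linepath (Aw w (vtx a)) (Aw w (vtx b)) s"
  by (simp add: side_def Aw_linepath)

lemma opposite_sideE:
  assumes "p \<in> T" "bc a p = 0" "a < 3" "b < 3" "c < 3" "a \<noteq> b" "a \<noteq> c" "b \<noteq> c"
  shows "p = side b c (bc c p)"
proof -
  have P: "(a, b, c) \<in> Perms" using assms by (simp add: Perms_iff)
  have "\<forall>d<3. bc d p = bc d (side b c (bc c p))"
    using bc_sum_Perms[OF P, of p] assms
    by (subst Perms_all3[OF P]) (auto simp: bc_side)
  then show ?thesis by (intro bc_eqI) auto
qed

text \<open>
  This brings the plane topology into play: a path can enter or leave a cell only through the
  image of the boundary of \<open>T\<close>.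
\<close>
lemma frontier_cell: "frontier (Aw w ` T) \<subseteq> Aw w ` bdry"
proof -
  have "Aw w ` tri = {Aw w v0, Aw w v1, Aw w v2}" by (auto simp: tri_def)
  then have "frontier (Aw w ` T) = closed_segment (Aw w v0) (Aw w v1) \<union>
      closed_segment (Aw w v1) (Aw w v2) \<union> closed_segment (Aw w v2) (Aw w v0)"
    unfolding hull_Aw[symmetric] by (simp add: frontier_of_triangle)
  moreover have "closed_segment (Aw w (vtx a)) (Aw w (vtx b)) \<subseteq> Aw w ` bdry" if "a < 3" "b < 3" for a b
  proof
    fix q assume "q \<in> closed_segment (Aw w (vtx a)) (Aw w (vtx b))"
    then obtain s where "s \<in> {0..1}" "q = linepath (Aw w (vtx a)) (Aw w (vtx b)) s"
      unfolding linepath_image_01[symmetric] by blast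
    then show "q \<in> Aw w ` bdry" using side_in_bdry[OF that, of s] by (auto simp: Aw_side[symmetric])
  qed
  from this[of 0 1] this[of 1 2] this[of 2 0] have
    "closed_segment (Aw w v0) (Aw w v1) \<subseteq> Aw w ` bdry"
    "closed_segment (Aw w v1) (Aw w v2) \<subseteq> Aw w ` bdry"
    "closed_segment (Aw w v2) (Aw w v0) \<subseteq> Aw w ` bdry" by simp_all
  ultimately show ?thesis by blast
qed

lemma bary_subdivide_cell:
  assumes "w \<in> words n"
  shows "bary_subdivide (Aw w ` tri) = (\<lambda>l. Aw (w @ [l]) ` tri) ` Perms"
proof -
  have inj: "inj_on (Aw w) tri" using inj_on_Aw[OF assms] tri_subset_T inj_on_subset by blast
  have dist: "v0 \<noteq> v1" "v0 \<noteq> v2" "v1 \<noteq> v2"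
    using bc_vtx by (metis zero_neq_one)+
  have bary: "barycenter (Aw w ` tri) = Aw w G"
    unfolding barycenter_def using dist by (subst sum.reindex[OF inj]) (simp add: tri_def Aw_G add.assoc)
  have child: "Aw (w @ [(x, y, z)]) ` tri = {Aw w (vtx x), midpoint (Aw w (vtx x)) (Aw w (vtx y)), barycenter (Aw w ` tri)}"
    for x y z unfolding bary by (simp add: tri_def Aw_snoc A_vtx Aw_midpoint)
  have vin: "vtx a \<in> tri" for a by (simp add: vtx_def tri_def)
  show ?thesis
  proof (intro equalityI subsetI)
    fix c assume "c \<in> bary_subdivide (Aw w ` tri)"
    then obtain p q where c: "c = {p, midpoint p q, barycenter (Aw w ` tri)}" "p \<in> Aw w ` tri"
        "q \<in> Aw w ` tri" "p \<noteq> q" unfolding bary_subdivide_def by blast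
    then obtain x y where xy: "x < 3" "y < 3" "p = Aw w (vtx x)" "q = Aw w (vtx y)" "x \<noteq> y"
      unfolding tri_eq by auto
    from third_vertex[OF xy(1,2,5)] obtain z where "(x, y, z) \<in> Perms" .
    moreover have "c = Aw (w @ [(x, y, z)]) ` tri" unfolding child c(1) xy(3,4) ..
    ultimately show "c \<in> (\<lambda>l. Aw (w @ [l]) ` tri) ` Perms" by (rule rev_image_eqI)
  next
    fix c assume "c \<in> (\<lambda>l. Aw (w @ [l]) ` tri) ` Perms"
    then obtain x y z where l: "(x, y, z) \<in> Perms" "c = Aw (w @ [(x, y, z)]) ` tri" by auto
    have "vtx x \<noteq> vtx y"
      using Perms_distinct[OF l(1)] Perms_less3[OF l(1)] bc_vtx'[of x x] bc_vtx'[of x y] by auto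
    then have "Aw w (vtx x) \<noteq> Aw w (vtx y)"
      using inj vin unfolding inj_on_def by blast
    moreover have "Aw w (vtx x) \<in> Aw w ` tri" "Aw w (vtx y) \<in> Aw w ` tri" using vin by auto
    ultimately show "c \<in> bary_subdivide (Aw w ` tri)"
      unfolding l(2) child bary_subdivide_def by blast
  qed
qed

lemma bary_subdivision_eq: "bary_subdivision n tri = (\<lambda>w. Aw w ` tri) ` words n"
proof (induction n)
  case 0
  then show ?case by (simp add: bary_subdivision_def)
next
  case (Suc n)
  have "bary_subdivision (Suc n) tri = (\<Union>c\<in>bary_subdivision n tri. bary_subdivide c)"
    by (simp add: bary_subdivision_def)
  also have "\<dots> = (\<Union>w\<in>words n. (\<lambda>l. Aw (w @ [l]) ` tri) ` Perms)"
    unfolding Suc by (auto simp: bary_subdivide_cell)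
  also have "\<dots> = (\<lambda>w. Aw w ` tri) ` words (Suc n)"
    by (auto intro: words_snoc elim!: words_Suc_snocE)
  finally show ?case .
qed

text \<open>
  The sides of a child are half of a side, the longer part of one median and the shorter part of
  another. A median is at most as long as the longest side, and its longer part is two thirds of
  it.
\<close>
lemma mesh_vertices:
  assumes "w \<in> words n" "a < 3" "b < 3"
  shows "dist (Aw w (vtx a)) (Aw w (vtx b)) \<le> (2/3) ^ n * (dist v0 v1 + dist v0 v2 + dist v1 v2)"
    (is "_ \<le> _ * ?K")
  using assms
proof (induction n arbitrary: w a b)
  case 0
  then show ?case by (auto simp: less_3_cases dist_commute)
next
  case (Suc n)
  obtain u l where w: "w = u @ [l]" "u \<in> words n" "l \<in> Perms"
    using words_Suc_snocE Suc.prems(1) by blast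
  obtain x y z where l: "l = (x, y, z)" by (cases l)
  define P Q R where "P = Aw u (vtx x)" "Q = Aw u (vtx y)" "R = Aw u (vtx z)"
  define D where "D = (2/3) ^ n * ?K"
  have D0: "D \<ge> 0" by (simp add: D_def)
  have xyz: "x < 3" "y < 3" "z < 3" using w l Perms_less3 by auto
  have d: "norm (P - Q) \<le> D" "norm (P - R) \<le> D" "norm (Q - R) \<le> D"
    using Suc.IH[OF w(2), folded D_def] xyz by (auto simp: P_Q_R_def dist_norm)
  have G: "Aw u G = (1/3) *\<^sub>R (P + Q + R)"
    using w(3) l by (auto simp: P_Q_R_def Aw_G Perms_def add_ac)
  have e0: "Aw w v0 = P" and e1: "Aw w v1 = midpoint P Q" and e2: "Aw w v2 = (1/3) *\<^sub>R (P + Q + R)"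
    by (simp_all add: w l Aw_snoc A_vtx P_Q_R_def Aw_midpoint G[unfolded P_Q_R_def])
  have "P - midpoint P Q = (1/2) *\<^sub>R (P - Q)"
    by (simp add: midpoint_def vec_eq_iff field_simps)
  then have "norm (P - midpoint P Q) \<le> 1/2 * D" using d by simp
  then have d01: "dist (Aw w v0) (Aw w v1) \<le> 2/3 * D"
    unfolding e0 e1 dist_norm using D0 by linarith
  have "P - (1/3) *\<^sub>R (P + Q + R) = (1/3) *\<^sub>R ((P - Q) + (P - R))"
    by (simp add: vec_eq_iff field_simps)
  then have "norm (P - (1/3) *\<^sub>R (P + Q + R)) = 1/3 * norm ((P - Q) + (P - R))"
    by (simp only: norm_scaleR; simp)
  then have d02: "dist (Aw w v0) (Aw w v2) \<le> 2/3 * D"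
    unfolding e0 e2 dist_norm using d norm_triangle_ineq[of "P - Q" "P - R"] by linarith
  have "midpoint P Q - (1/3) *\<^sub>R (P + Q + R) = (1/6) *\<^sub>R ((P - R) + (Q - R))"
    by (simp add: midpoint_def vec_eq_iff field_simps)
  then have "norm (midpoint P Q - (1/3) *\<^sub>R (P + Q + R)) = 1/6 * norm ((P - R) + (Q - R))"
    by (simp only: norm_scaleR; simp)
  then have "norm (midpoint P Q - (1/3) *\<^sub>R (P + Q + R)) \<le> 1/3 * D"
    using d norm_triangle_ineq[of "P - R" "Q - R"] by linarith
  then have d12: "dist (Aw w v1) (Aw w v2) \<le> 2/3 * D"
    unfolding e1 e2 dist_norm using D0 by linarith
  have "dist (Aw w (vtx a)) (Aw w (vtx b)) \<le> 2/3 * D"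
    using D0 d01 d02 d12 d01[unfolded dist_commute[of "Aw w v0"]] d02[unfolded dist_commute[of "Aw w v0"]]
      d12[unfolded dist_commute[of "Aw w v1"]] Suc.prems(2,3)
    unfolding less_3_cases by (elim disjE) simp_all
  then show ?case by (simp add: D_def mult.assoc)
qed

lemma mesh:
  "\<exists>K. \<forall>n. \<forall>w\<in>words n. \<forall>p\<in>T. \<forall>q\<in>T. dist (Aw w p) (Aw w q) \<le> (2/3) ^ n * K"
proof -
  let ?K = "dist v0 v1 + dist v0 v2 + dist v1 v2"
  have "dist (Aw w p) (Aw w q) \<le> (2/3) ^ n * (2 * ?K)" if w: "w \<in> words n" and pq: "p \<in> T" "q \<in> T" for w n p q
  proof -
    let ?D = "(2/3) ^ n * ?K"
    have *: "dist (Aw w v0) (Aw w p) \<le> ?D" if "p \<in> T" for p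
    proof -
      have "Aw w ` tri \<subseteq> cball (Aw w v0) ?D"
        using mesh_vertices[OF w, of 0 0] mesh_vertices[OF w, of 0 1] mesh_vertices[OF w, of 0 2]
        unfolding tri_def by simp
      then have "convex hull (Aw w ` tri) \<subseteq> cball (Aw w v0) ?D"
        by (simp add: subset_hull)
      then show ?thesis using that unfolding hull_Aw by auto
    qed
    have "dist (Aw w p) (Aw w q) \<le> ?D + ?D"
      using *[OF pq(1)] *[OF pq(2)] dist_triangle3[of "Aw w p" "Aw w q" "Aw w v0"] by linarith
    then show ?thesis by (simp add: algebra_simps)
  qed
  then show ?thesis by blast
qed

section \<open>Functions of small variation along the edges\<close>

text \<open>The cells of one level form a finite closed cover.\<close>
lemma glue_continuous:
  fixes F :: "real^2 \<Rightarrow> 'b::topological_space"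
  assumes "\<And>w. w \<in> words n \<Longrightarrow> continuous_on T (\<lambda>p. F (Aw w p))"
  shows "continuous_on T F"
proof (subst continuous_on_closed_invariant, intro allI impI)
  fix B :: "'b set" assume B: "closed B"
  let ?C = "\<lambda>w. Aw w ` (T \<inter> (\<lambda>p. F (Aw w p)) -` B)"
  have "compact (?C w)" if "w \<in> words n" for w
  proof (rule compact_continuous_image[OF continuous_on_Aw])
    have "closed (T \<inter> (\<lambda>p. F (Aw w p)) -` B)"
      using continuous_closed_preimage[OF assms[OF that] compact_imp_closed[OF compact_T] B] .
    then show "compact (T \<inter> (\<lambda>p. F (Aw w p)) -` B)"
      using compact_Int_closed[OF compact_T] by (metis Int_left_absorb)
  qed
  then have "closed (\<Union>w\<in>words n. ?C w)"
    by (intro compact_imp_closed compact_UN) auto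
  moreover have "(\<Union>w\<in>words n. ?C w) \<inter> T = F -` B \<inter> T"
  proof (intro equalityI subsetI)
    fix q assume "q \<in> (\<Union>w\<in>words n. ?C w) \<inter> T"
    then show "q \<in> F -` B \<inter> T" by auto
  next
    fix q assume q: "q \<in> F -` B \<inter> T"
    then obtain w p where "w \<in> words n" "p \<in> T" "q = Aw w p" using T_cover_words by blast
    with q show "q \<in> (\<Union>w\<in>words n. ?C w) \<inter> T" by auto
  qed
  ultimately show "\<exists>C. closed C \<and> C \<inter> T = F -` B \<inter> T" by blast
qed

text \<open>
  This folds the six children onto \<open>T\<close>; on the common faces of children the foldings agree.
\<close>
definition expand :: "real^2 \<Rightarrow> real^2" where
  "expand q = (SOME p. p \<in> T \<and> (\<exists>l\<in>Perms. q = A l p))"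

lemma expand_A:
  assumes "l \<in> Perms" "p \<in> T"
  shows "expand (A l p) = p"
proof -
  have "expand (A l p) \<in> T \<and> (\<exists>l'\<in>Perms. A l p = A l' (expand (A l p)))"
    unfolding expand_def by (rule someI[of _ p]) (use assms in auto)
  then obtain l' where l': "l' \<in> Perms" "A l p = A l' (expand (A l p))" "expand (A l p) \<in> T" by blast
  obtain x y z x' y' z' where e: "l = (x, y, z)" "l' = (x', y', z')" by (cases l, cases l')
  show ?thesis
    using A_unique(1)[OF assms(1)[unfolded e] l'(1)[unfolded e] assms(2) l'(3)] l'(2) unfolding e by simp
qed

lemma expand_funpow:
  assumes "w \<in> words n" "p \<in> T"
  shows "(expand ^^ n) (Aw w p) = p"
  using assms
proof (induction n arbitrary: w)
  case (Suc n)
  from Suc.prems(1) obtain l u where w: "w = l # u" "u \<in> words n" "l \<in> Perms"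
    by (rule words_Suc_ConsE)
  then show ?case
    using Suc.IH[OF w(2) Suc.prems(2)] expand_A[OF w(3) Aw_in_T[OF w(2) Suc.prems(2)]]
    by (simp add: funpow_Suc_right del: funpow.simps)
qed simp

text \<open>
  For \<open>k \<rightarrow> \<infinity>\<close> these functions will converge to a function \<open>h a\<close> that models the distance from
  the vertex \<open>a\<close>. In a child at the vertex \<open>a\<close>, where the coordinate of \<open>a\<close> is the largest, the
  model is half of the distance from the first vertex of the child. Where the coordinate of \<open>a\<close>
  is the smallest, a path from \<open>a\<close> may run to the barycenter, which costs \<open>1/2\<close>, and then into
  the child. In the other two children \<open>a\<close> is joined by an edge with the first vertex of the
  child, from whose distance the value is found by subtraction.
\<close>
primrec H :: "nat \<Rightarrow> nat \<Rightarrow> real^2 \<Rightarrow> real" where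
  "H 0 a q = 1 - bc a q"
| "H (Suc k) a q =
    (if \<forall>b<3. bc b q \<le> bc a q then H k 0 (expand q) / 2
     else if \<forall>b<3. bc a q \<le> bc b q then 1/2 + H k 2 (expand q) / 2
     else 1 - H k 0 (expand q) / 2)"

declare H.simps(2) [simp del]

text \<open>
  These properties are inherited from \<open>H k\<close> to \<open>H (Suc k)\<close>, and they make the cases in the
  definition of \<^const>\<open>H\<close> agree where two children meet.
\<close>
definition vertex_fun :: "(nat \<Rightarrow> real^2 \<Rightarrow> real) \<Rightarrow> bool" where
  "vertex_fun g \<longleftrightarrow>
     (\<forall>a<3. \<forall>p\<in>T. 0 \<le> g a p \<and> g a p \<le> 1 \<and> (bc a p = 0 \<longrightarrow> g a p = 1)) \<and>
     (\<forall>a<3. g a (vtx a) = 0) \<and>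
     (\<forall>p\<in>T. bc 1 p = 0 \<longrightarrow> g 0 p + g 2 p = 1)"

lemma vertex_funD:
  assumes "vertex_fun g"
  shows "a < 3 \<Longrightarrow> p \<in> T \<Longrightarrow> 0 \<le> g a p" "a < 3 \<Longrightarrow> p \<in> T \<Longrightarrow> g a p \<le> 1"
    "a < 3 \<Longrightarrow> p \<in> T \<Longrightarrow> bc a p = 0 \<Longrightarrow> g a p = 1" "a < 3 \<Longrightarrow> g a (vtx a) = 0"
    "p \<in> T \<Longrightarrow> bc 1 p = 0 \<Longrightarrow> g 0 p + g 2 p = 1"
  using assms by (auto simp: vertex_fun_def)

text \<open>
  Ties between the coordinates make several cases of the definition applicable. They occur where
  \<open>bc 0 p\<close> or \<open>bc 1 p\<close> vanishes, and there \<^const>\<open>vertex_fun\<close> forces the cases to agree.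
\<close>
lemma H_A:
  assumes g: "vertex_fun (H k)" and P: "(x, y, z) \<in> Perms" and p: "p \<in> T"
  shows "H (Suc k) x (A (x, y, z) p) = H k 0 p / 2"
    "H (Suc k) y (A (x, y, z) p) = 1 - H k 0 p / 2"
    "H (Suc k) z (A (x, y, z) p) = 1/2 + H k 2 p / 2"
proof -
  let ?q = "A (x, y, z) p"
  note bcA = bc_A[OF P, of p]
  have pos: "bc 0 p \<ge> 0" "bc 1 p \<ge> 0" "bc 2 p \<ge> 0" using p by (auto simp: T_iff)
  note f = expand_A[OF P p]
  have max: "(\<forall>b<3. bc b ?q \<le> bc a ?q) \<longleftrightarrow> bc x ?q \<le> bc a ?q \<and> bc y ?q \<le> bc a ?q \<and> bc z ?q \<le> bc a ?q" for a
    by (rule Perms_all3[OF P])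
  have min: "(\<forall>b<3. bc a ?q \<le> bc b ?q) \<longleftrightarrow> bc a ?q \<le> bc x ?q \<and> bc a ?q \<le> bc y ?q \<and> bc a ?q \<le> bc z ?q" for a
    by (rule Perms_all3[OF P])
  have one: "H k 0 p = 1" if "bc 0 p = 0" using vertex_funD(3)[OF g, of 0] that p by simp
  have sum: "H k 0 p + H k 2 p = 1" if "bc 1 p = 0" using vertex_funD(5)[OF g] that p by simp
  have "\<forall>b<3. bc b ?q \<le> bc x ?q" unfolding max using bcA pos by simp
  then show "H (Suc k) x ?q = H k 0 p / 2" by (simp add: f H.simps(2))
  have "bc 0 p = 0" if "\<forall>b<3. bc b ?q \<le> bc y ?q" using that[unfolded max] bcA pos by simp
  moreover have "bc 1 p = 0" if "\<forall>b<3. bc y ?q \<le> bc b ?q" using that[unfolded min] bcA pos by simp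
  ultimately show "H (Suc k) y ?q = 1 - H k 0 p / 2"
    using one sum by (auto simp: f H.simps(2))
  have "bc 0 p = 0 \<and> bc 1 p = 0" if "\<forall>b<3. bc b ?q \<le> bc z ?q" using that[unfolded max] bcA pos by simp
  moreover have "\<forall>b<3. bc z ?q \<le> bc b ?q" unfolding min using bcA pos by simp
  ultimately show "H (Suc k) z ?q = 1/2 + H k 2 p / 2"
    using one sum by (auto simp: f H.simps(2))
qed

lemma vertex_fun_H: "vertex_fun (H k)"
proof (induction k)
  case 0
  have "H 0 0 p + H 0 2 p = 1" if "bc 1 p = 0" for p using bc_sum[of p] that by simp
  moreover have "0 \<le> H 0 a p \<and> H 0 a p \<le> 1 \<and> (bc a p = 0 \<longrightarrow> H 0 a p = 1)" if "a < 3" "p \<in> T" for a p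
    using bc_le_1[OF that(2,1)] bc_nonneg[OF that(2,1)] by simp
  moreover have "H 0 a (vtx a) = 0" if "a < 3" for a using bc_vtx'[OF that that] by simp
  ultimately show ?case unfolding vertex_fun_def by blast
next
  case (Suc k)
  note D = vertex_funD[OF Suc]
  have main: "0 \<le> H (Suc k) a q \<and> H (Suc k) a q \<le> 1 \<and> (bc a q = 0 \<longrightarrow> H (Suc k) a q = 1) \<and>
      (bc 1 q = 0 \<longrightarrow> H (Suc k) 0 q + H (Suc k) 2 q = 1)" if a: "a < 3" and q: "q \<in> T" for a q
  proof -
    obtain l p where l: "l \<in> Perms" "p \<in> T" "q = A l p" using T_cover[OF q] .
    obtain x y z where xyz: "l = (x, y, z)" by (cases l)
    note P = l(1)[unfolded xyz]
    note HA = H_A[OF Suc P l(2)] and bcA = bc_A[OF P, of p]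
    have pos: "bc 0 p \<ge> 0" "bc 1 p \<ge> 0" "bc 2 p \<ge> 0" using l(2) by (auto simp: T_iff)
    note s = bc_sum[of p]
    have r0: "0 \<le> H k 0 p" "H k 0 p \<le> 1" and r2: "0 \<le> H k 2 p" "H k 2 p \<le> 1" using D(1,2) l(2) by auto
    have two: "H k 2 p = 1" if "bc 2 p = 0" using D(3)[of 2] that l(2) by simp
    have sum: "H k 0 p + H k 2 p = 1" if "bc 1 p = 0" using D(5) that l(2) by simp
    have qx: "bc x q > 0" using bcA pos s unfolding l(3) xyz by linarith
    have qy: "H k 0 p = 0 \<and> H k 2 p = 1" if "bc y q = 0"
    proof -
      have "bc 1 p = 0" "bc 2 p = 0" using that bcA pos unfolding l(3) xyz by linarith+
      then show ?thesis using two sum by simp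
    qed
    have qz: "H k 2 p = 1" if "bc z q = 0"
      using two that bcA unfolding l(3) xyz by simp
    have Hx: "H (Suc k) x q = H k 0 p / 2" and Hy: "H (Suc k) y q = 1 - H k 0 p / 2"
      and Hz: "H (Suc k) z q = 1/2 + H k 2 p / 2" using HA unfolding l(3) xyz by auto
    have "a = x \<or> a = y \<or> a = z" using Perms_cover[OF P a] .
    then have "0 \<le> H (Suc k) a q \<and> H (Suc k) a q \<le> 1 \<and> (bc a q = 0 \<longrightarrow> H (Suc k) a q = 1)"
      using qx qy qz r0 r2 by (elim disjE) (simp_all only: Hx Hy Hz, auto)
    moreover have "H (Suc k) 0 q + H (Suc k) 2 q = 1" if "bc 1 q = 0"
    proof -
      consider "1 = x" | "1 = y" "{0, 2} = {x, z}" | "1 = z" "{0, 2} = {x, y}"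
        using P by (auto simp: Perms_def)
      then show ?thesis
      proof cases
        case 1
        then show ?thesis using qx that by simp
      next
        case 2
        then have "H (Suc k) 0 q + H (Suc k) 2 q = H (Suc k) x q + H (Suc k) z q"
          by (auto simp: doubleton_eq_iff)
        then show ?thesis using Hx Hz qy that 2 by simp
      next
        case 3
        then have "H (Suc k) 0 q + H (Suc k) 2 q = H (Suc k) x q + H (Suc k) y q"
          by (auto simp: doubleton_eq_iff)
        then show ?thesis using Hx Hy by simp
      qed
    qed
    ultimately show ?thesis by blast
  qed
  have "H (Suc k) a (vtx a) = 0" if a: "a < 3" for a
  proof -
    obtain b where "b < 3" "a \<noteq> b" using a by (metis less_3_cases zero_neq_one)
    then obtain c where P: "(a, b, c) \<in> Perms" using third_vertex[OF a] by blast
    show ?thesis using H_A(1)[OF Suc P, of v0] D(4)[of 0] by (simp add: A_vtx)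
  qed
  moreover have "H (Suc k) 0 q + H (Suc k) 2 q = 1" if "q \<in> T" "bc 1 q = 0" for q
    using main[of 0 q] that by simp
  ultimately show ?case using main unfolding vertex_fun_def by blast
qed

lemma H_increment:
  assumes "a < 3" "q \<in> T"
  shows "\<bar>H (Suc k) a q - H k a q\<bar> \<le> (1/2) ^ k"
  using assms
proof (induction k arbitrary: a q)
  case 0
  then show ?case
    using vertex_funD(1,2)[OF vertex_fun_H, of a q 0] vertex_funD(1,2)[OF vertex_fun_H, of a q 1]
    by simp
next
  case (Suc k)
  obtain l p where l: "l \<in> Perms" "p \<in> T" "q = A l p" using T_cover[OF Suc.prems(2)] .
  obtain x y z where xyz: "l = (x, y, z)" by (cases l)
  note P = l(1)[unfolded xyz]
  note H1 = H_A[OF vertex_fun_H[of k] P l(2)] and H2 = H_A[OF vertex_fun_H[of "Suc k"] P l(2)]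
  have "a = x \<or> a = y \<or> a = z" using Perms_cover[OF P Suc.prems(1)] .
  then show ?case
    using Suc.IH[OF _ l(2), of 0] Suc.IH[OF _ l(2), of 2] unfolding l(3) xyz
    by (elim disjE) (simp_all only: H1 H2, auto simp: abs_if split: if_splits)
qed

lemma H_continuous: "a < 3 \<Longrightarrow> continuous_on T (H k a)"
proof (induction k arbitrary: a)
  case 0
  have "H 0 a = (\<lambda>q. 1 - bc a q)" by (simp add: fun_eq_iff)
  then show ?case by (simp add: continuous_intros)
next
  case (Suc k)
  show ?case
  proof (rule glue_continuous[of 1])
    fix w assume "w \<in> words 1"
    then obtain x y z where w: "w = [(x, y, z)]" "(x, y, z) \<in> Perms"
      by (auto simp: words_Cons elim!: words_Suc_ConsE[of _ 0, simplified])
    note HA = H_A[OF vertex_fun_H w(2)]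
    have "a = x \<or> a = y \<or> a = z" using Perms_cover[OF w(2) Suc.prems] .
    moreover have "continuous_on T (H k 0)" "continuous_on T (H k 2)" using Suc.IH by auto
    ultimately show "continuous_on T (\<lambda>p. H (Suc k) a (Aw w p))"
      by (elim disjE) (auto simp: w(1) HA cong: continuous_on_cong intro!: continuous_intros)
  qed
qed

definition h :: "nat \<Rightarrow> real^2 \<Rightarrow> real" where
  "h a q = H 0 a q + (\<Sum>k. H (Suc k) a q - H k a q)"

lemma H_uniform_limit:
  assumes a: "a < 3"
  shows "uniform_limit T (\<lambda>k. H k a) (h a) sequentially"
proof -
  have "uniform_limit T (\<lambda>n q. \<Sum>i<n. H (Suc i) a q - H i a q) (\<lambda>q. \<Sum>i. H (Suc i) a q - H i a q) sequentially"
  proof (rule Weierstrass_m_test)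
    show "norm (H (Suc n) a q - H n a q) \<le> (1/2) ^ n" if "q \<in> T" for n q
      using H_increment[OF a that] by simp
    show "summable (\<lambda>n. (1/2::real) ^ n)" by (simp add: summable_geometric)
  qed
  then have "uniform_limit T (\<lambda>n q. H 0 a q + (\<Sum>i<n. H (Suc i) a q - H i a q)) (\<lambda>q. h a q) sequentially"
    unfolding h_def by (intro uniform_limit_add uniform_limit_const)
  moreover have "H 0 a q + (\<Sum>i<n. H (Suc i) a q - H i a q) = H n a q" for n q
    by (subst sum_lessThan_telescope) simp
  ultimately show ?thesis by simp
qed

lemma h_continuous: "a < 3 \<Longrightarrow> continuous_on T (h a)"
  by (rule uniform_limit_theorem[OF _ H_uniform_limit]) (auto intro!: always_eventually H_continuous)

lemma H_tendsto: "a < 3 \<Longrightarrow> q \<in> T \<Longrightarrow> (\<lambda>k. H k a q) \<longlonglongrightarrow> h a q"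
  by (rule tendsto_uniform_limitI[OF H_uniform_limit])

lemma h_A:
  assumes P: "(x, y, z) \<in> Perms" and p: "p \<in> T"
  shows "h x (A (x, y, z) p) = h 0 p / 2"
    "h y (A (x, y, z) p) = 1 - h 0 p / 2"
    "h z (A (x, y, z) p) = 1/2 + h 2 p / 2"
proof -
  note HA = H_A[OF vertex_fun_H P p]
  note q = A_in_T[OF P p] and lt = Perms_less3[OF P]
  note L = LIMSEQ_unique[OF LIMSEQ_Suc[OF H_tendsto[OF _ q]]]
  show "h x (A (x, y, z) p) = h 0 p / 2"
    by (rule L) (use lt p in \<open>auto simp: HA intro!: tendsto_intros H_tendsto\<close>)
  show "h y (A (x, y, z) p) = 1 - h 0 p / 2"
    by (rule L) (use lt p in \<open>auto simp: HA intro!: tendsto_intros H_tendsto\<close>)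
  show "h z (A (x, y, z) p) = 1/2 + h 2 p / 2"
    by (rule L) (use lt p in \<open>auto simp: HA intro!: tendsto_intros H_tendsto\<close>)
qed

lemma h_nonneg: "a < 3 \<Longrightarrow> q \<in> T \<Longrightarrow> 0 \<le> h a q"
  by (rule LIMSEQ_le_const[OF H_tendsto]) (auto intro!: exI[of _ 0] vertex_funD(1)[OF vertex_fun_H])

lemma h_le_1: "a < 3 \<Longrightarrow> q \<in> T \<Longrightarrow> h a q \<le> 1"
  by (rule LIMSEQ_le_const2[OF H_tendsto]) (auto intro!: exI[of _ 0] vertex_funD(2)[OF vertex_fun_H])

lemma h_opposite: "a < 3 \<Longrightarrow> q \<in> T \<Longrightarrow> bc a q = 0 \<Longrightarrow> h a q = 1"
  using LIMSEQ_unique[OF H_tendsto[of a q], of 1] vertex_funD(3)[OF vertex_fun_H, of a q]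
  by simp

lemma h_vtx: "a < 3 \<Longrightarrow> h a (vtx a) = 0"
  using LIMSEQ_unique[OF H_tendsto[of a "vtx a"], of 0] vertex_funD(4)[OF vertex_fun_H, of a]
  by simp

lemma h_small:
  assumes "q \<in> T"
  obtains a where "a < 3" "h a q \<le> 1/2"
proof -
  obtain l p where l: "l \<in> Perms" "p \<in> T" "q = A l p" using T_cover[OF assms] .
  obtain x y z where xyz: "l = (x, y, z)" by (cases l)
  have "h x q \<le> 1/2" using h_A(1)[OF l(1)[unfolded xyz] l(2)] h_le_1[of 0 p] l xyz by simp
  then show ?thesis using that[of x] Perms_less3 l(1) xyz by blast
qed

lemma h_edges:
  assumes "w \<in> words n" "a < 3" "b < 3" "c < 3"
  shows "\<bar>h c (Aw w (vtx a)) - h c (Aw w (vtx b))\<bar> \<le> (1/2) ^ n"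
  using assms
proof (induction n arbitrary: w c)
  case 0
  then show ?case using h_nonneg[of c "vtx a"] h_nonneg[of c "vtx b"] h_le_1[of c "vtx a"] h_le_1[of c "vtx b"]
    by simp
next
  case (Suc n)
  obtain l u where w: "w = l # u" "u \<in> words n" "l \<in> Perms" using words_Suc_ConsE Suc.prems(1) by blast
  obtain x y z where xyz: "l = (x, y, z)" by (cases l)
  note P = w(3)[unfolded xyz]
  note hA = h_A[OF P Aw_in_T[OF w(2)], of "vtx a"] h_A[OF P Aw_in_T[OF w(2)], of "vtx b"]
  note IH = Suc.IH[OF w(2) Suc.prems(2,3), of 0] Suc.IH[OF w(2) Suc.prems(2,3), of 2]
  have "c = x \<or> c = y \<or> c = z" using Perms_cover[OF P Suc.prems(4)] .
  then show ?case
    using IH hA unfolding w(1) xyz Aw.simps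
    by (elim disjE) (auto simp: abs_if split: if_splits)
qed

text \<open>
  The 1-Lipschitz functions of the distance that will be constructed, described without
  mentioning it.
\<close>
definition Lip :: "(real^2 \<Rightarrow> real) \<Rightarrow> bool" where
  "Lip F \<longleftrightarrow> continuous_on T F \<and>
     (\<forall>n. \<forall>w\<in>words n. \<forall>a<3. \<forall>b<3. \<bar>F (Aw w (vtx a)) - F (Aw w (vtx b))\<bar> \<le> (1/2) ^ n)"

lemma LipI:
  assumes "continuous_on T F"
    "\<And>n w a b. w \<in> words n \<Longrightarrow> a < 3 \<Longrightarrow> b < 3 \<Longrightarrow> \<bar>F (Aw w (vtx a)) - F (Aw w (vtx b))\<bar> \<le> (1/2) ^ n"
  shows "Lip F"
  using assms by (simp add: Lip_def)

lemma LipD: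
  assumes "Lip F"
  shows "continuous_on T F"
    "w \<in> words n \<Longrightarrow> a < 3 \<Longrightarrow> b < 3 \<Longrightarrow> \<bar>F (Aw w (vtx a)) - F (Aw w (vtx b))\<bar> \<le> (1/2) ^ n"
  using assms by (auto simp: Lip_def)

text \<open>
  A scaled copy of \<open>h a\<close> on the cells of level \<open>n\<close> that have \<open>v\<close> as vertex number \<open>a\<close>, extended
  to the other cells by the value that it takes on the sides opposite to \<open>v\<close>.
\<close>
definition bump :: "nat \<Rightarrow> nat \<Rightarrow> real^2 \<Rightarrow> real^2 \<Rightarrow> real" where
  "bump n a v q = (1/2) ^ n *
     (if \<exists>w\<in>words n. q \<in> Aw w ` T \<and> Aw w (vtx a) = v then h a ((expand ^^ n) q) else 1)"

text \<open>
  A point shared by a cell at \<open>v\<close> and another cell lies opposite to \<open>v\<close>, where \<open>h a\<close> is \<open>1\<close>.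
\<close>
lemma bump_Aw:
  assumes w: "w \<in> words n" and p: "p \<in> T" and a: "a < 3"
  shows "bump n a v (Aw w p) = (1/2) ^ n * (if Aw w (vtx a) = v then h a p else 1)"
proof (cases "Aw w (vtx a) = v")
  case True
  then show ?thesis using w p expand_funpow[OF w p] by (auto simp: bump_def)
next
  case False
  have "h a p = 1" if w': "w' \<in> words n" and "Aw w p \<in> Aw w' ` T" and v: "Aw w' (vtx a) = v" for w'
  proof -
    from that(2) obtain p' where p': "p' \<in> T" "Aw w p = Aw w' p'" by blast
    have "\<not> bc a p > 0"
      using Aw_unique[OF w w' p p'] False v a by auto
    then show ?thesis using bc_nonneg[OF p a] h_opposite[OF a p] by simp
  qed
  then show ?thesis using False expand_funpow[OF w p] by (auto simp: bump_def)
qed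

lemma bump_in_T:
  assumes "q \<in> T" "a < 3"
  shows "0 \<le> bump n a v q" "bump n a v q \<le> (1/2) ^ n"
proof -
  obtain w p where w: "w \<in> words n" "p \<in> T" "q = Aw w p" using T_cover_words[OF assms(1)] .
  show "0 \<le> bump n a v q" "bump n a v q \<le> (1/2) ^ n"
    unfolding w(3) bump_Aw[OF w(1,2) assms(2)] using h_nonneg[OF assms(2) w(2)] h_le_1[OF assms(2) w(2)] by auto
qed

lemma Lip_bump:
  assumes a: "a < 3"
  shows "Lip (bump n a v)"
proof (rule LipI)
  show "continuous_on T (bump n a v)"
  proof (rule glue_continuous)
    fix w assume w: "w \<in> words n"
    show "continuous_on T (\<lambda>p. bump n a v (Aw w p))"
      using h_continuous[OF a] bump_Aw[OF w _ a]
      by (cases "Aw w (vtx a) = v") (auto cong: continuous_on_cong intro!: continuous_intros)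
  qed
next
  fix m w b c assume w: "w \<in> words m" and b: "b < (3::nat)" and c: "c < (3::nat)"
  show "\<bar>bump n a v (Aw w (vtx b)) - bump n a v (Aw w (vtx c))\<bar> \<le> (1/2) ^ m"
  proof (cases "m \<le> n")
    case True
    have "Aw w (vtx b) \<in> T" "Aw w (vtx c) \<in> T" using Aw_in_T[OF w] by auto
    then have "\<bar>bump n a v (Aw w (vtx b)) - bump n a v (Aw w (vtx c))\<bar> \<le> (1/2) ^ n"
      using bump_in_T[of "Aw w (vtx b)" a n v] bump_in_T[of "Aw w (vtx c)" a n v] a by (simp add: abs_le_iff)
    also have "\<dots> \<le> (1/2) ^ m" using True by (intro power_decreasing) auto
    finally show ?thesis .
  next
    case False
    then obtain k where m: "m = n + k" by (metis less_eqE nle_le)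
    obtain u u' where u: "w = u @ u'" "u \<in> words n" "u' \<in> words k"
      using words_splitE w unfolding m by blast
    have "bump n a v (Aw w p) = (1/2) ^ n * (if Aw u (vtx a) = v then h a (Aw u' p) else 1)" if "p \<in> T" for p
      unfolding u(1) Aw_append by (rule bump_Aw[OF u(2) Aw_in_T[OF u(3) that] a])
    then have "\<bar>bump n a v (Aw w (vtx b)) - bump n a v (Aw w (vtx c))\<bar>
        \<le> (1/2) ^ n * \<bar>h a (Aw u' (vtx b)) - h a (Aw u' (vtx c))\<bar>"
      by (auto simp flip: right_diff_distrib simp: abs_mult)
    also have "\<dots> \<le> (1/2) ^ n * (1/2) ^ k" using h_edges[OF u(3) b c a] by (intro mult_left_mono) auto
    finally show ?thesis by (simp add: m power_add)
  qed
qed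

lemma Lip_cell:
  assumes F: "Lip F" and w: "w \<in> words n"
  shows "Lip (\<lambda>p. 2 ^ n * F (Aw w p))"
proof (rule LipI)
  have "continuous_on T (\<lambda>p. F (Aw w p))"
    by (rule continuous_on_compose2[OF LipD(1)[OF F] continuous_on_Aw]) (use Aw_in_T[OF w] in blast)
  then show "continuous_on T (\<lambda>p. 2 ^ n * F (Aw w p))" by (intro continuous_intros)
  fix m u a b assume u: "u \<in> words m" "a < (3::nat)" "b < (3::nat)"
  have "\<bar>F (Aw w (Aw u (vtx a))) - F (Aw w (Aw u (vtx b)))\<bar> \<le> (1/2) ^ (n + m)"
    using LipD(2)[OF F words_append[OF w u(1)] u(2,3)] by (simp add: Aw_append)
  then have "2 ^ n * \<bar>F (Aw w (Aw u (vtx a))) - F (Aw w (Aw u (vtx b)))\<bar> \<le> 2 ^ n * (1/2) ^ (n + m)"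
    by (intro mult_left_mono) auto
  then show "\<bar>2 ^ n * F (Aw w (Aw u (vtx a))) - 2 ^ n * F (Aw w (Aw u (vtx b)))\<bar> \<le> (1/2) ^ m"
    by (simp add: power_add power_one_over abs_mult flip: right_diff_distrib)
qed

text \<open>
  Along an edge of level \<open>Suc n\<close> the folded function runs through half of the values of \<open>F\<close>
  along an edge of level \<open>n\<close>; an edge of level \<open>0\<close> consists of two edges of level \<open>1\<close>.
\<close>
lemma Lip_expand:
  assumes F: "Lip F"
  shows "Lip (\<lambda>q. F (expand q) / 2)"
proof (rule LipI)
  show "continuous_on T (\<lambda>q. F (expand q) / 2)"
  proof (rule glue_continuous[of 1])
    fix w assume "w \<in> words 1"
    then obtain l where w: "w = [l]" "l \<in> Perms" by (auto elim!: words_Suc_ConsE[of _ 0, simplified])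
    have "continuous_on T (\<lambda>q. F q / 2)" using LipD(1)[OF F] by (intro continuous_intros) auto
    then show "continuous_on T (\<lambda>p. F (expand (Aw w p)) / 2)"
      using expand_A[OF w(2)] w(1) by (simp cong: continuous_on_cong)
  qed
next
  have pos: "\<bar>F (expand (Aw w (vtx a))) / 2 - F (expand (Aw w (vtx b))) / 2\<bar> \<le> (1/2) ^ n"
    if w: "w \<in> words n" and n: "n \<ge> 1" and ab: "a < 3" "b < 3" for w n a b
  proof -
    obtain m where m: "n = Suc m" using n by (cases n) auto
    obtain l u where u: "w = l # u" "u \<in> words m" "l \<in> Perms" using words_Suc_ConsE w m by metis
    then show ?thesis
      using LipD(2)[OF F u(2) ab] expand_A[OF u(3) Aw_in_T[OF u(2)]] m by (simp add: abs_if split: if_splits)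
  qed
  fix n w a b assume w: "w \<in> words n" and ab: "a < (3::nat)" "b < (3::nat)"
  show "\<bar>F (expand (Aw w (vtx a))) / 2 - F (expand (Aw w (vtx b))) / 2\<bar> \<le> (1/2) ^ n"
  proof (cases n)
    case 0
    show ?thesis
    proof (cases "a = b")
      case False
      then obtain c where P: "(a, b, c) \<in> Perms" "(b, a, c) \<in> Perms"
        using third_vertex[OF ab] by (metis Perms_iff)
      have W: "[(a, b, c)] \<in> words 1" "[(b, a, c)] \<in> words 1" using P by (auto simp: words_Cons)
      have "\<bar>F (expand (vtx a)) / 2 - F (expand (midpoint (vtx a) (vtx b))) / 2\<bar> \<le> 1/2"
        using pos[OF W(1), of 0 1] by (simp add: A_vtx)
      moreover have "\<bar>F (expand (vtx b)) / 2 - F (expand (midpoint (vtx a) (vtx b))) / 2\<bar> \<le> 1/2"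
        using pos[OF W(2), of 0 1] by (simp add: A_vtx midpoint_sym)
      ultimately have "\<bar>F (expand (vtx a)) / 2 - F (expand (vtx b)) / 2\<bar> \<le> 1" by linarith
      then show ?thesis using 0 w by simp
    qed (simp add: 0)
  qed (use pos[OF w _ ab] in auto)
qed

lemma cells_shrink:
  assumes w: "\<And>n. w n \<in> words n" "\<And>n. p n \<in> T" "\<And>n. q = Aw (w n) (p n)" and p': "\<And>n. p' n \<in> T"
  shows "(\<lambda>n. Aw (w n) (p' n)) \<longlonglongrightarrow> q"
proof -
  obtain K where K: "\<And>w n p q. w \<in> words n \<Longrightarrow> p \<in> T \<Longrightarrow> q \<in> T \<Longrightarrow> dist (Aw w p) (Aw w q) \<le> (2/3) ^ n * K"
    using mesh by metis
  have lim: "(\<lambda>n. (2/3) ^ n * K) \<longlonglongrightarrow> 0"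
    by (rule tendsto_mult_left_zero) (rule LIMSEQ_power_zero, simp)
  have "dist (Aw (w n) (p' n)) q \<le> (2/3) ^ n * K" for n
    using K[OF w(1)[of n] p'[of n] w(2)[of n]] w(3)[of n] by simp
  then have "(\<lambda>n. dist (Aw (w n) (p' n)) q) \<longlonglongrightarrow> 0"
    by (intro tendsto_sandwich[OF _ _ tendsto_const lim]) auto
  then show ?thesis by (rule tendsto_dist_iff[THEN iffD2])
qed

text \<open>
  Nested cells shrink to the point \<open>q\<close>, and the first vertices of consecutive cells are equal or
  joined by an edge. The lengths of these edges have the sum \<open>2\<close>.
\<close>
lemma Lip_bound_vertex:
  assumes F: "Lip F" and q: "q \<in> T"
  shows "\<bar>F q - F v0\<bar> \<le> 2"
proof -
  have "\<exists>w p. w \<in> words n \<and> p \<in> T \<and> q = Aw w p \<and> \<bar>F (Aw w v0) - F v0\<bar> \<le> 2 - 2 * (1/2) ^ n" for n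
  proof (induction n)
    case 0
    then show ?case using q by (intro exI[of _ "[]"] exI[of _ q]) simp
  next
    case (Suc n)
    then obtain w p where w: "w \<in> words n" "p \<in> T" "q = Aw w p" "\<bar>F (Aw w v0) - F v0\<bar> \<le> 2 - 2 * (1/2) ^ n" by blast
    obtain l p' where l: "l \<in> Perms" "p' \<in> T" "p = A l p'" using T_cover[OF w(2)] .
    obtain x y z where xyz: "l = (x, y, z)" by (cases l)
    have "\<bar>F (Aw w (vtx x)) - F (Aw w (vtx 0))\<bar> \<le> (1/2) ^ n"
      using LipD(2)[OF F w(1), of x 0] Perms_less3 l(1) xyz by auto
    then have "\<bar>F (Aw (w @ [l]) v0) - F v0\<bar> \<le> 2 - 2 * (1/2) ^ Suc n"
      using w(4) by (simp add: Aw_snoc xyz A_vtx)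
    then show ?case using words_snoc[OF w(1) l(1)] l w by (intro exI[of _ "w @ [l]"] exI[of _ p']) (simp add: Aw_snoc)
  qed
  then obtain w p where w: "\<And>n. w n \<in> words n" "\<And>n. p n \<in> T" "\<And>n. q = Aw (w n) (p n)"
      "\<And>n. \<bar>F (Aw (w n) v0) - F v0\<bar> \<le> 2 - 2 * (1/2) ^ n" by metis
  have "(\<lambda>n. Aw (w n) v0) \<longlonglongrightarrow> q" by (rule cells_shrink[OF w(1-3)]) simp
  then have "(\<lambda>n. F (Aw (w n) v0)) \<longlonglongrightarrow> F q"
    by (intro continuous_on_tendsto_compose[OF LipD(1)[OF F] _ q]) (auto intro!: always_eventually Aw_in_T[OF w(1)])
  then have "(\<lambda>n. \<bar>F (Aw (w n) v0) - F v0\<bar>) \<longlonglongrightarrow> \<bar>F q - F v0\<bar>" by (intro tendsto_intros)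
  moreover have "\<bar>F (Aw (w n) v0) - F v0\<bar> \<le> 2" for n
    using w(4)[of n] by (rule order_trans) simp
  ultimately show ?thesis by (intro LIMSEQ_le_const2) auto
qed

lemma Lip_bound:
  assumes F: "Lip F" and w: "w \<in> words n" and p: "p \<in> T" "q \<in> T"
  shows "\<bar>F (Aw w p) - F (Aw w q)\<bar> \<le> 4 * (1/2) ^ n"
proof -
  have "\<bar>2 ^ n * F (Aw w p) - 2 ^ n * F (Aw w q)\<bar> \<le> 4"
    using Lip_bound_vertex[OF Lip_cell[OF F w] p(1)] Lip_bound_vertex[OF Lip_cell[OF F w] p(2)] by linarith
  then have "2 ^ n * \<bar>F (Aw w p) - F (Aw w q)\<bar> \<le> 4"
    by (simp add: abs_mult flip: right_diff_distrib)
  then show ?thesis by (simp add: field_simps)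
qed

end

section \<open>Paths of constant speed\<close>

lemma sum_dist_sorted:
  fixes ts :: "real list"
  assumes "sorted ts"
  shows "(\<Sum>i<length ts - 1. \<bar>ts ! i - ts ! Suc i\<bar>) = (if ts = [] then 0 else last ts - hd ts)"
proof -
  have "(\<Sum>i<m. \<bar>ts ! i - ts ! Suc i\<bar>) = ts ! m - ts ! 0" if "m < length ts" for m
    using that
  proof (induction m)
    case (Suc m)
    have "ts ! m \<le> ts ! Suc m" using assms Suc.prems by (simp add: sorted_nth_mono)
    then show ?case using Suc by simp
  qed simp
  from this[of "length ts - 1"] show ?thesis by (simp add: hd_conv_nth last_conv_nth)
qed

lemma path_length_linear:
  assumes lin: "\<And>s s'. s \<in> {0..1} \<Longrightarrow> s' \<in> {0..1} \<Longrightarrow> d (g s) (g s') = L * \<bar>s - s'\<bar>"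
    and L: "L \<ge> 0"
  shows "path_length d g = ennreal L"
proof (rule antisym)
  show "path_length d g \<le> ennreal L"
    unfolding path_length_def
  proof (rule SUP_least)
    fix ts :: "real list" assume "ts \<in> {ts. sorted ts \<and> set ts \<subseteq> {0..1}}"
    then have ts: "sorted ts" "set ts \<subseteq> {0..1}" by auto
    have "(\<Sum>i<length ts - 1. d (g (ts ! i)) (g (ts ! Suc i))) = (\<Sum>i<length ts - 1. L * \<bar>ts ! i - ts ! Suc i\<bar>)"
    proof (rule sum.cong[OF refl])
      fix i assume "i \<in> {..<length ts - 1}"
      then have "ts ! i \<in> set ts" "ts ! Suc i \<in> set ts" by auto
      then show "d (g (ts ! i)) (g (ts ! Suc i)) = L * \<bar>ts ! i - ts ! Suc i\<bar>" using lin ts(2) by blast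
    qed
    also have "\<dots> = L * (if ts = [] then 0 else last ts - hd ts)"
      by (simp only: sum_distrib_left[symmetric] sum_dist_sorted[OF ts(1)])
    also have "\<dots> \<le> L * 1"
    proof (intro mult_left_mono L)
      show "(if ts = [] then 0 else last ts - hd ts) \<le> 1"
      proof (cases "ts = []")
        case False
        then have "last ts \<in> {0..1}" "hd ts \<in> {0..1}" using ts(2) last_in_set hd_in_set by blast+
        then show ?thesis using False by auto
      qed simp
    qed
    finally show "ennreal (\<Sum>i<length ts - 1. d (g (ts ! i)) (g (ts ! Suc i))) \<le> ennreal L"
      by (simp add: ennreal_leI)
  qed
  have "ennreal (\<Sum>i<length [0, 1::real] - 1. d (g ([0, 1] ! i)) (g ([0, 1] ! Suc i))) \<le> path_length d g"
    unfolding path_length_def by (rule SUP_upper) simp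
  then show "ennreal L \<le> path_length d g" using lin[of 0 1] by simp
qed

context Metric_space
begin

lemma geodesic_path_linear:
  assumes lin: "\<And>s s'. s \<in> {0..1} \<Longrightarrow> s' \<in> {0..1} \<Longrightarrow> d (g s) (g s') = d x y * \<bar>s - s'\<bar>"
    and g: "g 0 = x" "g 1 = y" "\<And>s. s \<in> {0..1} \<Longrightarrow> g s \<in> M"
  shows "geodesic_path M d g x y"
  unfolding geodesic_path_def
proof (intro conjI g(1,2))
  show "pathin mtopology g"
    unfolding pathin_def continuous_map_to_metric
  proof (intro strip)
    fix s \<epsilon> assume s: "s \<in> topspace (top_of_set {0..1::real})" and \<epsilon>: "0 < (\<epsilon>::real)"
    let ?U = "{0..1} \<inter> ball s (\<epsilon> / (d x y + 1))"
    have pos: "d x y + 1 > 0" by (simp add: add_nonneg_pos)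
    have "g u \<in> mball (g s) \<epsilon>" if u: "u \<in> ?U" for u
    proof -
      have "d (g s) (g u) = d x y * \<bar>s - u\<bar>" using lin s u by auto
      also have "\<dots> \<le> (d x y + 1) * \<bar>s - u\<bar>" by (intro mult_right_mono) auto
      also have "\<dots> < \<epsilon>" using u pos by (simp add: dist_real_def field_simps)
      finally show ?thesis using g(3) s u by auto
    qed
    moreover have "openin (top_of_set {0..1}) ?U" by (simp add: openin_open_Int)
    moreover have "s \<in> ?U" using s \<epsilon> pos by simp
    ultimately show "\<exists>U. openin (top_of_set {0..1}) U \<and> s \<in> U \<and> (\<forall>u\<in>U. g u \<in> mball (g s) \<epsilon>)" by blast
  qed
  show "path_length d g = ennreal (d x y)"
    by (rule path_length_linear) (use lin in auto)
qed

end

lemma ex_power_less: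
  fixes q K e :: real
  assumes "0 \<le> q" "q < 1" "0 < e"
  obtains n where "K * q ^ n < e"
proof -
  have "(\<lambda>n. K * q ^ n) \<longlonglongrightarrow> K * 0" using assms by (intro tendsto_intros LIMSEQ_power_zero) simp
  then have "\<forall>\<^sub>F n in sequentially. K * q ^ n < e" by (rule order_tendstoD(2)) (use assms in simp)
  then show ?thesis using that eventually_happens'[OF sequentially_bot] by blast
qed

context plane_triangle
begin

section \<open>The distance\<close>

text \<open>
  By duality this is the largest distance that is continuous in the plane topology and gives the
  edges of each level \<open>n\<close> at most the length \<open>2\<^sup>-\<^sup>n\<close>.
\<close>
definition dd :: "real^2 \<Rightarrow> real^2 \<Rightarrow> real" where
  "dd x y = (if x \<in> T \<and> y \<in> T then SUP F\<in>{F. Lip F}. \<bar>F x - F y\<bar> else 0)"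

lemma Lip_h: "a < 3 \<Longrightarrow> Lip (h a)"
  by (rule LipI[OF h_continuous h_edges])

lemma dd_upper:
  assumes "Lip F" "x \<in> T" "y \<in> T"
  shows "\<bar>F x - F y\<bar> \<le> dd x y"
proof -
  have "\<bar>F x - F y\<bar> \<le> 4" if "Lip F" for F
    using Lip_bound[OF that, of "[]" 0 x y] assms by simp
  then have "bdd_above ((\<lambda>F. \<bar>F x - F y\<bar>) ` {F. Lip F})" by (intro bdd_aboveI2) auto
  then show ?thesis using assms unfolding dd_def by (auto intro!: cSUP_upper)
qed

lemma dd_least:
  assumes "x \<in> T" "y \<in> T" "\<And>F. Lip F \<Longrightarrow> \<bar>F x - F y\<bar> \<le> r"
  shows "dd x y \<le> r"
proof -
  have "{F. Lip F} \<noteq> {}" using Lip_h[of 0] by auto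
  then show ?thesis using assms unfolding dd_def by (auto intro!: cSUP_least)
qed

lemma dd_nonneg: "0 \<le> dd x y"
proof (cases "x \<in> T \<and> y \<in> T")
  case True
  then show ?thesis using dd_upper[OF Lip_h[of 0], of x y] by simp
qed (auto simp: dd_def)

lemma dd_commute: "dd x y = dd y x"
  unfolding dd_def by (simp add: abs_minus_commute conj_commute)

lemma dd_self: "dd x x = 0"
proof (cases "x \<in> T")
  case True
  then have "dd x x \<le> 0" by (intro dd_least) auto
  then show ?thesis using dd_nonneg[of x x] by simp
qed (simp add: dd_def)

lemma dd_triangle:
  assumes "x \<in> T" "y \<in> T" "z \<in> T"
  shows "dd x z \<le> dd x y + dd y z"
proof (rule dd_least)
  fix F assume "Lip F"
  then show "\<bar>F x - F z\<bar> \<le> dd x y + dd y z"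
    using dd_upper[of F x y] dd_upper[of F y z] assms by linarith
qed (use assms in auto)

text \<open>
  Relative to a small cell around \<open>x\<close>, some vertex is modelled at a distance of at most one half
  from \<open>x\<close>; the \<^const>\<open>bump\<close> around that vertex separates \<open>x\<close> from the points outside its star.
\<close>
lemma dd_pos:
  assumes "x \<in> T" "y \<in> T" "x \<noteq> y"
  shows "dd x y > 0"
proof -
  obtain K where K: "\<And>w n p q. w \<in> words n \<Longrightarrow> p \<in> T \<Longrightarrow> q \<in> T \<Longrightarrow> dist (Aw w p) (Aw w q) \<le> (2/3) ^ n * K"
    using mesh by metis
  obtain n where n: "(2 * K) * (2/3) ^ n < dist x y"
    using ex_power_less[of "2/3" "dist x y" "2 * K"] assms(3) by auto
  obtain w p where w: "w \<in> words n" "p \<in> T" "x = Aw w p" using T_cover_words[OF assms(1)] .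
  obtain u q where u: "u \<in> words n" "q \<in> T" "y = Aw u q" using T_cover_words[OF assms(2)] .
  obtain a where a: "a < 3" "h a p \<le> 1/2" using h_small[OF w(2)] .
  let ?v = "Aw w (vtx a)"
  have "Aw u (vtx a) \<noteq> ?v"
  proof
    assume eq: "Aw u (vtx a) = ?v"
    have "dist x ?v \<le> (2/3) ^ n * K" "dist y ?v \<le> (2/3) ^ n * K"
      using K[OF w(1,2), of "vtx a"] K[OF u(1,2), of "vtx a"] w u eq by auto
    then show False using n dist_triangle2[of x y ?v] by (simp add: algebra_simps)
  qed
  then have "bump n a ?v x \<le> (1/2) ^ n * (1/2)" "bump n a ?v y = (1/2) ^ n"
    using bump_Aw[OF w(1,2) a(1), of ?v] bump_Aw[OF u(1,2) a(1), of ?v] w u a by auto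
  moreover have "(1/2::real) ^ n > 0" by simp
  ultimately have "\<bar>bump n a ?v x - bump n a ?v y\<bar> > 0" by linarith
  then show ?thesis using dd_upper[OF Lip_bump[OF a(1)] assms(1,2), of n ?v] by linarith
qed

lemma Metric_space_dd: "Metric_space T dd"
proof
  show "0 \<le> dd x y" for x y by (rule dd_nonneg)
  show "dd x y = dd y x" for x y by (rule dd_commute)
  show "dd x y = 0 \<longleftrightarrow> x = y" if "x \<in> T" "y \<in> T" for x y
    using dd_pos[OF that] dd_self[of x] by (cases "x = y") auto
  show "dd x z \<le> dd x y + dd y z" if "x \<in> T" "y \<in> T" "z \<in> T" for x y z
    using dd_triangle that .
qed

text \<open>
  Functions on \<open>T\<close> restrict to the child and, by folding, extend from the child to \<open>T\<close>.
\<close>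
lemma dd_A:
  assumes l: "l \<in> Perms" and p: "p \<in> T" "q \<in> T"
  shows "dd (A l p) (A l q) = dd p q / 2"
proof (rule antisym)
  have W: "[l] \<in> words 1" using l by (simp add: words_Cons)
  have AT: "A l p \<in> T" "A l q \<in> T" using A_in_T l p by auto
  show "dd (A l p) (A l q) \<le> dd p q / 2"
  proof (rule dd_least[OF AT])
    fix F assume "Lip F"
    from dd_upper[OF Lip_cell[OF this W] p] show "\<bar>F (A l p) - F (A l q)\<bar> \<le> dd p q / 2"
      by (simp add: abs_if split: if_splits)
  qed
  have "dd p q \<le> 2 * dd (A l p) (A l q)"
  proof (rule dd_least[OF p])
    fix F assume "Lip F"
    from dd_upper[OF Lip_expand[OF this] AT] show "\<bar>F p - F q\<bar> \<le> 2 * dd (A l p) (A l q)"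
      using expand_A[OF l] p by (simp add: abs_if split: if_splits)
  qed
  then show "dd p q / 2 \<le> dd (A l p) (A l q)" by simp
qed

lemma dd_Aw:
  assumes "w \<in> words n" "p \<in> T" "q \<in> T"
  shows "dd (Aw w p) (Aw w q) = (1/2) ^ n * dd p q"
  using assms
proof (induction n arbitrary: w)
  case (Suc n)
  obtain l u where w: "w = l # u" "u \<in> words n" "l \<in> Perms" using words_Suc_ConsE Suc.prems(1) by blast
  then show ?case
    using Suc.IH[OF w(2) Suc.prems(2,3)] dd_A[OF w(3) Aw_in_T Aw_in_T, OF w(2) Suc.prems(2) w(2) Suc.prems(3)]
    by simp
qed simp

lemma dd_le_4: "x \<in> T \<Longrightarrow> y \<in> T \<Longrightarrow> dd x y \<le> 4"
  using Lip_bound[of _ "[]" 0 x y] by (intro dd_least) auto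

lemma dd_cell_le: "w \<in> words n \<Longrightarrow> p \<in> T \<Longrightarrow> q \<in> T \<Longrightarrow> dd (Aw w p) (Aw w q) \<le> 4 * (1/2) ^ n"
  using dd_Aw[of w n p q] dd_le_4[of p q] by simp

lemma dd_vtx:
  assumes "a < 3" "b < 3" "a \<noteq> b"
  shows "dd (vtx a) (vtx b) = 1"
proof (rule antisym)
  show "dd (vtx a) (vtx b) \<le> 1"
    using LipD(2)[of _ "[]" 0 a b] assms by (intro dd_least) auto
  have "h a (vtx b) = 1" using assms by (intro h_opposite) (auto simp: bc_vtx')
  then show "1 \<le> dd (vtx a) (vtx b)"
    using dd_upper[OF Lip_h[OF assms(1)], of "vtx a" "vtx b"] h_vtx[OF assms(1)] by simp
qed

text \<open>A neighbourhood of \<open>x\<close> meets only those cells of level \<open>n\<close> that contain \<open>x\<close>.\<close>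
lemma dd_near:
  assumes x: "x \<in> T" and e: "e > 0"
  shows "\<exists>\<delta>>0. \<forall>y\<in>T. dist x y < \<delta> \<longrightarrow> dd x y < e"
proof -
  obtain n where n: "4 * (1/2::real) ^ n < e" using ex_power_less[of "1/2" e 4] e by auto
  let ?C = "\<Union>w\<in>{w \<in> words n. x \<notin> Aw w ` T}. Aw w ` T"
  have "closed ?C" by (intro closed_UN) (auto simp: closed_cell)
  then have "open (- ?C)" by (rule open_Compl)
  moreover have "x \<in> - ?C" by auto
  ultimately obtain \<delta> where \<delta>: "\<delta> > 0" "ball x \<delta> \<subseteq> - ?C" using openE by blast
  have "dd x y < e" if y: "y \<in> T" "dist x y < \<delta>" for y
  proof -
    obtain w q where w: "w \<in> words n" "q \<in> T" "y = Aw w q" using T_cover_words[OF y(1)] .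
    have "y \<in> ball x \<delta>" using y(2) by simp
    then have "y \<notin> ?C" using \<delta>(2) by blast
    then have "x \<in> Aw w ` T" using w by auto
    then obtain p where "p \<in> T" "x = Aw w p" by blast
    then show ?thesis using dd_cell_le[OF w(1) _ w(2), of p] w(3) n by simp
  qed
  then show ?thesis using \<delta>(1) by blast
qed

lemma mtopology_dd: "Metric_space.mtopology T dd = top_of_set T"
proof -
  interpret Metric_space T dd by (rule Metric_space_dd)
  have "continuous_map (top_of_set T) mtopology id"
    unfolding continuous_map_to_metric
  proof (intro strip)
    fix x e assume x: "x \<in> topspace (top_of_set T)" and e: "0 < (e::real)"
    then have xT: "x \<in> T" by simp
    obtain \<delta> where \<delta>: "\<delta> > 0" "\<And>y. y \<in> T \<Longrightarrow> dist x y < \<delta> \<Longrightarrow> dd x y < e" using dd_near[OF xT e] by metis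
    have "openin (top_of_set T) (T \<inter> ball x \<delta>)" by (simp add: openin_open_Int)
    moreover have "\<forall>y\<in>T \<inter> ball x \<delta>. id y \<in> mball (id x) e" using \<delta> xT by auto
    ultimately show "\<exists>U. openin (top_of_set T) U \<and> x \<in> U \<and> (\<forall>y\<in>U. id y \<in> mball (id x) e)"
      using xT \<delta>(1) by (intro exI[of _ "T \<inter> ball x \<delta>"]) auto
  qed
  moreover have "compact_space (top_of_set T)" using compact_T by (simp add: compact_space_subtopology)
  ultimately have "homeomorphic_map (top_of_set T) mtopology id"
    by (intro continuous_imp_homeomorphic_map) (auto simp: Hausdorff_space_mtopology)
  then show ?thesis by simp
qed

lemma continuous_on_dd: "x \<in> T \<Longrightarrow> continuous_on T (dd x)"
proof (subst continuous_on_iff, intro ballI allI impI)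
  fix y e assume x: "x \<in> T" and y: "y \<in> T" and e: "0 < (e::real)"
  obtain \<delta> where \<delta>: "\<delta> > 0" "\<And>z. z \<in> T \<Longrightarrow> dist y z < \<delta> \<Longrightarrow> dd y z < e" using dd_near[OF y e] by metis
  have "dist (dd x z) (dd x y) < e" if z: "z \<in> T" "dist z y < \<delta>" for z
    using \<delta>(2)[OF z(1)] z(2) dd_triangle[OF x y z(1)] dd_triangle[OF x z(1) y] dd_commute[of y z]
    by (simp add: dist_real_def dist_commute)
  then show "\<exists>\<delta>>0. \<forall>z\<in>T. dist z y < \<delta> \<longrightarrow> dist (dd x z) (dd x y) < e" using \<delta>(1) by blast
qed

text \<open>
  Finite sequences of points in which consecutive points lie in a common cell of level \<open>n\<close>, with
  the sum of their \<^const>\<open>dd\<close>-distances.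
\<close>
inductive chain :: "nat \<Rightarrow> real^2 \<Rightarrow> real^2 \<Rightarrow> real \<Rightarrow> bool" for n x where
  start: "x \<in> T \<Longrightarrow> chain n x x 0"
| step: "chain n x (Aw w p) r \<Longrightarrow> w \<in> words n \<Longrightarrow> p \<in> T \<Longrightarrow> q \<in> T \<Longrightarrow>
    chain n x (Aw w q) (r + dd (Aw w p) (Aw w q))"

lemma chain_nonneg: "chain n x z r \<Longrightarrow> dd x z \<le> r \<and> z \<in> T \<and> x \<in> T"
proof (induction rule: chain.induct)
  case (step w p r q)
  then show ?case using Aw_in_T[OF step.hyps(2)] dd_triangle[of x "Aw w p" "Aw w q"] by auto
qed (auto simp: dd_self)

lemma chain_cost_nonneg: "chain n x z r \<Longrightarrow> 0 \<le> r"
  using chain_nonneg[of n x z r] dd_nonneg[of x z] by simp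

text \<open>
  The truncation at \<open>m\<close> gives a value also to points that are not known to be reachable by a
  chain.
\<close>
definition chain_dist :: "nat \<Rightarrow> real \<Rightarrow> real^2 \<Rightarrow> real^2 \<Rightarrow> real" where
  "chain_dist n m x z = Inf (insert m {r. chain n x z r})"

text \<open>
  Membership in \<^const>\<open>Lip\<close> is a local condition: long edges are unions of short ones, and a short
  edge lies in a cell of level \<open>n\<close>. So the truncated cost of chains is again bounded by \<^const>\<open>dd\<close>,
  and \<^const>\<open>dd\<close> is a length metric.
\<close>
lemma Lip_chain_dist:
  assumes m: "m \<ge> 0"
  shows "Lip (chain_dist n m x)"
proof -
  have bdd: "bdd_below (insert m {r. chain n x z r})" for z
    using m chain_cost_nonneg by (intro bdd_belowI[of _ 0]) auto
  have le: "chain_dist n m x (Aw w q) \<le> chain_dist n m x (Aw w p) + dd (Aw w p) (Aw w q)"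
    if w: "w \<in> words n" "p \<in> T" "q \<in> T" for w p q
  proof -
    have "chain_dist n m x (Aw w q) - dd (Aw w p) (Aw w q) \<le> r" if r: "r \<in> insert m {r. chain n x (Aw w p) r}" for r
    proof (cases "r = m")
      case True
      have "chain_dist n m x (Aw w q) \<le> m" unfolding chain_dist_def by (intro cInf_lower bdd) simp
      then show ?thesis using True dd_nonneg[of "Aw w p" "Aw w q"] by simp
    next
      case False
      then have "chain n x (Aw w q) (r + dd (Aw w p) (Aw w q))" using r w by (auto intro: chain.step)
      then have "chain_dist n m x (Aw w q) \<le> r + dd (Aw w p) (Aw w q)"
        unfolding chain_dist_def by (intro cInf_lower bdd) simp
      then show ?thesis by simp
    qed
    then have "chain_dist n m x (Aw w q) - dd (Aw w p) (Aw w q) \<le> chain_dist n m x (Aw w p)"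
      unfolding chain_dist_def[of n m x "Aw w p"] by (intro cInf_greatest) auto
    then show ?thesis by simp
  qed
  have cell: "\<bar>chain_dist n m x (Aw w p) - chain_dist n m x (Aw w q)\<bar> \<le> dd (Aw w p) (Aw w q)"
    if w: "w \<in> words n" "p \<in> T" "q \<in> T" for w p q
    using le[OF w] le[OF w(1) w(3,2)] dd_commute[of "Aw w p" "Aw w q"] by linarith
  have high: "\<bar>chain_dist n m x (Aw w (vtx a)) - chain_dist n m x (Aw w (vtx b))\<bar> \<le> (1/2) ^ k"
    if k: "k \<ge> n" and w: "w \<in> words k" and ab: "a < 3" "b < 3" for k w a b
  proof -
    obtain j where j: "k = n + j" using k le_Suc_ex by blast
    obtain u u' where u: "w = u @ u'" "u \<in> words n" "u' \<in> words j" using words_splitE w unfolding j by blast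
    have "dd (Aw w (vtx a)) (Aw w (vtx b)) \<le> (1/2) ^ k"
      using dd_Aw[OF w, of "vtx a" "vtx b"] dd_vtx[OF ab] dd_self by (cases "a = b") auto
    then show ?thesis
      using cell[OF u(2) Aw_in_T Aw_in_T, OF u(3) _ u(3), of "vtx a" "vtx b"] by (simp add: u(1) Aw_append)
  qed
  show ?thesis
  proof (rule LipI)
    show "continuous_on T (chain_dist n m x)"
    proof (rule glue_continuous)
      fix w assume w: "w \<in> words n"
      show "continuous_on T (\<lambda>p. chain_dist n m x (Aw w p))"
      proof (subst continuous_on_iff, intro ballI allI impI)
        fix p e assume p: "p \<in> T" and e: "0 < (e::real)"
        obtain \<delta> where \<delta>: "\<delta> > 0" "\<And>q. q \<in> T \<Longrightarrow> dist p q < \<delta> \<Longrightarrow> dd p q < e" using dd_near[OF p e] by metis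
        have "dist (chain_dist n m x (Aw w q)) (chain_dist n m x (Aw w p)) < e" if q: "q \<in> T" "dist q p < \<delta>" for q
        proof -
          have "dd (Aw w q) (Aw w p) \<le> dd q p"
            using dd_Aw[OF w q(1) p] dd_nonneg[of q p] by (simp add: mult_left_le_one_le power_le_one)
          then show ?thesis using \<delta>(2)[of q] q cell[OF w q(1) p] dd_commute[of p q]
            by (simp add: dist_real_def dist_commute)
        qed
        then show "\<exists>\<delta>>0. \<forall>q\<in>T. dist q p < \<delta> \<longrightarrow> dist (chain_dist n m x (Aw w q)) (chain_dist n m x (Aw w p)) < e"
          using \<delta>(1) by blast
      qed
    qed
    fix k w a b assume "w \<in> words k" "a < (3::nat)" "b < (3::nat)"
    then show "\<bar>chain_dist n m x (Aw w (vtx a)) - chain_dist n m x (Aw w (vtx b))\<bar> \<le> (1/2) ^ k"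
    proof (induction "n - k" arbitrary: k w a b)
      case 0
      then show ?case using high by simp
    next
      case (Suc j)
      let ?f = "chain_dist n m x"
      show ?case
      proof (cases "a = b")
        case False
        then obtain c where P: "(a, b, c) \<in> Perms" "(b, a, c) \<in> Perms"
          using third_vertex[OF Suc.prems(2,3)] by (metis Perms_iff)
        have j: "j = n - Suc k" using Suc.hyps(2) by simp
        \<comment> \<open>the edge consists of two edges of the next level\<close>
        have "\<bar>?f (Aw w (vtx a)) - ?f (Aw w (midpoint (vtx a) (vtx b)))\<bar> \<le> (1/2) ^ Suc k"
          using Suc.hyps(1)[OF j words_snoc[OF Suc.prems(1) P(1)], of 0 1] by (simp add: Aw_snoc A_vtx)
        moreover have "\<bar>?f (Aw w (vtx b)) - ?f (Aw w (midpoint (vtx a) (vtx b)))\<bar> \<le> (1/2) ^ Suc k"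
          using Suc.hyps(1)[OF j words_snoc[OF Suc.prems(1) P(2)], of 0 1] by (simp add: Aw_snoc A_vtx midpoint_sym)
        ultimately have "\<bar>?f (Aw w (vtx a)) - ?f (Aw w (vtx b))\<bar> \<le> (1/2) ^ Suc k + (1/2) ^ Suc k" by linarith
        then show ?thesis by simp
      qed simp
    qed
  qed
qed

lemma chain_exists:
  assumes "x \<in> T" "y \<in> T" "e > 0"
  obtains r where "chain n x y r" "r < dd x y + e"
proof -
  let ?m = "dd x y + e"
  have m: "?m \<ge> 0" using dd_nonneg[of x y] assms(3) by simp
  have bdd: "bdd_below (insert ?m {r. chain n x z r})" for z
    using m chain_cost_nonneg by (intro bdd_belowI[of _ 0]) auto
  have "chain_dist n ?m x x \<le> 0" unfolding chain_dist_def
    by (intro cInf_lower bdd) (auto intro: chain.start assms)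
  then have "chain_dist n ?m x y \<le> dd x y"
    using dd_upper[OF Lip_chain_dist[OF m] assms(1,2), of n x] by linarith
  then have "chain_dist n ?m x y < ?m" using assms(3) by linarith
  then obtain r where "r \<in> insert ?m {r. chain n x y r}" "r < ?m"
    unfolding chain_dist_def by (subst (asm) cInf_less_iff[OF _ bdd]) auto
  then show ?thesis using that by auto
qed

text \<open>
  The links of a chain are short, so the chain can be cut close to any prescribed cost.
\<close>
lemma chain_split:
  assumes "chain n x z r" "0 \<le> \<theta>" "\<theta> \<le> r"
  shows "\<exists>z'\<in>T. dd x z' \<le> \<theta> \<and> dd z' z \<le> r - \<theta> + 4 * (1/2) ^ n"
  using assms
proof (induction arbitrary: \<theta> rule: chain.induct)
  case start
  then show ?case using dd_self by (intro bexI[of _ x]) auto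
next
  case (step w p r q)
  note T = Aw_in_T[OF step.hyps(2)]
  have tri: "dd z' (Aw w q) \<le> dd z' (Aw w p) + dd (Aw w p) (Aw w q)" if "z' \<in> T" for z'
    using dd_triangle[OF that] T step.hyps by auto
  show ?case
  proof (cases "\<theta> \<le> r")
    case True
    then obtain z' where "z' \<in> T" "dd x z' \<le> \<theta>" "dd z' (Aw w p) \<le> r - \<theta> + 4 * (1/2) ^ n"
      using step.IH step.prems by blast
    then show ?thesis using tri[of z'] by (intro bexI[of _ z']) auto
  next
    case False
    have "dd (Aw w p) (Aw w q) \<le> 4 * (1/2) ^ n" using dd_cell_le step.hyps by blast
    then show ?thesis using False chain_nonneg[OF step.hyps(1)] step.prems by (intro bexI[of _ "Aw w p"]) auto
  qed
qed

text \<open>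
  Cutting chains in the middle gives approximate midpoints, and compactness gives exact ones.
\<close>
lemma midpoint_exists:
  assumes xy: "x \<in> T" "y \<in> T"
  obtains z where "z \<in> T" "dd x z \<le> dd x y / 2" "dd y z \<le> dd x y / 2"
proof -
  let ?S = "{z \<in> T. dd x z \<le> dd x y / 2}"
  have "closed (T \<inter> dd x -` {..dd x y / 2})"
    by (rule continuous_closed_preimage[OF continuous_on_dd[OF xy(1)] compact_imp_closed[OF compact_T] closed_atMost])
  moreover have "?S = T \<inter> (T \<inter> dd x -` {..dd x y / 2})" by auto
  ultimately have "compact ?S" using compact_Int_closed[OF compact_T] by presburger
  moreover have "x \<in> ?S" using xy dd_self dd_nonneg by simp
  moreover have "continuous_on ?S (dd y)" by (rule continuous_on_subset[OF continuous_on_dd[OF xy(2)]]) auto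
  ultimately obtain z where z: "z \<in> ?S" "\<And>z'. z' \<in> ?S \<Longrightarrow> dd y z \<le> dd y z'"
    using continuous_attains_inf[of ?S "dd y"] by blast
  have "dd y z \<le> dd x y / 2 + e" if e: "e > 0" for e
  proof -
    obtain n where n: "4 * (1/2::real) ^ n < e/2" using ex_power_less[of "1/2" "e/2" 4] e by auto
    obtain r where r: "chain n x y r" "r < dd x y + e/2" using chain_exists[OF xy, of "e/2" n] e by auto
    have "dd x y / 2 \<le> r" using chain_nonneg[OF r(1)] dd_nonneg[of x y] by linarith
    then obtain z' where "z' \<in> T" "dd x z' \<le> dd x y / 2" "dd z' y \<le> r - dd x y / 2 + 4 * (1/2) ^ n"
      using chain_split[OF r(1), of "dd x y / 2"] dd_nonneg[of x y] by auto
    then have "dd y z' \<le> dd x y / 2 + e" "z' \<in> ?S" using r(2) n dd_commute[of z' y] by auto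
    then show ?thesis using z(2) by fastforce
  qed
  then have "dd y z \<le> dd x y / 2" by (rule field_le_epsilon)
  then show ?thesis using that z(1) by blast
qed

section \<open>Geodesics of the distance\<close>

text \<open>
  The distance from \<open>x\<close> maps such a set isometrically to the real line. Images of geodesics that
  start in \<open>x\<close> are aligned, and constructing geodesics by enlarging aligned sets makes it easy
  to prescribe points on them.
\<close>
definition aligned :: "real^2 \<Rightarrow> (real^2) set \<Rightarrow> bool" where
  "aligned x C \<longleftrightarrow> (\<forall>u\<in>C. \<forall>v\<in>C. dd u v = \<bar>dd x u - dd x v\<bar>)"

lemma aligned_insert:
  assumes "aligned x C" "\<And>v. v \<in> C \<Longrightarrow> dd z v = \<bar>dd x z - dd x v\<bar>"
  shows "aligned x (insert z C)"
  using assms dd_commute unfolding aligned_def by (auto simp: dd_self abs_minus_commute)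

lemma aligned_maximal_exists:
  assumes C0: "aligned x C0" "C0 \<subseteq> T" "\<And>u. u \<in> C0 \<Longrightarrow> dd x u \<le> L"
  obtains C where "C0 \<subseteq> C" "C \<subseteq> T" "aligned x C" "\<And>u. u \<in> C \<Longrightarrow> dd x u \<le> L"
    "\<And>z. z \<in> T \<Longrightarrow> dd x z \<le> L \<Longrightarrow> aligned x (insert z C) \<Longrightarrow> z \<in> C"
proof -
  define \<A> where "\<A> = {C. C0 \<subseteq> C \<and> C \<subseteq> T \<and> aligned x C \<and> (\<forall>u\<in>C. dd x u \<le> L)}"
  have "\<exists>M\<in>\<A>. \<forall>X\<in>\<A>. M \<subseteq> X \<longrightarrow> X = M"
  proof (rule subset_Zorn_nonempty)
    show "\<A> \<noteq> {}" using C0 by (auto simp: \<A>_def)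
    fix \<C> assume \<C>: "\<C> \<noteq> {}" "subset.chain \<A> \<C>"
    have "dd u v = \<bar>dd x u - dd x v\<bar>" if "u \<in> X" "X \<in> \<C>" "v \<in> Y" "Y \<in> \<C>" for u v X Y
    proof -
      have "X \<subseteq> Y \<or> Y \<subseteq> X" using \<C>(2) that by (meson subset_chain_def)
      moreover have "aligned x X" "aligned x Y" using \<C>(2) that unfolding subset_chain_def \<A>_def by auto
      ultimately show ?thesis using that unfolding aligned_def by blast
    qed
    then have "aligned x (\<Union>\<C>)" unfolding aligned_def by blast
    then show "\<Union>\<C> \<in> \<A>" using \<C> unfolding subset_chain_def \<A>_def by blast
  qed
  then obtain C where C: "C \<in> \<A>" "\<And>X. X \<in> \<A> \<Longrightarrow> C \<subseteq> X \<Longrightarrow> X = C" by blast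
  show ?thesis
  proof
    show "C0 \<subseteq> C" "C \<subseteq> T" "aligned x C" "\<And>u. u \<in> C \<Longrightarrow> dd x u \<le> L" using C(1) by (auto simp: \<A>_def)
    fix z assume "z \<in> T" "dd x z \<le> L" "aligned x (insert z C)"
    then have "insert z C \<in> \<A>" using C(1) by (auto simp: \<A>_def)
    then show "z \<in> C" using C(2)[of "insert z C"] by blast
  qed
qed

text \<open>
  A maximal aligned set is closed, and midpoints fill its gaps. So it is parametrised by the
  distance from \<open>x\<close>.
\<close>
lemma geodesic_through:
  assumes xy: "x \<in> C0" "y \<in> C0" and C0: "aligned x C0" "C0 \<subseteq> T" "\<And>u. u \<in> C0 \<Longrightarrow> dd x u \<le> dd x y"
  obtains g where "path g" "geodesic_path T dd g x y" "C0 \<subseteq> g ` {0..1}" "aligned x (g ` {0..1})" "g ` {0..1} \<subseteq> T"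
    "\<And>s. s \<in> {0..1} \<Longrightarrow> dd x (g s) = dd x y * s"
proof -
  interpret Metric_space T dd by (rule Metric_space_dd)
  define L where "L = dd x y"
  have xT: "x \<in> T" "y \<in> T" using xy C0 by auto
  obtain C where C: "C0 \<subseteq> C" "C \<subseteq> T" "aligned x C" "\<And>u. u \<in> C \<Longrightarrow> dd x u \<le> L"
    and mx: "\<And>z. z \<in> T \<Longrightarrow> dd x z \<le> L \<Longrightarrow> aligned x (insert z C) \<Longrightarrow> z \<in> C"
    using aligned_maximal_exists[OF C0(1,2), of L] C0(3) L_def by metis
  have al: "dd u v = \<bar>dd x u - dd x v\<bar>" if "u \<in> C" "v \<in> C" for u v
    using C(3) that by (auto simp: aligned_def)
  have "closed C"
  proof -
    have cT: "closed T" by (rule compact_imp_closed[OF compact_T])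
    have "closure C \<subseteq> C"
    proof
      fix z assume z: "z \<in> closure C"
      have zT: "z \<in> T" using z closure_minimal[OF C(2) cT] by blast
      have "dd v z - \<bar>dd x v - dd x z\<bar> \<in> {0}" if v: "v \<in> C" for v
      proof -
        have vT: "v \<in> T" using v C(2) by blast
        have "continuous_on (closure C) (\<lambda>z. dd v z - \<bar>dd x v - dd x z\<bar>)"
          by (intro continuous_intros continuous_on_subset[OF continuous_on_dd] closure_minimal[OF C(2) cT] vT xT)
        moreover have "dd v u - \<bar>dd x v - dd x u\<bar> \<in> {0}" if "u \<in> C" for u using al[OF v that] by simp
        ultimately show ?thesis using z image_closure_subset[of C "\<lambda>z. dd v z - \<bar>dd x v - dd x z\<bar>" "{0}"] by blast
      qed
      then have "aligned x (insert z C)"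
        by (intro aligned_insert C(3)) (metis abs_minus_commute commute diff_eq_diff_eq diff_zero singletonD eq_iff_diff_eq_0)
      moreover have "dd x z \<le> L"
      proof -
        have "continuous_on (closure C) (dd x)"
          by (rule continuous_on_subset[OF continuous_on_dd[OF xT(1)] closure_minimal[OF C(2) cT]])
        then show ?thesis using z image_closure_subset[of C "dd x" "{..L}"] C(4) by blast
      qed
      ultimately show "z \<in> C" using mx zT by blast
    qed
    then show ?thesis by (metis closed_closure closure_subset subset_antisym)
  qed
  then have compC: "compact C" using compact_Int_closed[OF compact_T] C(2) by (metis inf.absorb2)
  define R where "R = dd x ` C"
  have "compact R" unfolding R_def
    by (rule compact_continuous_image[OF continuous_on_subset[OF continuous_on_dd[OF xT(1)] C(2)] compC])
  have R0: "0 \<in> R" "L \<in> R" using xy C(1) dd_self[of x] unfolding R_def L_def by (auto intro!: image_eqI)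
  \<comment> \<open>a gap in the distances is bounded by two points, and their midpoint could be added\<close>
  have full: "s \<in> R" if s: "0 \<le> s" "s \<le> L" for s
  proof (rule ccontr)
    assume sR: "s \<notin> R"
    have "compact (R \<inter> {0..s})" "compact (R \<inter> {s..L})" using \<open>compact R\<close> by (simp_all add: compact_Int)
    moreover have "R \<inter> {0..s} \<noteq> {}" "R \<inter> {s..L} \<noteq> {}" using R0 s by auto
    ultimately obtain a b where a': "a \<in> R \<inter> {0..s}" "\<And>r. r \<in> R \<inter> {0..s} \<Longrightarrow> r \<le> a"
      and b': "b \<in> R \<inter> {s..L}" "\<And>r. r \<in> R \<inter> {s..L} \<Longrightarrow> b \<le> r"
      using compact_attains_sup[of "R \<inter> {0..s}"] compact_attains_inf[of "R \<inter> {s..L}"] by metis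
    have a: "a \<in> R" "a \<le> s" "\<And>r. r \<in> R \<Longrightarrow> 0 \<le> r \<Longrightarrow> r \<le> s \<Longrightarrow> r \<le> a"
      and b: "b \<in> R" "b \<ge> s" "\<And>r. r \<in> R \<Longrightarrow> s \<le> r \<Longrightarrow> r \<le> L \<Longrightarrow> b \<le> r"
      using a' b' by auto
    obtain p q where p: "p \<in> C" "dd x p = a" and q: "q \<in> C" "dd x q = b" using a(1) b(1) by (auto simp: R_def)
    have ab: "a < s" "s < b" using a b sR by (auto simp: less_le)
    have pq: "dd p q = b - a" using al[OF p(1) q(1)] p q ab by simp
    have pqT: "p \<in> T" "q \<in> T" using p q C(2) by auto
    obtain z where z: "z \<in> T" "dd p z \<le> (b - a) / 2" "dd q z \<le> (b - a) / 2"
      using midpoint_exists[OF pqT] pq by metis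
    have "dd x z \<le> a + (b - a) / 2" using dd_triangle[OF xT(1) pqT(1) z(1)] p z(2) by linarith
    moreover have "b \<le> dd x z + (b - a) / 2"
      using dd_triangle[OF xT(1) z(1) pqT(2)] q z(3) dd_commute[of z q] by linarith
    ultimately have xz: "dd x z = (a + b) / 2" by (simp add: field_simps)
    have "dd z e = \<bar>dd x z - dd x e\<bar>" if e: "e \<in> C" for e
    proof -
      have eT: "e \<in> T" using e C(2) by blast
      have eR: "dd x e \<in> R" "dd x e \<le> L" using e C(4) by (auto simp: R_def)
      have t1: "dd z e \<le> dd p z + dd p e" "dd p e \<le> dd p z + dd z e"
        "dd z e \<le> dd q z + dd q e" "dd q e \<le> dd q z + dd z e"
        using dd_triangle[OF z(1) pqT(1) eT] dd_triangle[OF pqT(1) z(1) eT]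
          dd_triangle[OF z(1) pqT(2) eT] dd_triangle[OF pqT(2) z(1) eT] dd_commute[of z p] dd_commute[of z q] by auto
      have t2: "dd p e = \<bar>a - dd x e\<bar>" "dd q e = \<bar>b - dd x e\<bar>" using al[OF p(1) e] al[OF q(1) e] p q by auto
      consider "dd x e \<le> a" | "b \<le> dd x e"
        using a(3)[OF eR(1) dd_nonneg] b(3)[OF eR(1) _ eR(2)] by linarith
      then show ?thesis
        by cases (use t1 t2 xz z ab in \<open>auto simp: abs_if field_simps split: if_splits\<close>)
    qed
    then have "aligned x (insert z C)" by (rule aligned_insert[OF C(3)])
    moreover have "dd x z \<le> L" using xz ab C(4)[OF q(1)] q by (simp add: field_simps)
    ultimately have "z \<in> C" using mx z(1) by blast
    then have "dd x z \<in> R" by (simp add: R_def)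
    moreover have "0 \<le> dd x z" by (rule dd_nonneg)
    ultimately show False
      using a(3)[of "dd x z"] b(3)[of "dd x z"] xz ab C(4)[OF \<open>z \<in> C\<close>] by (cases "dd x z \<le> s") (auto simp: field_simps)
  qed
  define g where "g s = (SOME u. u \<in> C \<and> dd x u = L * s)" for s
  have L0: "L \<ge> 0" by (simp add: L_def dd_nonneg)
  have g: "g s \<in> C" "dd x (g s) = L * s" if s: "s \<in> {0..1}" for s
  proof -
    have "L * s \<in> R" using full[of "L * s"] L0 s by (auto intro: mult_left_le)
    then have "\<exists>u. u \<in> C \<and> dd x u = L * s" by (auto simp: R_def)
    then have "g s \<in> C \<and> dd x (g s) = L * s" unfolding g_def by (rule someI_ex)
    then show "g s \<in> C" "dd x (g s) = L * s" by auto
  qed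
  have inj: "u = v" if "u \<in> C" "v \<in> C" "dd x u = dd x v" for u v
  proof -
    have "dd u v = 0" using al[OF that(1,2)] that(3) by simp
    then show ?thesis using zero that C(2) by blast
  qed
  have lin: "dd (g s) (g s') = dd x y * \<bar>s - s'\<bar>" if "s \<in> {0..1}" "s' \<in> {0..1}" for s s'
    using al[OF g(1)[OF that(1)] g(1)[OF that(2)]] g(2)[OF that(1)] g(2)[OF that(2)] L0
    unfolding L_def[symmetric] by (simp add: abs_mult flip: right_diff_distrib)
  have xyC: "x \<in> C" "y \<in> C" using xy C(1) by auto
  have "g 0 = x" by (rule inj) (use g[of 0] xyC dd_self in auto)
  moreover have "g 1 = y" by (rule inj) (use g[of 1] xyC L_def in auto)
  ultimately have geo: "geodesic_path T dd g x y" using lin g(1) C(2) by (intro geodesic_path_linear) auto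
  have "g ` {0..1} = C"
  proof (intro equalityI subsetI)
    fix u assume u: "u \<in> C"
    show "u \<in> g ` {0..1}"
    proof (cases "L = 0")
      case True
      then have "dd x u = L * 0" using C(4)[OF u] dd_nonneg[of x u] by simp
      then have "u = g 0" using inj[OF u g(1)[of 0]] g(2)[of 0] by simp
      then show ?thesis by auto
    next
      case False
      then have s: "dd x u / L \<in> {0..1}" using C(4)[OF u] dd_nonneg[of x u] L0 by (simp add: divide_le_eq_1)
      then have "u = g (dd x u / L)" using inj[OF u g(1)[OF s]] g(2)[OF s] False by simp
      then show ?thesis using s by blast
    qed
  qed (use g in auto)
  moreover have "path g"
    using geo unfolding geodesic_path_def mtopology_dd pathin_def path_def by (simp add: continuous_map_in_subtopology)
  moreover have "dd x (g s) = dd x y * s" if "s \<in> {0..1}" for s using g(2)[OF that] by (simp add: L_def)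
  ultimately show ?thesis using that[of g] geo C by simp
qed

lemma aligned_pair: "x \<in> T \<Longrightarrow> y \<in> T \<Longrightarrow> aligned x {x, y}"
  by (auto simp: aligned_def dd_self dd_nonneg dd_commute)

lemma geodesic_distance_dd: "geodesic_distance T dd"
  unfolding geodesic_distance_def
proof (intro conjI ballI Metric_space_dd)
  fix x y assume "x \<in> T" "y \<in> T"
  then obtain g where "path g" "geodesic_path T dd g x y"
    using geodesic_through[of x "{x, y}" y] aligned_pair[of x y] dd_self[of x] dd_nonneg[of x y]
    by (metis empty_subsetI insertE insertI1 insert_subset order_refl singletonD singletonI insertI2)
  then show "\<exists>g. path g \<and> geodesic_path T dd g x y" by blast
qed

lemma bc_side_01:
  "bc 0 (side 0 (Suc 0) r) = 1 - r" "bc (Suc 0) (side 0 (Suc 0) r) = r" "bc 2 (side 0 (Suc 0) r) = 0"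
  "bc 0 (side (Suc 0) 0 r) = r" "bc (Suc 0) (side (Suc 0) 0 r) = 1 - r" "bc 2 (side (Suc 0) 0 r) = 0"
  by (simp_all add: bc_side)

section \<open>The edges\<close>

lemma side_halves:
  "side a b s = A (a, b, c) (side 0 1 (2 * s))"
  "side a b s = A (b, a, c) (side 1 0 (2 * s - 1))"
proof -
  have "side a b s = (1 - 2 * s) *\<^sub>R vtx a + (2 * s) *\<^sub>R midpoint (vtx a) (vtx b)"
    by (simp add: side_def linepath_def midpoint_def vec_eq_iff field_simps)
  then show "side a b s = A (a, b, c) (side 0 1 (2 * s))"
    by (simp add: A_def bc_side_01)
  have "side a b s = (2 * s - 1) *\<^sub>R vtx b + (2 - 2 * s) *\<^sub>R midpoint (vtx b) (vtx a)"
    by (simp add: side_def linepath_def midpoint_def vec_eq_iff field_simps)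
  then show "side a b s = A (b, a, c) (side 1 0 (2 * s - 1))"
    by (simp add: A_def bc_side_01)
qed

text \<open>
  Halving an edge halves the error of a bound that holds for all edges, so a crude bound
  suffices to obtain the exact one. The bound is stated for a general \<open>e\<close> because it serves both
  the distance \<^const>\<open>dd\<close> and its competitors.
\<close>
lemma side_from_vertex:
  fixes e :: "real^2 \<Rightarrow> real^2 \<Rightarrow> real"
  assumes tri: "\<And>x y z. x \<in> T \<Longrightarrow> y \<in> T \<Longrightarrow> z \<in> T \<Longrightarrow> e x z \<le> e x y + e y z"
    and edge: "\<And>n w a b. w \<in> words n \<Longrightarrow> a < 3 \<Longrightarrow> b < 3 \<Longrightarrow> a \<noteq> b \<Longrightarrow> e (Aw w (vtx a)) (Aw w (vtx b)) \<le> (1/2) ^ n"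
    and bound: "\<And>n w a b s. w \<in> words n \<Longrightarrow> a < 3 \<Longrightarrow> b < 3 \<Longrightarrow> a \<noteq> b \<Longrightarrow> 0 \<le> s \<Longrightarrow> s \<le> 1 \<Longrightarrow>
      e (Aw w (vtx a)) (Aw w (side a b s)) \<le> K * (1/2) ^ n"
    and w: "w \<in> words n" and ab: "a < 3" "b < 3" "a \<noteq> b" "0 \<le> s" "s \<le> 1"
  shows "e (Aw w (vtx a)) (Aw w (side a b s)) \<le> (1/2) ^ n * s"
proof -
  have *: "e (Aw w (vtx a)) (Aw w (side a b s)) \<le> (1/2) ^ n * (s + K * (1/2) ^ k)" for k
    using w ab
  proof (induction k arbitrary: n w a b s)
    case 0
    have "K * (1/2) ^ n \<le> (1/2) ^ n * (s + K)" using 0 by (simp add: algebra_simps)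
    with bound[OF 0] have "e (Aw w (vtx a)) (Aw w (side a b s)) \<le> (1/2) ^ n * (s + K)" by (rule order_trans)
    then show ?case by simp
  next
    case (Suc k)
    obtain c where P: "(a, b, c) \<in> Perms" using third_vertex Suc.prems(2-4) by blast
    then have P': "(b, a, c) \<in> Perms" by (auto simp: Perms_def)
    note W = words_snoc[OF Suc.prems(1) P] and W' = words_snoc[OF Suc.prems(1) P']
    let ?m = "midpoint (Aw w (vtx a)) (Aw w (vtx b))"
    have m: "Aw (w @ [(a, b, c)]) (vtx 1) = ?m" "Aw (w @ [(b, a, c)]) (vtx 1) = ?m"
      "Aw (w @ [(a, b, c)]) (vtx 0) = Aw w (vtx a)"
      by (simp_all add: Aw_snoc A_vtx Aw_midpoint midpoint_sym)
    show ?case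
    proof (cases "2 * s \<le> 1")
      case True
      have "Aw w (side a b s) = Aw (w @ [(a, b, c)]) (side 0 1 (2 * s))"
        using side_halves(1)[of a b s c] by (simp add: Aw_snoc)
      then show ?thesis using Suc.IH[OF W, of 0 1 "2 * s"] m Suc.prems True by (simp add: field_simps)
    next
      case False
      have eq: "Aw w (side a b s) = Aw (w @ [(b, a, c)]) (side 1 0 (2 * s - 1))"
        using side_halves(2)[of a b s c] by (simp add: Aw_snoc)
      have "e ?m (Aw w (side a b s)) \<le> (1/2) ^ Suc n * (2 * s - 1 + K * (1/2) ^ k)"
        unfolding eq using Suc.IH[OF W', of 1 0 "2 * s - 1"] Suc.prems False m by simp
      moreover have "e (Aw w (vtx a)) ?m \<le> (1/2) ^ Suc n"
        using edge[OF W, of 0 1] m by simp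
      moreover have "e (Aw w (vtx a)) (Aw w (side a b s)) \<le> e (Aw w (vtx a)) ?m + e ?m (Aw w (side a b s))"
        using Suc.prems Aw_in_T[OF W, of "vtx 1"] unfolding m by (intro tri Aw_in_T[OF Suc.prems(1)] side_in_T) auto
      moreover have "(1/2) ^ Suc n + (1/2) ^ Suc n * (2 * s - 1 + K * (1/2) ^ k) = (1/2) ^ n * (s + K * (1/2) ^ Suc k)"
        by (simp add: algebra_simps)
      ultimately show ?thesis by linarith
    qed
  qed
  have "e (Aw w (vtx a)) (Aw w (side a b s)) \<le> (1/2) ^ n * s + \<epsilon>" if \<epsilon>: "\<epsilon> > 0" for \<epsilon>
  proof -
    obtain k where "(1/2) ^ n * K * (1/2) ^ k < \<epsilon>" using ex_power_less[of "1/2" \<epsilon> "(1/2) ^ n * K"] \<epsilon> by auto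
    then show ?thesis using *[of k] by (simp add: distrib_left mult.assoc)
  qed
  then show ?thesis by (rule field_le_epsilon)
qed

lemma dd_edge:
  assumes "w \<in> words n" "a < 3" "b < 3" "a \<noteq> b"
  shows "dd (Aw w (vtx a)) (Aw w (vtx b)) = (1/2) ^ n"
  using dd_Aw[OF assms(1), of "vtx a" "vtx b"] dd_vtx assms by simp

lemma dd_side_vertex:
  assumes "a < 3" "b < 3" "a \<noteq> b" "0 \<le> s" "s \<le> 1"
  shows "dd (vtx a) (side a b s) = s"
proof -
  have le: "dd (vtx a) (side a b s) \<le> s" if "a < 3" "b < 3" "a \<noteq> b" "0 \<le> s" "s \<le> 1" for a b s
  proof -
    have "dd (Aw [] (vtx a)) (Aw [] (side a b s)) \<le> (1/2) ^ 0 * s"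
      by (rule side_from_vertex[where K = 4])
        (use that dd_triangle dd_edge dd_cell_le side_in_T in auto)
    then show ?thesis by simp
  qed
  have "1 \<le> dd (vtx a) (side a b s) + dd (side a b s) (vtx b)"
    using dd_triangle[OF vtx_in_T(1) side_in_T vtx_in_T(1), of a b s a b] dd_vtx[of a b] assms by simp
  moreover have "dd (side a b s) (vtx b) \<le> 1 - s"
    using le[of b a "1 - s"] assms by (simp add: dd_commute side_rev[of b a])
  ultimately show ?thesis using le[OF assms] by linarith
qed

text \<open>
  Bisection again: points on different halves are compared through the midpoint, and points on
  the same half are at half of the distance of two points on an edge one level up.
\<close>
lemma dd_side:
  assumes "a < 3" "b < 3" "a \<noteq> b" "0 \<le> s" "s \<le> 1" "0 \<le> s'" "s' \<le> 1"
  shows "dd (side a b s) (side a b s') = \<bar>s - s'\<bar>"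
proof -
  have "dd (side a b s) (side a b s') \<le> \<bar>s - s'\<bar> + 4 * (1/2) ^ k" for k
    using assms
  proof (induction k arbitrary: a b s s')
    case 0
    then show ?case using dd_le_4[of "side a b s" "side a b s'"] side_in_T by simp
  next
    case (Suc k)
    obtain c where P: "(a, b, c) \<in> Perms" using third_vertex Suc.prems(1-3) by blast
    then have P': "(b, a, c) \<in> Perms" by (auto simp: Perms_def)
    have half: "dd (side a b s) (side a b s') \<le> \<bar>s - s'\<bar> + 4 * (1/2) ^ Suc k"
      if "2 * s \<le> 1" "2 * s' \<le> 1" "0 \<le> s" "0 \<le> s'" "(a, b, c) \<in> Perms" for a b c s s'
    proof -
      have "dd (side a b s) (side a b s') = dd (side 0 1 (2 * s)) (side 0 1 (2 * s')) / 2"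
        unfolding side_halves(1)[of a b _ c] by (rule dd_A[OF that(5)]) (use that side_in_T in auto)
      moreover have "dd (side 0 1 (2 * s)) (side 0 1 (2 * s')) \<le> \<bar>2 * s - 2 * s'\<bar> + 4 * (1/2) ^ k"
        by (rule Suc.IH) (use that in auto)
      ultimately show ?thesis by (simp add: abs_if split: if_splits)
    qed
    have across: "dd (side a b s) (side a b s') \<le> s' - s" if s: "2 * s \<le> 1" "1 \<le> 2 * s'" "0 \<le> s" "s' \<le> 1" for s s'
    proof -
      let ?m = "side a b (1/2)"
      have m: "?m = A (a, b, c) (vtx 1)" "?m = A (b, a, c) (vtx 1)"
        using side_halves[of a b "1/2" c] by simp_all
      have "dd (side a b s) ?m = dd (side 0 1 (2 * s)) (vtx 1) / 2"
        unfolding side_halves(1)[of a b s c] m by (rule dd_A[OF P]) (use s side_in_T in auto)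
      also have "dd (side 0 1 (2 * s)) (vtx 1) = 1 - 2 * s"
        using dd_side_vertex[of 1 0 "1 - 2 * s"] s side_rev[of 0 1 "2 * s"] dd_commute[of "vtx 1"] by simp
      finally have 1: "dd (side a b s) ?m = 1/2 - s" by simp
      have "dd ?m (side a b s') = dd (vtx 1) (side 1 0 (2 * s' - 1)) / 2"
        unfolding side_halves(2)[of a b s' c] m(2) by (rule dd_A[OF P']) (use s side_in_T in auto)
      also have "dd (vtx 1) (side 1 0 (2 * s' - 1)) = 2 * s' - 1"
        using dd_side_vertex[of 1 0 "2 * s' - 1"] s by simp
      finally have 2: "dd ?m (side a b s') = s' - 1/2" by simp
      have "dd (side a b s) (side a b s') \<le> dd (side a b s) ?m + dd ?m (side a b s')"
        by (intro dd_triangle side_in_T) (use s Suc.prems in auto)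
      then show ?thesis using 1 2 by simp
    qed
    consider "2 * s \<le> 1" "2 * s' \<le> 1" | "1 \<le> 2 * s" "1 \<le> 2 * s'" | "2 * s \<le> 1" "1 \<le> 2 * s'" | "1 \<le> 2 * s" "2 * s' \<le> 1"
      by linarith
    then show ?case
    proof cases
      case 1
      then show ?thesis using half P Suc.prems by blast
    next
      case 2
      then show ?thesis using half[of "1 - s" "1 - s'" b a c] P' Suc.prems
        by (simp add: side_rev[of a b] abs_minus_commute)
    next
      case 3
      have "0 \<le> 4 * (1/2::real) ^ Suc k" by simp
      then show ?thesis using across[of s s'] 3 Suc.prems by linarith
    next
      case 4
      have "0 \<le> 4 * (1/2::real) ^ Suc k" by simp
      then show ?thesis using across[of s' s] 4 Suc.prems dd_commute[of "side a b s" "side a b s'"] by linarith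
    qed
  qed
  then have "dd (side a b s) (side a b s') \<le> \<bar>s - s'\<bar> + e" if "e > 0" for e
    using ex_power_less[of "1/2" e 4] that by (smt (verit) field_sum_of_halves)
  then have le: "dd (side a b s) (side a b s') \<le> \<bar>s - s'\<bar>" by (rule field_le_epsilon)
  moreover have "\<bar>s - s'\<bar> \<le> dd (side a b s) (side a b s')"
  proof -
    have T: "side a b s \<in> T" "side a b s' \<in> T" "vtx a \<in> T" using side_in_T assms by auto
    then show ?thesis
      using dd_triangle[OF T(3,1,2)] dd_triangle[OF T(3,2,1)] dd_side_vertex[of a b] assms
        dd_commute[of "side a b s"] by auto
  qed
  ultimately show ?thesis by simp
qed

lemma edges_geodesic_dd: "edges_geodesic tri dd"
  unfolding edges_geodesic_def
proof (intro allI ballI impI)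
  interpret Metric_space T dd by (rule Metric_space_dd)
  fix n c u v assume c: "c \<in> bary_subdivision n tri" and uv: "u \<in> c" "v \<in> c" "u \<noteq> v"
  then obtain w where w: "w \<in> words n" "c = Aw w ` tri" unfolding bary_subdivision_eq by auto
  then obtain a b where ab: "a < 3" "b < 3" "u = Aw w (vtx a)" "v = Aw w (vtx b)"
    using uv unfolding tri_eq by auto
  have ne: "a \<noteq> b" using uv ab by auto
  have lin: "dd (linepath u v s) (linepath u v s') = (1/2) ^ n * \<bar>s - s'\<bar>" if "s \<in> {0..1}" "s' \<in> {0..1}" for s s'
    using dd_Aw[OF w(1) side_in_T side_in_T, of a b s a b s'] dd_side[OF ab(1,2) ne, of s s'] that ab
    by (simp add: Aw_side)
  have duv: "dd u v = (1/2) ^ n" using dd_edge[OF w(1) ab(1,2) ne] ab by simp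
  have "linepath u v s \<in> T" if "s \<in> {0..1}" for s
    using Aw_in_T[OF w(1) side_in_T, of a b s] that ab by (simp add: Aw_side)
  then have "geodesic_path T dd (linepath u v) u v"
    by (intro geodesic_path_linear) (use lin duv in \<open>auto simp: linepath_def\<close>)
  moreover have "path_length dd (linepath u v) = ennreal ((1/2) ^ n)"
    by (rule path_length_linear) (use lin in auto)
  ultimately show "geodesic_path (convex hull tri) dd (linepath u v) u v \<and>
      path_length dd (linepath u v) = ennreal ((1/2) ^ n)" by (simp add: hull_tri)
qed

section \<open>Geodesics and the skeleton of a subdivision\<close>

text \<open>The skeleton of the \<open>n\<close>-th subdivision, that is, the union of its edges.\<close>
definition Sk :: "nat \<Rightarrow> (real^2) set" where
  "Sk n = (\<Union>w\<in>words n. Aw w ` bdry)"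

lemma Sk_I: "w \<in> words n \<Longrightarrow> p \<in> bdry \<Longrightarrow> Aw w p \<in> Sk n"
  by (auto simp: Sk_def)

lemma Sk_subset_T: "Sk n \<subseteq> T"
  using Aw_in_T bdry_subset_T by (auto simp: Sk_def)

text \<open>The skeleton does not enter the interior of a cell.\<close>
lemma Sk_cell:
  assumes "Aw w p \<in> Sk n" "w \<in> words n" "p \<in> T"
  shows "p \<in> bdry"
proof -
  obtain w' q where q: "w' \<in> words n" "q \<in> bdry" "Aw w p = Aw w' q"
    using assms(1) by (auto simp: Sk_def)
  then show ?thesis using Aw_unique[OF assms(2) q(1) assms(3) _ q(3)] bdry_subset_T by auto
qed

definition linked :: "nat \<Rightarrow> real^2 \<Rightarrow> real^2 \<Rightarrow> bool" where
  "linked n x y \<longleftrightarrow> (\<exists>w\<in>words n. \<exists>p\<in>bdry. \<exists>q\<in>bdry. x = Aw w p \<and> y = Aw w q)"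

definition links :: "nat \<Rightarrow> (real \<Rightarrow> real^2) \<Rightarrow> (real \<times> real) set" where
  "links n g = {(s, s'). 0 \<le> s \<and> s \<le> s' \<and> s' \<le> 1 \<and> linked n (g s) (g s')}"

text \<open>
  A path leaves the cell in which it starts for a last time. After that it stays in the
  remaining cells, which gives an induction on their number.
\<close>
lemma path_links:
  assumes g: "path g" and "finite K" "K \<subseteq> words n" "0 \<le> s0" "s0 \<le> 1" "g s0 \<in> Sk n" "g 1 \<in> Sk n"
    and "g ` {s0..1} \<subseteq> (\<Union>w\<in>K. Aw w ` T)"
  shows "(s0, 1) \<in> (links n g)\<^sup>*"
  using assms(2-)
proof (induction "card K" arbitrary: K s0)
  case 0
  then show ?case by auto
next
  case (Suc k)
  have cg: "continuous_on {0..1} g" using g by (simp add: path_def)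
  obtain w p where w: "w \<in> K" "p \<in> T" "g s0 = Aw w p" using Suc.prems(3,4,7) by force
  have wn: "w \<in> words n" using w Suc.prems by auto
  have pb: "p \<in> bdry" using Sk_cell[OF _ wn w(2)] w(3) Suc.prems(5) by simp
  let ?S = "{s0..1} \<inter> g -` (Aw w ` T)"
  have cs: "continuous_on {s0..1} g" using cg by (rule continuous_on_subset) (use Suc.prems in auto)
  have "closed ?S" by (rule continuous_closed_preimage[OF cs closed_atLeastAtMost closed_cell])
  then have "compact ?S" by (simp add: compact_eq_bounded_closed bounded_Int)
  moreover have "s0 \<in> ?S" using w Suc.prems by auto
  ultimately obtain s1 where s1: "s1 \<in> ?S" "\<And>s. s \<in> ?S \<Longrightarrow> s \<le> s1"
    using compact_attains_sup[of ?S] by blast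
  obtain q where q: "q \<in> T" "g s1 = Aw w q" using s1(1) by auto
  have after: "g s \<notin> Aw w ` T" if "s1 < s" "s \<le> 1" for s
  proof
    assume "g s \<in> Aw w ` T"
    then have "s \<in> ?S" using that s1(1) by auto
    then show False using s1(2) that by force
  qed
  show ?case
  proof (cases "s1 = 1")
    case True
    have "q \<in> bdry" using Sk_cell[OF _ wn q(1)] q(2) Suc.prems(6) True by simp
    then have "linked n (g s0) (g 1)" using wn pb w(3) q(2) True unfolding linked_def by blast
    then show ?thesis using Suc.prems by (auto simp: links_def)
  next
    case False
    then have s1l: "s0 \<le> s1" "s1 < 1" using s1(1) by auto
    have lim: "((\<lambda>s. g s) \<longlongrightarrow> g s1) (at s1 within {s1<..1})"
    proof -
      have "(g \<longlongrightarrow> g s1) (at s1 within {0..1})"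
        using cg s1l Suc.prems unfolding continuous_on by auto
      then show ?thesis by (rule tendsto_within_subset) (use s1l Suc.prems in auto)
    qed
    have nb: "at s1 within {s1<..1} \<noteq> bot"
      using s1l by (simp add: at_within_eq_bot_iff)
    have inner: "g s1 \<in> closure S" if "\<And>s. s1 < s \<Longrightarrow> s \<le> 1 \<Longrightarrow> g s \<in> S" for S
    proof (rule Lim_in_closed_set[OF closed_closure _ nb lim])
      show "\<forall>\<^sub>F s in at s1 within {s1<..1}. g s \<in> closure S"
        unfolding eventually_at_filter using that closure_subset by (auto intro!: always_eventually)
    qed
    have "g s1 \<in> closure (- (Aw w ` T))" by (rule inner) (use after in auto)
    then have "g s1 \<in> frontier (Aw w ` T)"
      using q by (auto simp: frontier_def closure_complement intro!: closure_subset[THEN subsetD])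
    then obtain q' where q': "q' \<in> bdry" "g s1 = Aw w q'" using frontier_cell by blast
    have "linked n (g s0) (g s1)" using wn pb w(3) q' unfolding linked_def by blast
    then have "(s0, s1) \<in> links n g" using s1l Suc.prems by (auto simp: links_def)
    moreover have "(s1, 1) \<in> (links n g)\<^sup>*"
    proof (rule Suc.hyps(1)[of "K - {w}"])
      show "k = card (K - {w})" using Suc.hyps(2) w(1) Suc.prems(1) by simp
      show "finite (K - {w})" "K - {w} \<subseteq> words n" "0 \<le> s1" "s1 \<le> 1" using Suc.prems s1l by auto
      show "g s1 \<in> Sk n" using q' wn Sk_I by simp
      show "g 1 \<in> Sk n" by fact
      have late: "g s \<in> (\<Union>w\<in>K - {w}. Aw w ` T)" if "s1 < s" "s \<le> 1" for s
      proof -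
        have "s \<in> {s0..1}" using that s1l by auto
        then have "g s \<in> (\<Union>w\<in>K. Aw w ` T)" using Suc.prems(7) by blast
        then show ?thesis using after[OF that] by blast
      qed
      have "closed (\<Union>w\<in>K - {w}. Aw w ` T)" using Suc.prems(1) by (intro closed_UN) (auto simp: closed_cell)
      then have "g s1 \<in> (\<Union>w\<in>K - {w}. Aw w ` T)" using inner[OF late] by (simp add: closure_closed)
      then show "g ` {s1..1} \<subseteq> (\<Union>w\<in>K - {w}. Aw w ` T)"
        using late by (metis (no_types, lifting) atLeastAtMost_iff image_subsetI less_eq_real_def)
    qed
    ultimately show ?thesis by (rule converse_rtrancl_into_rtrancl)
  qed
qed

end

lemma (in Metric_space) geodesic_additive:
  assumes g: "geodesic_path M d g x y" and s: "0 \<le> r" "r \<le> s" "s \<le> u" "u \<le> 1"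
  shows "d (g r) (g u) = d (g r) (g s) + d (g s) (g u)"
proof -
  have gM: "g s \<in> M" if "s \<in> {0..1}" for s
    using g that unfolding geodesic_path_def pathin_def continuous_map_def by auto
  have gx: "g 0 = x" "g 1 = y" using g by (auto simp: geodesic_path_def)
  let ?ts = "[0, r, s, u, 1]"
  have "ennreal (\<Sum>i<length ?ts - 1. d (g (?ts ! i)) (g (?ts ! Suc i))) \<le> path_length d g"
    unfolding path_length_def by (rule SUP_upper) (use s in auto)
  also have "path_length d g = ennreal (d x y)" using g by (auto simp: geodesic_path_def)
  finally have "(\<Sum>i<length ?ts - 1. d (g (?ts ! i)) (g (?ts ! Suc i))) \<le> d x y"
    by (simp only: ennreal_le_iff[OF nonneg])
  then have le: "d x (g r) + d (g r) (g s) + d (g s) (g u) + d (g u) y \<le> d x y"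
    using gx by (simp add: eval_nat_numeral add.assoc)
  have M: "g 0 \<in> M" "g 1 \<in> M" "g r \<in> M" "g s \<in> M" "g u \<in> M" using gM s by auto
  have "d x y \<le> d x (g r) + d (g r) y" "d (g r) y \<le> d (g r) (g u) + d (g u) y"
    "d (g r) (g u) \<le> d (g r) (g s) + d (g s) (g u)"
    using M triangle gx by auto
  then show ?thesis using le by linarith
qed

text \<open>An arbitrary distance with the prescribed geodesic edges.\<close>
locale bary_metric = plane_triangle +
  fixes d :: "real^2 \<Rightarrow> real^2 \<Rightarrow> real"
  assumes geodesic: "geodesic_distance T d" and edges: "edges_geodesic tri d"
begin

sublocale Met: Metric_space T d
  using geodesic by (simp add: geodesic_distance_def)

text \<open>
  Geodesics, with the condition on the length replaced by the additivity of the distance.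
\<close>
definition geodesic_curve :: "(real \<Rightarrow> real^2) \<Rightarrow> real^2 \<Rightarrow> real^2 \<Rightarrow> bool" where
  "geodesic_curve g x y \<longleftrightarrow> path g \<and> pathin Met.mtopology g \<and> g 0 = x \<and> g 1 = y \<and>
     (\<forall>s\<in>{0..1}. g s \<in> T) \<and>
     (\<forall>r s u. 0 \<le> r \<longrightarrow> r \<le> s \<longrightarrow> s \<le> u \<longrightarrow> u \<le> 1 \<longrightarrow> d (g r) (g u) = d (g r) (g s) + d (g s) (g u))"

lemma geodesic_curveD:
  assumes "geodesic_curve g x y"
  shows "path g" "pathin Met.mtopology g" "g 0 = x" "g 1 = y" "s \<in> {0..1} \<Longrightarrow> g s \<in> T"
    "0 \<le> r \<Longrightarrow> r \<le> s \<Longrightarrow> s \<le> u \<Longrightarrow> u \<le> 1 \<Longrightarrow> d (g r) (g u) = d (g r) (g s) + d (g s) (g u)"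
  using assms unfolding geodesic_curve_def by blast+

lemma geodesic_curve_exists:
  assumes "x \<in> T" "y \<in> T"
  obtains g where "geodesic_curve g x y"
proof -
  obtain g where g: "path g" "geodesic_path T d g x y"
    using geodesic assms unfolding geodesic_distance_def by blast
  have p: "pathin Met.mtopology g" using g(2) by (simp add: geodesic_path_def)
  then have "\<forall>s\<in>{0..1}. g s \<in> T" unfolding pathin_def continuous_map_def by auto
  moreover have "g 0 = x" "g 1 = y" using g(2) by (auto simp: geodesic_path_def)
  ultimately have "geodesic_curve g x y"
    using g p Met.geodesic_additive[OF g(2)] unfolding geodesic_curve_def by blast
  then show ?thesis by (rule that)
qed

lemma edge_geodesic:
  assumes w: "w \<in> words n" and ab: "a < 3" "b < 3" "a \<noteq> b"
  shows "d (Aw w (vtx a)) (Aw w (vtx b)) = (1/2) ^ n"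
    "0 \<le> s \<Longrightarrow> s \<le> s' \<Longrightarrow> s' \<le> 1 \<Longrightarrow> d (Aw w (vtx a)) (Aw w (side a b s')) =
       d (Aw w (vtx a)) (Aw w (side a b s)) + d (Aw w (side a b s)) (Aw w (side a b s'))"
proof -
  let ?u = "Aw w (vtx a)" and ?v = "Aw w (vtx b)"
  have "vtx a \<noteq> vtx b" using ab bc_vtx'[of a a] bc_vtx'[of a b] by auto
  then have ne: "?u \<noteq> ?v" using Aw_inj[OF w vtx_in_T(1) vtx_in_T(1)] by blast
  have uv: "?u \<in> Aw w ` tri" "?v \<in> Aw w ` tri" using ab unfolding tri_eq by auto
  have "Aw w ` tri \<in> bary_subdivision n tri" using w unfolding bary_subdivision_eq by (rule imageI)
  note E = edges[unfolded edges_geodesic_def hull_tri, rule_format, OF this uv ne]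
  have g: "geodesic_path T d (linepath ?u ?v) ?u ?v"
    and len: "path_length d (linepath ?u ?v) = ennreal ((1/2) ^ n)"
    using E by auto
  have "ennreal (d ?u ?v) = ennreal ((1/2) ^ n)" using g len by (simp add: geodesic_path_def)
  then show "d ?u ?v = (1/2) ^ n" by (simp add: ennreal_inj)
  show "d ?u (Aw w (side a b s')) = d ?u (Aw w (side a b s)) + d (Aw w (side a b s)) (Aw w (side a b s'))"
    if "0 \<le> s" "s \<le> s'" "s' \<le> 1"
    using Met.geodesic_additive[OF g, of 0 s s'] that by (simp add: Aw_side linepath_def)
qed

text \<open>
  That an edge is a geodesic makes the distance additive along it but says nothing about its
  speed. Constant speed follows because both halves of the edge are edges of prescribed length.
\<close>
lemma edge_side_vertex:
  assumes w: "w \<in> words n" and ab: "a < 3" "b < 3" "a \<noteq> b" and s: "0 \<le> s" "s \<le> 1"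
  shows "d (Aw w (vtx a)) (Aw w (side a b s)) = (1/2) ^ n * s"
proof -
  have le: "d (Aw w (vtx a)) (Aw w (side a b s)) \<le> (1/2) ^ n * s"
    if "w \<in> words n" "a < 3" "b < 3" "a \<noteq> b" "0 \<le> s" "s \<le> 1" for n w a b s
  proof (rule side_from_vertex[where K = 1])
    fix n w and a b :: nat and s :: real
    assume a: "w \<in> words n" "a < 3" "b < 3" "a \<noteq> b" "0 \<le> s" "s \<le> 1"
    then have "d (Aw w (vtx a)) (Aw w (vtx b)) =
        d (Aw w (vtx a)) (Aw w (side a b s)) + d (Aw w (side a b s)) (Aw w (vtx b))"
      using edge_geodesic(2)[OF a(1-5), of 1] by simp
    then show "d (Aw w (vtx a)) (Aw w (side a b s)) \<le> 1 * (1/2) ^ n"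
      using edge_geodesic(1)[OF a(1-4)] Met.nonneg[of "Aw w (side a b s)" "Aw w (vtx b)"] by linarith
  qed (use that edge_geodesic(1) Met.triangle in auto)
  have "d (Aw w (vtx a)) (Aw w (vtx b)) =
      d (Aw w (vtx a)) (Aw w (side a b s)) + d (Aw w (side a b s)) (Aw w (vtx b))"
    using edge_geodesic(2)[OF w ab s(1), of 1] s by simp
  moreover have "d (Aw w (side a b s)) (Aw w (vtx b)) \<le> (1/2) ^ n * (1 - s)"
    using le[OF w ab(2,1) ab(3)[symmetric], of "1 - s"] s by (simp add: Met.commute side_rev[of b a])
  ultimately show ?thesis using le[OF w ab s] edge_geodesic(1)[OF w ab] by (simp add: algebra_simps)
qed

lemma skeleton_chain:
  assumes "x \<in> Sk n" "y \<in> Sk n"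
  obtains g where "geodesic_curve g x y" "(0, 1) \<in> (links n g)\<^sup>*"
proof -
  obtain g where g: "geodesic_curve g x y"
    using geodesic_curve_exists[of x y] assms Sk_subset_T by blast
  note D = geodesic_curveD[OF g]
  have "g ` {0..1} \<subseteq> (\<Union>w\<in>words n. Aw w ` T)"
  proof
    fix z assume "z \<in> g ` {0..1}"
    then have "z \<in> T" using D(5) by auto
    then obtain w p where "w \<in> words n" "p \<in> T" "z = Aw w p" by (rule T_cover_words)
    then show "z \<in> (\<Union>w\<in>words n. Aw w ` T)" by blast
  qed
  then have "(0, 1) \<in> (links n g)\<^sup>*"
    by (intro path_links[OF D(1), of "words n"]) (use D(3,4) assms in auto)
  then show ?thesis using that g by blast
qed

text \<open>The links of a geodesic reduce a bound on the skeleton to points of one cell.\<close>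
lemma skeleton_Lip:
  assumes F: "\<And>w p q. w \<in> words n \<Longrightarrow> p \<in> bdry \<Longrightarrow> q \<in> bdry \<Longrightarrow> F (Aw w q) - F (Aw w p) \<le> d (Aw w p) (Aw w q)"
    and xy: "x \<in> Sk n" "y \<in> Sk n"
  shows "F y - F x \<le> d x y"
proof -
  obtain g where g: "geodesic_curve g x y" and R: "(0, 1) \<in> (links n g)\<^sup>*"
    using skeleton_chain[OF xy] .
  note g = geodesic_curveD[OF g]
  have "F (g s) - F (g 0) \<le> d (g 0) (g s) \<and> 0 \<le> s \<and> s \<le> 1" if "(0, s) \<in> (links n g)\<^sup>*" for s
    using that
  proof (induction rule: rtrancl_induct)
    case base
    have "d (g 0) (g 0) = 0" using g(5)[of 0] by simp
    then show ?case by simp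
  next
    case (step s s')
    then have s: "0 \<le> s" "s \<le> s'" "s' \<le> 1" "linked n (g s) (g s')" by (auto simp: links_def)
    then have "F (g s') - F (g s) \<le> d (g s) (g s')" using F unfolding linked_def by auto
    then show ?case using step.IH g(6)[OF _ s(1-3)] s(1-3) by auto
  qed
  from this[OF R] g(3,4) show ?thesis by simp
qed

text \<open>
  One of the links of a geodesic from a point of \<open>S\<close> to a point outside \<open>S\<close> leaves \<open>S\<close>.
\<close>
lemma skeleton_cross:
  assumes xy: "x \<in> Sk n" "y \<in> Sk n" and S: "x \<in> S" "y \<notin> S"
  obtains w p q where "w \<in> words n" "p \<in> bdry" "q \<in> bdry" "Aw w p \<in> S" "Aw w q \<notin> S"
    "d x y = d x (Aw w p) + d (Aw w p) (Aw w q) + d (Aw w q) y"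
proof -
  obtain g where g: "geodesic_curve g x y" and R: "(0, 1) \<in> (links n g)\<^sup>*"
    using skeleton_chain[OF xy] .
  note g = geodesic_curveD[OF g]
  have "g s \<in> S \<or> (\<exists>r r'. (r, r') \<in> links n g \<and> g r \<in> S \<and> g r' \<notin> S)" if "(0, s) \<in> (links n g)\<^sup>*" for s
    using that
  proof (induction rule: rtrancl_induct)
    case base
    then show ?case using S g by simp
  qed blast
  from this[OF R] obtain r r' where r: "(r, r') \<in> links n g" "g r \<in> S" "g r' \<notin> S" using S g by auto
  then obtain w p q where w: "w \<in> words n" "p \<in> bdry" "q \<in> bdry" "g r = Aw w p" "g r' = Aw w q"
    using r(1) unfolding linked_def links_def by auto
  have "d x y = d x (g r) + d (g r) (g r') + d (g r') y"
    using g(6)[of 0 r 1] g(6)[of r r' 1] r g(3,4) unfolding links_def by auto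
  then show ?thesis using that[of w p q] w r by simp
qed

end

context plane_triangle
begin

section \<open>The distance from a vertex to the opposite side\<close>

lemma opposite_childE:
  assumes "p \<in> T" "a < 3" "bc a p = 0"
  obtains x y p' where "(x, y, a) \<in> Perms" "p' \<in> T" "p = A (x, y, a) p'" "bc 2 p' = 0"
proof -
  note main = that
  obtain b where "b < 3" "a \<noteq> b" using assms(2) by (metis less_3_cases zero_neq_one)
  then obtain c where abc: "(a, b, c) \<in> Perms" using third_vertex[OF assms(2)] by blast
  have pos: "bc b p \<ge> 0" "bc c p \<ge> 0" using bc_nonneg[OF assms(1)] Perms_less3[OF abc] by auto
  have *: thesis if xy: "(x, y, a) \<in> Perms" "bc x p \<ge> bc y p" "bc y p \<ge> 0" for x y
  proof -
    obtain p' where "p' \<in> T" "p = A (x, y, a) p'" "bc 2 p' = 3 * bc a p"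
      by (rule A_sortedE[OF xy(1,2)]) (use xy assms in auto)
    then show thesis using xy(1) assms(3) by (intro main[of x y p']) auto
  qed
  have "(b, c, a) \<in> Perms" "(c, b, a) \<in> Perms" using abc by (auto simp: Perms_def)
  then show thesis using * pos by (cases "bc b p \<ge> bc c p") auto
qed

text \<open>
  The open star of \<open>v\<close> in the cells of level \<open>n\<close> that have \<open>v\<close> as vertex number \<open>a\<close>.
\<close>
definition openstar :: "nat \<Rightarrow> nat \<Rightarrow> real^2 \<Rightarrow> (real^2) set" where
  "openstar n a v = {z. \<exists>w\<in>words n. \<exists>p\<in>T. z = Aw w p \<and> Aw w (vtx a) = v \<and> bc a p > 0}"

lemma openstar_Aw:
  assumes "w \<in> words n" "p \<in> T" "a < 3"
  shows "Aw w p \<in> openstar n a v \<longleftrightarrow> Aw w (vtx a) = v \<and> bc a p > 0"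
proof
  assume "Aw w p \<in> openstar n a v"
  then obtain w' p' where w': "w' \<in> words n" "p' \<in> T" "Aw w p = Aw w' p'" "Aw w' (vtx a) = v" "bc a p' > 0"
    unfolding openstar_def by blast
  from Aw_unique[OF assms(1) w'(1) assms(2) w'(2,3)] show "Aw w (vtx a) = v \<and> bc a p > 0"
    using w' assms(3) by auto
qed (use assms in \<open>auto simp: openstar_def\<close>)

lemma midpoint_coords:
  assumes "(x, y, z) \<in> Perms" "(x', y', z') \<in> Perms" "midpoint (vtx x) (vtx y) = midpoint (vtx x') (vtx y')"
  shows "z = z'"
proof -
  have lt: "x < 3" "y < 3" "z < 3" "x' < 3" "y' < 3" "z' < 3" using assms(1,2) by (auto simp: Perms_iff)
  have "bc z (midpoint (vtx x) (vtx y)) = 0" using assms(1) lt by (simp add: bc_midpoint bc_vtx' Perms_iff)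
  then have "bc z (vtx x') + bc z (vtx y') = 0" unfolding assms(3) by (simp add: bc_midpoint)
  moreover have "bc z (vtx x') \<ge> 0" "bc z (vtx y') \<ge> 0" using bc_nonneg[OF vtx_in_T(1) lt(3)] by auto
  ultimately have "bc z (vtx x') = 0" "bc z (vtx y') = 0" by linarith+
  then have "z \<noteq> x'" "z \<noteq> y'" using bc_vtx'[OF lt(3,4)] bc_vtx'[OF lt(3,5)] by auto
  then show ?thesis using Perms_cover[OF assms(2) lt(3)] by auto
qed

text \<open>
  A midpoint of a side determines the side, because in the interior of a common face the
  coordinates of two cells agree.
\<close>
lemma midpoint_shared:
  assumes w: "w \<in> words n" "w' \<in> words n" and P: "(x, y, z) \<in> Perms" "(x', y', z') \<in> Perms"
    and eq: "Aw w (midpoint (vtx x) (vtx y)) = Aw w' (midpoint (vtx x') (vtx y'))"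
  shows "z = z'" "Aw w (vtx x) = Aw w' (vtx x)" "Aw w (vtx y) = Aw w' (vtx y)"
proof -
  have T: "midpoint (vtx x) (vtx y) \<in> T" for x y
    using bc_nonneg[OF vtx_in_T(1)[of x]] bc_nonneg[OF vtx_in_T(1)[of y]] unfolding T_def by (simp add: bc_midpoint)
  note un = Aw_unique[OF w T T eq]
  show "z = z'" using midpoint_coords[OF P] un by blast
  have "bc x (midpoint (vtx x) (vtx y)) > 0" "bc y (midpoint (vtx x) (vtx y)) > 0" "x < 3" "y < 3"
    using P(1) by (auto simp: Perms_iff bc_midpoint bc_vtx')
  then show "Aw w (vtx x) = Aw w' (vtx x)" "Aw w (vtx y) = Aw w' (vtx y)" using un by auto
qed

end

context bary_metric
begin

text \<open>
  The way through the barycenter costs half an edge up to the barycenter; the rest is a distance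
  of the same kind in a child, with half of the error. The initial bound comes from following
  two sides.
\<close>
lemma opposite_le:
  assumes "w \<in> words n" "a < 3" "p \<in> T" "bc a p = 0"
  shows "d (Aw w (vtx a)) (Aw w p) \<le> (1/2) ^ n"
proof -
  have *: "d (Aw w (vtx a)) (Aw w p) \<le> (1/2) ^ n + (1/2) ^ n * (1/2) ^ k" for k
    using assms
  proof (induction k arbitrary: n w a p)
    case 0
    obtain b where b: "b < 3" "a \<noteq> b" using 0 by (metis less_3_cases zero_neq_one)
    then obtain c where abc: "(a, b, c) \<in> Perms" using third_vertex[OF 0(2)] by blast
    have p: "p = side b c (bc c p)" using opposite_sideE[of p a b c] 0 abc by (simp add: Perms_iff)
    have s: "0 \<le> bc c p" "bc c p \<le> 1" using bc_nonneg bc_le_1 0(3) Perms_less3[OF abc] by auto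
    have "d (Aw w (vtx b)) (Aw w p) = (1/2) ^ n * bc c p"
      by (subst p, rule edge_side_vertex[OF 0(1) _ _ _ s]) (use abc in \<open>auto simp: Perms_iff\<close>)
    also have "\<dots> \<le> (1/2) ^ n" using s by (simp add: mult_left_le)
    finally have "d (Aw w (vtx b)) (Aw w p) \<le> (1/2) ^ n" .
    moreover have "d (Aw w (vtx a)) (Aw w (vtx b)) = (1/2) ^ n"
      using edge_geodesic(1)[OF 0(1,2) b] .
    moreover have "d (Aw w (vtx a)) (Aw w p) \<le> d (Aw w (vtx a)) (Aw w (vtx b)) + d (Aw w (vtx b)) (Aw w p)"
      using 0 Aw_in_T[OF 0(1)] by (intro Met.triangle) auto
    ultimately show ?case by simp
  next
    case (Suc k)
    obtain x y p' where xy: "(x, y, a) \<in> Perms" "p' \<in> T" "p = A (x, y, a) p'" "bc 2 p' = 0"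
      using opposite_childE[OF Suc.prems(3,2,4)] .
    have P: "(a, x, y) \<in> Perms" using xy(1) by (auto simp: Perms_def)
    have "d (Aw (w @ [(a, x, y)]) (vtx 0)) (Aw (w @ [(a, x, y)]) (vtx 2)) = (1/2) ^ Suc n"
      by (rule edge_geodesic(1)[OF words_snoc[OF Suc.prems(1) P]]) auto
    then have 1: "d (Aw w (vtx a)) (Aw w G) = (1/2) ^ Suc n" by (simp add: Aw_snoc A_vtx)
    have "d (Aw (w @ [(x, y, a)]) (vtx 2)) (Aw (w @ [(x, y, a)]) p') \<le> (1/2) ^ Suc n + (1/2) ^ Suc n * (1/2) ^ k"
      by (rule Suc.IH[OF words_snoc[OF Suc.prems(1) xy(1)]]) (use xy in auto)
    then have 2: "d (Aw w G) (Aw w p) \<le> (1/2) ^ Suc n + (1/2) ^ Suc n * (1/2) ^ k"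
      by (simp add: Aw_snoc A_vtx xy(3))
    have "d (Aw w (vtx a)) (Aw w p) \<le> d (Aw w (vtx a)) (Aw w G) + d (Aw w G) (Aw w p)"
      using Suc.prems Aw_in_T[OF Suc.prems(1)] by (intro Met.triangle) auto
    then show ?case using 1 2 by simp
  qed
  have "d (Aw w (vtx a)) (Aw w p) \<le> (1/2) ^ n + e" if e: "e > 0" for e
  proof -
    obtain k where "(1/2) ^ n * (1/2) ^ k < e" by (rule ex_power_less[of "1/2" e "(1/2) ^ n"]) (use e in auto)
    then show ?thesis using *[of k] by linarith
  qed
  then show ?thesis by (rule field_le_epsilon)
qed

text \<open>
  The first vertex of a child is a vertex of the parent. The point \<open>q\<close> also lies opposite to the
  first vertex of a neighbouring child, whose distance to \<open>q\<close> is bounded from above by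
  \<open>opposite_le\<close>. Since both first vertices are the ends of an edge of the parent, the triangle
  inequality gives the bound.
\<close>
lemma opposite_first_ge:
  assumes W: "W \<in> words (Suc n)" and q: "q \<in> T" "bc 0 q = 0"
  shows "(1/2) ^ Suc n \<le> d (Aw W v0) (Aw W q)"
proof -
  obtain w l where w: "W = w @ [l]" "w \<in> words n" "l \<in> Perms" using words_Suc_snocE[OF W] .
  obtain x y z where l: "l = (x, y, z)" by (cases l)
  note P = w(3)[unfolded l]
  have P': "(y, x, z) \<in> Perms" using P by (auto simp: Perms_def)
  have eq: "A (x, y, z) q = A (y, x, z) q" using q(2) by (simp add: A_def midpoint_sym)
  have "d (Aw (w @ [(y, x, z)]) (vtx 0)) (Aw (w @ [(y, x, z)]) q) \<le> (1/2) ^ Suc n"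
    by (rule opposite_le[OF words_snoc[OF w(2) P']]) (use q in auto)
  then have "d (Aw w (vtx y)) (Aw W q) \<le> (1/2) ^ Suc n"
    by (simp add: w(1) l Aw_snoc A_vtx eq)
  moreover have "d (Aw w (vtx x)) (Aw w (vtx y)) = (1/2) ^ n"
    using edge_geodesic(1)[OF w(2)] P by (simp add: Perms_iff)
  moreover have "d (Aw w (vtx x)) (Aw w (vtx y)) \<le> d (Aw w (vtx x)) (Aw W q) + d (Aw W q) (Aw w (vtx y))"
    using Aw_in_T[OF w(2)] Aw_in_T[OF W q(1)] by (intro Met.triangle) auto
  moreover have "d (Aw W q) (Aw w (vtx y)) = d (Aw w (vtx y)) (Aw W q)" by (rule Met.commute)
  moreover have "Aw W v0 = Aw w (vtx x)" by (simp add: w(1) l Aw_snoc A_vtx)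
  ultimately show ?thesis by simp
qed

text \<open>A geodesic from \<open>u\<close> leaves the star of \<open>u\<close> through a side opposite to \<open>u\<close>.\<close>
lemma star_exit:
  assumes W: "W \<in> words (Suc n)" "Aw W v0 = u" and y: "y \<in> Sk (Suc n)" "y \<notin> openstar (Suc n) 0 u"
  obtains w q where "w \<in> words (Suc n)" "q \<in> bdry" "Aw w v0 = u" "bc 0 q = 0"
    "(1/2) ^ Suc n + d (Aw w q) y \<le> d u y"
proof -
  have u: "u \<in> Sk (Suc n)" using Sk_I[OF W(1) vtx_in_bdry, of 0] W(2) by simp
  have us: "u \<in> openstar (Suc n) 0 u" using openstar_Aw[OF W(1), of "vtx 0" 0 u] W(2) by simp
  obtain w p q where w: "w \<in> words (Suc n)" "p \<in> bdry" "q \<in> bdry" "Aw w p \<in> openstar (Suc n) 0 u"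
      "Aw w q \<notin> openstar (Suc n) 0 u" "d u y = d u (Aw w p) + d (Aw w p) (Aw w q) + d (Aw w q) y"
    by (rule skeleton_cross[OF u y(1) us y(2)])
  have T: "p \<in> T" "q \<in> T" using w(2,3) bdry_subset_T by auto
  have wu: "Aw w v0 = u" using w(4) openstar_Aw[OF w(1) T(1), of 0 u] by simp
  have q0: "bc 0 q = 0" using w(5) openstar_Aw[OF w(1) T(2), of 0 u] wu bc_nonneg[OF T(2), of 0] by simp
  have "d u (Aw w q) \<le> d u (Aw w p) + d (Aw w p) (Aw w q)"
    using u Sk_subset_T Aw_in_T[OF w(1)] T by (intro Met.triangle) auto
  then have "(1/2) ^ Suc n + d (Aw w q) y \<le> d u y"
    using opposite_first_ge[OF w(1) T(2) q0] wu w(6) by simp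
  then show ?thesis using that w(1,3) wu q0 by blast
qed

text \<open>
  A geodesic from the vertex \<open>u\<close> to a point \<open>Y\<close> of the opposite side first leaves the star of
  \<open>u\<close>, which costs half an edge. Later it enters the star of the midpoint of the half side that
  contains \<open>Y\<close>, at a point \<open>z2\<close> between an end \<open>av\<close> of that side and a barycenter \<open>bb\<close>.
  Comparison with \<open>av\<close> before \<open>z2\<close> and with \<open>bb\<close> after \<open>z2\<close> contributes another half edge, up to
  half of the error made for smaller cells.
\<close>
lemma opposite_ge_aux:
  assumes "w \<in> words n" "a < 3" "p \<in> T" "bc a p = 0"
  shows "(1/2) ^ n * (1 - (1/2) ^ k) \<le> d (Aw w (vtx a)) (Aw w p)"
  using assms
proof (induction k arbitrary: n w a p)
  case 0
  then show ?case by simp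
next
  case (Suc k)
  note w = Suc.prems(1)
  define h :: real where "h = (1/2) ^ Suc n"
  obtain x y p' where xy: "(x, y, a) \<in> Perms" "p' \<in> T" "p = A (x, y, a) p'" "bc 2 p' = 0"
    using opposite_childE[OF Suc.prems(3,2,4)] .
  define W u Y where "W = w @ [(x, y, a)]" and "u = Aw w (vtx a)" and "Y = Aw w p"
  have W: "W \<in> words (Suc n)" unfolding W_def by (rule words_snoc[OF w xy(1)])
  have YW: "Y = Aw W p'" by (simp add: Y_def W_def Aw_snoc xy(3))
  have xl: "x < 3" "y < 3" "a \<noteq> x" using xy(1) by (auto simp: Perms_iff)
  have ne: "Aw w (vtx x) \<noteq> u"
  proof
    assume "Aw w (vtx x) = u"
    then have "vtx x = vtx a" using Aw_inj[OF w] unfolding u_def by simp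
    then show False using bc_vtx'[OF Suc.prems(2) xl(1)] bc_vtx'[OF Suc.prems(2,2)] xl by simp
  qed
  show ?case
  proof (cases "bc 1 p' = 0")
    case True
    have "p' = v0" by (rule bc_eqI) (use True xy(4) in auto)
    then have "d u Y = (1/2) ^ n"
      using edge_geodesic(1)[OF w Suc.prems(2) xl(1,3)] by (simp add: YW W_def Aw_snoc A_vtx u_def)
    then show ?thesis unfolding u_def Y_def by (simp add: mult_left_le)
  next
    case False
    then have p1: "bc 1 p' > 0" using bc_nonneg[OF xy(2), of 1] by simp
    have P0: "(a, x, y) \<in> Perms" using xy(1) by (auto simp: Perms_def)
    have W0: "w @ [(a, x, y)] \<in> words (Suc n)" "Aw (w @ [(a, x, y)]) v0 = u"
      using words_snoc[OF w P0] by (auto simp: Aw_snoc A_vtx u_def)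
    have p'b: "p' \<in> bdry" using xy by (auto simp: bdry_def intro!: exI[of _ 2])
    have YSk: "Y \<in> Sk (Suc n)" unfolding YW by (rule Sk_I[OF W p'b])
    have YT: "Y \<in> T" using YSk Sk_subset_T by auto
    have "Y \<notin> openstar (Suc n) 0 u"
      using openstar_Aw[OF W xy(2), of 0 u] ne by (simp add: YW W_def Aw_snoc A_vtx)
    then obtain w1 q1 where w1: "w1 \<in> words (Suc n)" "q1 \<in> bdry" "Aw w1 v0 = u" "bc 0 q1 = 0"
      "h + d (Aw w1 q1) Y \<le> d u Y"
      using star_exit[OF W0 YSk] unfolding h_def by blast
    define z1 where "z1 = Aw w1 q1"
    have q1T: "q1 \<in> T" using w1(2) bdry_subset_T by auto
    have z1Sk: "z1 \<in> Sk (Suc n)" unfolding z1_def by (rule Sk_I[OF w1(1,2)])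
    have z1T: "z1 \<in> T" using z1Sk Sk_subset_T by auto
    define m where "m = Aw W v1"
    have m_eq: "m = Aw w (midpoint (vtx x) (vtx y))" by (simp add: m_def W_def Aw_snoc A_vtx)
    have z1m: "z1 \<notin> openstar (Suc n) 1 m"
    proof
      assume "z1 \<in> openstar (Suc n) 1 m"
      then have m1: "Aw w1 v1 = m" using openstar_Aw[OF w1(1) q1T, of 1 m] unfolding z1_def by simp
      obtain w' l where w': "w1 = w' @ [l]" "w' \<in> words n" "l \<in> Perms" using words_Suc_snocE[OF w1(1)] .
      obtain x1 y1 c1 where l: "l = (x1, y1, c1)" by (cases l)
      note P1 = w'(3)[unfolded l]
      have m2: "m = Aw w' (midpoint (vtx x1) (vtx y1))" using m1 by (simp add: w' l Aw_snoc A_vtx)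
      have sh: "c1 = a" "Aw w' (vtx x1) = Aw w (vtx x1)"
        using midpoint_shared[OF w'(2) w P1 xy(1)] m_eq m2 by auto
      have "Aw w' (vtx x1) = u" using w1(3) by (simp add: w' l Aw_snoc A_vtx)
      then have "Aw w (vtx x1) = Aw w (vtx a)" using sh by (simp add: u_def)
      then have "vtx x1 = vtx a" using Aw_inj[OF w] by simp
      moreover have "x1 < 3" "a \<noteq> x1" using P1 sh by (auto simp: Perms_iff)
      ultimately show False using bc_vtx'[OF Suc.prems(2), of x1] bc_vtx'[OF Suc.prems(2,2)] by simp
    qed
    have Ym: "Y \<in> openstar (Suc n) 1 m" using openstar_Aw[OF W xy(2), of 1 m] p1 by (simp add: YW m_def)
    obtain w2 p2 q2 where w2: "w2 \<in> words (Suc n)" "p2 \<in> bdry" "q2 \<in> bdry"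
        "Aw w2 p2 \<in> - openstar (Suc n) 1 m" "Aw w2 q2 \<notin> - openstar (Suc n) 1 m"
        "d z1 Y = d z1 (Aw w2 p2) + d (Aw w2 p2) (Aw w2 q2) + d (Aw w2 q2) Y"
      by (rule skeleton_cross[OF z1Sk YSk, of "- openstar (Suc n) 1 m"]) (use z1m Ym in auto)
    have T2: "p2 \<in> T" "q2 \<in> T" using w2(2,3) bdry_subset_T by auto
    have w2m: "Aw w2 v1 = m" using w2(5) openstar_Aw[OF w2(1) T2(2), of 1 m] by simp
    have "bc 1 p2 = 0"
      using w2(4) openstar_Aw[OF w2(1) T2(1), of 1 m] w2m bc_nonneg[OF T2(1), of 1] by simp
    then have p2: "p2 = side 0 2 (bc 2 p2)" using opposite_sideE[OF T2(1), of 1 0 2] by simp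
    define t where "t = bc 2 p2"
    have t: "0 \<le> t" "t \<le> 1" unfolding t_def using bc_nonneg bc_le_1 T2(1) by auto
    define z2 av bb where "z2 = Aw w2 p2" and "av = Aw w2 v0" and "bb = Aw w2 v2"
    have in_T: "z2 \<in> T" "av \<in> T" "bb \<in> T" "Aw w2 q2 \<in> T"
      using Aw_in_T[OF w2(1)] T2 by (auto simp: z2_def av_def bb_def)
    have "d av z2 = h * t"
      using edge_side_vertex[OF w2(1), of 0 2 t] t p2 by (simp add: z2_def av_def h_def t_def)
    moreover have "d bb z2 = h * (1 - t)"
      using edge_side_vertex[OF w2(1), of 2 0 "1 - t"] t p2 side_rev[of 0 2 t]
      by (simp add: z2_def bb_def h_def t_def)
    moreover have "h \<le> d av z1"
    proof -
      have "z1 \<notin> openstar (Suc n) 0 av" using openstar_Aw[OF w1(1) q1T, of 0 av] w1(4) by (simp add: z1_def)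
      then obtain w' q' where "h + d (Aw w' q') z1 \<le> d av z1"
        using star_exit[OF w2(1) av_def[symmetric] z1Sk] unfolding h_def by blast
      then show ?thesis using Met.nonneg[of "Aw w' q'" z1] by linarith
    qed
    moreover have "h * (1 - (1/2) ^ k) \<le> d bb Y"
    proof -
      obtain w3 l where w3: "w2 = w3 @ [l]" "w3 \<in> words n" "l \<in> Perms" using words_Suc_snocE[OF w2(1)] .
      obtain x2 y2 c2 where l: "l = (x2, y2, c2)" by (cases l)
      note P2 = w3(3)[unfolded l]
      have m3: "m = Aw w3 (midpoint (vtx x2) (vtx y2))" using w2m by (simp add: w3 l Aw_snoc A_vtx)
      have sh: "Aw w (vtx x) = Aw w3 (vtx x)" "Aw w (vtx y) = Aw w3 (vtx y)"
        using midpoint_shared[OF w w3(2) xy(1) P2] m_eq m3 by auto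
      have "p = side x y (bc y p)"
        using opposite_sideE[OF Suc.prems(3,4,2), of x y] xy(1) by (auto simp: Perms_iff)
      then have "Aw w p = Aw w3 p" using Aw_side[of w x y "bc y p"] Aw_side[of w3 x y "bc y p"] sh by metis
      then have Y3: "Y = Aw (w3 @ [(x, y, a)]) p'" by (simp add: Y_def Aw_snoc xy(3))
      have b3: "bb = Aw (w3 @ [(x, y, a)]) (vtx 2)" by (simp add: bb_def w3 l Aw_snoc A_vtx)
      show ?thesis unfolding Y3 b3 h_def
        by (rule Suc.IH[OF words_snoc[OF w3(2) xy(1)]]) (use xy in auto)
    qed
    moreover have "d av z1 \<le> d av z2 + d z2 z1" "d bb Y \<le> d bb z2 + d z2 Y" "d z2 Y \<le> d z2 (Aw w2 q2) + d (Aw w2 q2) Y"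
      using in_T z1T YT by (auto intro: Met.triangle)
    moreover have "d z2 z1 = d z1 z2" by (rule Met.commute)
    moreover have "d z1 Y = d z1 z2 + d z2 (Aw w2 q2) + d (Aw w2 q2) Y" using w2(6) by (simp add: z2_def)
    moreover have "h * (1 - t) = h - h * t" by (simp add: algebra_simps)
    ultimately have "h + (h * (1 - (1/2) ^ k)) \<le> d u Y" using w1(5) unfolding z1_def[symmetric] by linarith
    moreover have "h + h * (1 - (1/2) ^ k) = (1/2) ^ n * (1 - (1/2) ^ Suc k)" by (simp add: h_def field_simps)
    ultimately show ?thesis by (simp add: u_def Y_def)
  qed
qed

lemma opposite_eq:
  assumes "w \<in> words n" "a < 3" "p \<in> T" "bc a p = 0"
  shows "d (Aw w (vtx a)) (Aw w p) = (1/2) ^ n"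
proof (rule antisym[OF opposite_le[OF assms]])
  show "(1/2) ^ n \<le> d (Aw w (vtx a)) (Aw w p)"
  proof (rule field_le_epsilon)
    fix e :: real assume "e > 0"
    then obtain k where "(1/2) ^ n * (1/2) ^ k < e" using ex_power_less[of "1/2" e "(1/2) ^ n"] by force
    then show "(1/2) ^ n \<le> d (Aw w (vtx a)) (Aw w p) + e"
      using opposite_ge_aux[OF assms, of k] by (simp add: algebra_simps)
  qed
qed

lemma vertex_bdry_dist:
  assumes w: "w \<in> words n" and a: "a < 3" and p: "p \<in> bdry"
  shows "d (Aw w (vtx a)) (Aw w p) = (1/2) ^ n * (1 - bc a p)"
proof (cases "bc a p = 0")
  case True
  then show ?thesis using opposite_eq[OF w a] p bdry_subset_T by auto
next
  case False
  obtain c where c: "c < 3" "bc c p = 0" and pT: "p \<in> T" using p by (auto simp: bdry_def)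
  then have ca: "c \<noteq> a" using False by auto
  obtain b where P: "(c, a, b) \<in> Perms" using third_vertex[OF c(1) a ca] .
  have pe: "p = side a b (bc b p)" using opposite_sideE[OF pT c(2,1) a, of b] P by (simp add: Perms_iff)
  have "bc b p = 1 - bc a p" using bc_sum_Perms[OF P, of p] c by simp
  moreover have "0 \<le> bc b p" "bc b p \<le> 1" using bc_nonneg bc_le_1 pT P by (auto simp: Perms_iff)
  moreover have "d (Aw w (vtx a)) (Aw w (side a b (bc b p))) = (1/2) ^ n * bc b p"
    by (rule edge_side_vertex[OF w a]) (use P calculation in \<open>auto simp: Perms_iff\<close>)
  ultimately show ?thesis using pe by simp
qed

text \<open>
  On the boundary of a cell the distance from a vertex is an affine function of the barycentric
  coordinate that belongs to the vertex.
\<close>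
lemma bdry_dist_ge:
  assumes w: "w \<in> words n" and a: "a < 3" and p: "p \<in> bdry" "q \<in> bdry"
  shows "(1/2) ^ n * \<bar>bc a p - bc a q\<bar> \<le> d (Aw w p) (Aw w q)"
proof -
  have T: "Aw w (vtx a) \<in> T" "Aw w p \<in> T" "Aw w q \<in> T" using Aw_in_T[OF w] p bdry_subset_T by auto
  have "\<bar>d (Aw w (vtx a)) (Aw w p) - d (Aw w (vtx a)) (Aw w q)\<bar> \<le> d (Aw w p) (Aw w q)"
    using Met.triangle[OF T] Met.triangle[OF T(1,3,2)] Met.commute[of "Aw w p" "Aw w q"] by linarith
  moreover have "(1/2) ^ n * \<bar>bc a p - bc a q\<bar> = \<bar>(1/2) ^ n * (1 - bc a p) - (1/2) ^ n * (1 - bc a q)\<bar>"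
    by (simp add: abs_mult abs_minus_commute flip: right_diff_distrib)
  ultimately show ?thesis using vertex_bdry_dist[OF w a] p by simp
qed

end

section \<open>Interpolation of vertex values\<close>

text \<open>
  One of the numbers \<open>e0\<close>, \<open>e1\<close>, \<open>e2\<close> is minus the sum of two numbers of equal sign. Subtracting
  the value of \<open>f\<close> that belongs to it leaves these two, and their moduli add up to its modulus.
\<close>
lemma weighted_sum_le:
  fixes e0 e1 e2 f0 f1 f2 r D :: real
  assumes sum: "e0 + e1 + e2 = 0"
    and e: "r * \<bar>e0\<bar> \<le> D" "r * \<bar>e1\<bar> \<le> D" "r * \<bar>e2\<bar> \<le> D"
    and f: "\<bar>f0 - f1\<bar> \<le> r" "\<bar>f0 - f2\<bar> \<le> r" "\<bar>f1 - f2\<bar> \<le> r"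
  shows "e0 * f0 + e1 * f1 + e2 * f2 \<le> D"
proof -
  have b: "e * (f - g) \<le> \<bar>e\<bar> * r" if "\<bar>f - g\<bar> \<le> r" for e f g :: real
  proof -
    have "e * (f - g) \<le> \<bar>e\<bar> * \<bar>f - g\<bar>" by (simp add: abs_mult[symmetric])
    also have "\<dots> \<le> \<bar>e\<bar> * r" using that by (intro mult_left_mono) auto
    finally show ?thesis .
  qed
  have *: "e0 * f0 + e1 * f1 + e2 * f2 \<le> D"
    if s: "e0 + e1 + e2 = 0" "e1 * e2 \<ge> 0" "r * \<bar>e0\<bar> \<le> D" "\<bar>f1 - f0\<bar> \<le> r" "\<bar>f2 - f0\<bar> \<le> r" for e0 e1 e2 f0 f1 f2 :: real
  proof -
    have e0: "e0 = - e1 - e2" using s(1) by simp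
    have "e0 * f0 + e1 * f1 + e2 * f2 = e1 * (f1 - f0) + e2 * (f2 - f0)" unfolding e0 by (simp add: algebra_simps)
    also have "\<dots> \<le> \<bar>e1\<bar> * r + \<bar>e2\<bar> * r" using b[OF s(4), of e1] b[OF s(5), of e2] by linarith
    also have "\<bar>e1\<bar> * r + \<bar>e2\<bar> * r = r * \<bar>e0\<bar>"
    proof -
      have "\<bar>e0\<bar> = \<bar>e1\<bar> + \<bar>e2\<bar>" unfolding e0 using s(2) by (auto simp: zero_le_mult_iff)
      then show ?thesis by (simp add: algebra_simps)
    qed
    finally show ?thesis using s(3) by linarith
  qed
  consider "e1 * e2 \<ge> 0" | "e0 * e2 \<ge> 0" | "e0 * e1 \<ge> 0"
    by (metis linorder_not_le mult_less_0_iff not_less_iff_gr_or_eq)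
  then show ?thesis
  proof cases
    case 1
    then show ?thesis using *[of e0 e1 e2 f1 f0 f2] sum e f by (simp add: abs_minus_commute)
  next
    case 2
    then show ?thesis using *[of e1 e0 e2 f0 f1 f2] sum e f by (simp add: abs_minus_commute add_ac)
  next
    case 3
    then show ?thesis using *[of e2 e0 e1 f0 f2 f1] sum e f by (simp add: abs_minus_commute add_ac)
  qed
qed

context plane_triangle
begin

text \<open>
  The function that is affine on every cell of level \<open>n\<close> and agrees with \<open>f\<close> at the vertices.
  The choice of the cell is harmless because the coordinates of two cells agree on common faces.
\<close>
definition interp :: "nat \<Rightarrow> (real^2 \<Rightarrow> real) \<Rightarrow> real^2 \<Rightarrow> real" where
  "interp n f z = (let (w, p) = SOME (w, p). w \<in> words n \<and> p \<in> T \<and> z = Aw w p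
     in bc 0 p * f (Aw w v0) + bc 1 p * f (Aw w v1) + bc 2 p * f (Aw w v2))"

lemma interp_Aw:
  assumes "w \<in> words n" "p \<in> T"
  shows "interp n f (Aw w p) = bc 0 p * f (Aw w v0) + bc 1 p * f (Aw w v1) + bc 2 p * f (Aw w v2)"
proof -
  define wp where "wp = (SOME (w', p'). w' \<in> words n \<and> p' \<in> T \<and> Aw w p = Aw w' p')"
  obtain w' p' where wp: "wp = (w', p')" by (cases wp)
  have "case wp of (w', p') \<Rightarrow> w' \<in> words n \<and> p' \<in> T \<and> Aw w p = Aw w' p'"
    unfolding wp_def by (rule someI[of _ "(w, p)"]) (use assms in simp)
  then have w': "w' \<in> words n" "p' \<in> T" "Aw w p = Aw w' p'" by (simp_all add: wp)
  note un = Aw_unique[OF assms(1) w'(1) assms(2) w'(2,3)]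
  have eq: "bc a p' * f (Aw w' (vtx a)) = bc a p * f (Aw w (vtx a))" if "a < 3" for a
    using un that bc_nonneg[OF assms(2) that] by (cases "bc a p = 0") auto
  show ?thesis
    unfolding interp_def wp_def[symmetric] wp Let_def using eq[of 0] eq[of 1] eq[of 2] by simp
qed

lemma interp_vtx:
  assumes "w \<in> words n" "a < 3"
  shows "interp n f (Aw w (vtx a)) = f (Aw w (vtx a))"
  using interp_Aw[OF assms(1) vtx_in_T(1), of f a] assms(2) by (auto simp: less_3_cases)

end

context bary_metric
begin

text \<open>
  This bounds \<open>d\<close> from below: any assignment of values to the vertices of level \<open>n\<close> that
  respects the lengths of the edges is respected by \<open>d\<close> on the whole skeleton.
\<close>
lemma interp_Lip:
  assumes f: "\<And>w a b. w \<in> words n \<Longrightarrow> a < 3 \<Longrightarrow> b < 3 \<Longrightarrow> \<bar>f (Aw w (vtx a)) - f (Aw w (vtx b))\<bar> \<le> (1/2) ^ n"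
    and xy: "x \<in> Sk n" "y \<in> Sk n"
  shows "interp n f y - interp n f x \<le> d x y"
proof (rule skeleton_Lip[OF _ xy])
  fix w p q assume w: "w \<in> words n" and p: "p \<in> bdry" "q \<in> bdry"
  have T: "p \<in> T" "q \<in> T" using p bdry_subset_T by auto
  have "(bc 0 q - bc 0 p) * f (Aw w v0) + (bc 1 q - bc 1 p) * f (Aw w v1) + (bc 2 q - bc 2 p) * f (Aw w v2) \<le> d (Aw w p) (Aw w q)"
  proof (rule weighted_sum_le[where r = "(1/2) ^ n"])
    show "bc 0 q - bc 0 p + (bc 1 q - bc 1 p) + (bc 2 q - bc 2 p) = 0" using bc_sum[of p] bc_sum[of q] by simp
    have "(1/2) ^ n * \<bar>bc a q - bc a p\<bar> \<le> d (Aw w p) (Aw w q)" if "a < 3" for a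
      using bdry_dist_ge[OF w that p] by (simp add: abs_minus_commute)
    from this[of 0] this[of 1] this[of 2] show
      "(1/2) ^ n * \<bar>bc 0 q - bc 0 p\<bar> \<le> d (Aw w p) (Aw w q)" "(1/2) ^ n * \<bar>bc 1 q - bc 1 p\<bar> \<le> d (Aw w p) (Aw w q)"
      "(1/2) ^ n * \<bar>bc 2 q - bc 2 p\<bar> \<le> d (Aw w p) (Aw w q)" by simp_all
    show "\<bar>f (Aw w v0) - f (Aw w v1)\<bar> \<le> (1/2) ^ n" "\<bar>f (Aw w v0) - f (Aw w v2)\<bar> \<le> (1/2) ^ n"
      "\<bar>f (Aw w v1) - f (Aw w v2)\<bar> \<le> (1/2) ^ n"
      using f[OF w, of 0 1] f[OF w, of 0 2] f[OF w, of 1 2] by simp_all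
  qed
  then show "interp n f (Aw w q) - interp n f (Aw w p) \<le> d (Aw w p) (Aw w q)"
    unfolding interp_Aw[OF w T(1)] interp_Aw[OF w T(2)] by (simp add: algebra_simps)
qed

end

context plane_triangle
begin

section \<open>Uniqueness\<close>

lemma path_meets_bdry:
  assumes "path g" "0 \<le> s" "s \<le> u" "u \<le> 1"
    and "g s \<in> Aw w ` T \<longleftrightarrow> g u \<notin> Aw w ` T"
  obtains r where "s \<le> r" "r \<le> u" "g r \<in> Aw w ` bdry"
proof -
  have "connected (g ` {s..u})"
    using assms(1-4) by (intro connected_continuous_image) (auto simp: path_def elim: continuous_on_subset)
  moreover have "g s \<in> g ` {s..u}" "g u \<in> g ` {s..u}" using assms(3) by auto
  then have "g ` {s..u} \<inter> Aw w ` T \<noteq> {}" "g ` {s..u} - Aw w ` T \<noteq> {}"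
    using assms(5) by blast+
  ultimately have "g ` {s..u} \<inter> frontier (Aw w ` T) \<noteq> {}" by (rule connected_Int_frontier)
  then show ?thesis using that frontier_cell by fastforce
qed

lemma mesh_separates:
  assumes "x \<noteq> y"
  obtains N where "\<And>n w. N \<le> n \<Longrightarrow> w \<in> words n \<Longrightarrow> x \<in> Aw w ` T \<Longrightarrow> y \<notin> Aw w ` T"
proof -
  obtain K where K: "\<forall>n. \<forall>w\<in>words n. \<forall>p\<in>T. \<forall>q\<in>T. dist (Aw w p) (Aw w q) \<le> (2/3) ^ n * K"
    using mesh by blast
  have "dist (Aw [] v0) (Aw [] v0) \<le> (2/3) ^ 0 * K" using K words_0 vtx_in_T by blast
  then have K0: "K \<ge> 0" by simp
  obtain N where N: "K * (2/3) ^ N < dist x y"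
    by (rule ex_power_less[of "2/3" "dist x y" K]) (use assms in auto)
  have "y \<notin> Aw w ` T" if n: "N \<le> n" and w: "w \<in> words n" and x: "x \<in> Aw w ` T" for n w
  proof
    assume "y \<in> Aw w ` T"
    then have "dist x y \<le> (2/3) ^ n * K" using K w x by auto
    also have "\<dots> \<le> (2/3) ^ N * K" using n K0 by (intro mult_right_mono power_decreasing) auto
    finally show False using N by (simp add: mult.commute)
  qed
  then show ?thesis using that by blast
qed

end

context bary_metric
begin

text \<open>
  The plane topology and \<open>d\<close> are related only by the continuity of geodesics for both. A
  geodesic that starts in \<open>x\<close> leaves a small cell around \<open>x\<close> at a point that is close to \<open>x\<close> for
  \<open>d\<close>, and the vertices of the cell are within one edge length of that point.
\<close>
lemma vertex_approx:
  assumes x: "x \<in> T" and e: "e > 0"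
  obtains N where "\<And>n w a. N \<le> n \<Longrightarrow> w \<in> words n \<Longrightarrow> x \<in> Aw w ` T \<Longrightarrow> a < 3 \<Longrightarrow> d x (Aw w (vtx a)) \<le> e + (1/2) ^ n"
proof -
  have "v0 \<noteq> v1" using bc_vtx by (metis zero_neq_one)
  then obtain y where y: "y \<in> T" "y \<noteq> x" by (metis vtx_in_T(2,3))
  obtain g where g: "geodesic_curve g x y" using geodesic_curve_exists[OF x y(1)] .
  note D = geodesic_curveD(1-5)[OF g]
  have cg: "continuous_on {0..1} g" using D(1) by (simp add: path_def)
  have "closed ({0..1} \<inter> g -` {x})" by (rule continuous_closed_preimage[OF cg]) auto
  then have "compact ({0..1} \<inter> g -` {x})" by (simp add: compact_eq_bounded_closed bounded_Int)
  moreover have "0 \<in> {0..1} \<inter> g -` {x}" using D(3) by simp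
  ultimately obtain t where t: "t \<in> {0..1} \<inter> g -` {x}" "\<And>s. s \<in> {0..1} \<inter> g -` {x} \<Longrightarrow> s \<le> t"
    using compact_attains_sup[of "{0..1} \<inter> g -` {x}"] by blast
  have t01: "0 \<le> t" "t \<le> 1" "g t = x" using t(1) by auto
  then have t1: "t < 1" using D(4) y by (cases "t = 1") auto
  obtain U where U: "openin (top_of_set {0..1}) U" "t \<in> U" "\<forall>s\<in>U. g s \<in> Met.mball (g t) e"
  proof -
    have "t \<in> topspace (top_of_set {0..1})" using t01 by simp
    then show ?thesis using that D(2) e unfolding pathin_def Met.continuous_map_to_metric by metis
  qed
  obtain V where V: "open V" "U = {0..1} \<inter> V" using U(1) by (auto simp: openin_open)
  obtain \<delta> where \<delta>: "\<delta> > 0" "ball t \<delta> \<subseteq> V" using V U(2) openE by blast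
  define s where "s = min 1 (t + \<delta> / 2)"
  have s: "t < s" "s \<le> 1" "s < t + \<delta>" using \<delta>(1) t1 by (auto simp: s_def)
  have near: "d x (g r) < e" if "t \<le> r" "r \<le> s" for r
  proof -
    have "r \<in> U" using that s t01 \<delta>(2) unfolding V(2) by (auto simp: dist_real_def intro!: subsetD[OF \<delta>(2)])
    then show ?thesis using U(3) t01 by auto
  qed
  have "g s \<noteq> x" using t(2)[of s] s t01 by fastforce
  then obtain N where N: "\<And>n w. N \<le> n \<Longrightarrow> w \<in> words n \<Longrightarrow> x \<in> Aw w ` T \<Longrightarrow> g s \<notin> Aw w ` T"
    using mesh_separates[of x "g s"] by metis
  have "d x (Aw w (vtx a)) \<le> e + (1/2) ^ n" if n: "N \<le> n" and w: "w \<in> words n" "x \<in> Aw w ` T" and a: "a < 3" for n w a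
  proof -
    obtain r where r: "t \<le> r" "r \<le> s" "g r \<in> Aw w ` bdry"
      by (rule path_meets_bdry[OF D(1), of t s w]) (use t01 s N[OF n w] w in auto)
    then obtain q where q: "q \<in> bdry" "g r = Aw w q" by blast
    have qT: "q \<in> T" using q(1) bdry_subset_T by auto
    have "d (Aw w (vtx a)) (g r) = (1/2) ^ n * (1 - bc a q)"
      unfolding q(2) by (rule vertex_bdry_dist[OF w(1) a q(1)])
    also have "\<dots> \<le> (1/2) ^ n" using bc_nonneg[OF qT a] by (simp add: mult_left_le)
    finally have "d (g r) (Aw w (vtx a)) \<le> (1/2) ^ n" by (simp add: Met.commute)
    moreover have "d x (Aw w (vtx a)) \<le> d x (g r) + d (g r) (Aw w (vtx a))"
      using x D(5)[of r] r s t01 Aw_in_T[OF w(1)] by (intro Met.triangle) auto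
    ultimately show ?thesis using near[OF r(1,2)] by linarith
  qed
  then show ?thesis using that by blast
qed

text \<open>
  Interpolating the function \<open>e u\<close> from its values at the vertices turns the distances for \<open>e\<close>
  into lower bounds for the distances for \<open>d\<close>.
\<close>
lemma vertices_le:
  assumes e: "bary_metric v0 v1 v2 e"
    and w: "w \<in> words n" "w' \<in> words n" and a: "a < 3" "b < 3"
  shows "e (Aw w (vtx a)) (Aw w' (vtx b)) \<le> d (Aw w (vtx a)) (Aw w' (vtx b))"
proof -
  interpret E: bary_metric v0 v1 v2 e by (rule e)
  let ?u = "Aw w (vtx a)"
  have uT: "?u \<in> T" using Aw_in_T[OF w(1)] by simp
  have "interp n (e ?u) (Aw w' (vtx b)) - interp n (e ?u) ?u \<le> d ?u (Aw w' (vtx b))"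
  proof (rule interp_Lip)
    fix w1 i j assume w1: "w1 \<in> words n" and ij: "i < (3::nat)" "j < (3::nat)"
    let ?p = "Aw w1 (vtx i)" and ?q = "Aw w1 (vtx j)"
    have T: "?p \<in> T" "?q \<in> T" using Aw_in_T[OF w1] by auto
    have "e ?p ?q \<le> (1/2) ^ n" using E.edge_geodesic(1)[OF w1 ij] T by (cases "i = j") auto
    then show "\<bar>e ?u ?p - e ?u ?q\<bar> \<le> (1/2) ^ n"
      using E.Met.triangle[OF uT T] E.Met.triangle[OF uT T(2,1)] E.Met.commute[of ?p ?q] by linarith
  qed (use w in \<open>auto intro: Sk_I\<close>)
  then show ?thesis using uT by (simp add: interp_vtx w a)
qed

lemma distance_unique:
  assumes e: "bary_metric v0 v1 v2 e" and xy: "x \<in> T" "y \<in> T"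
  shows "d x y = e x y"
proof -
  interpret E: bary_metric v0 v1 v2 e by (rule e)
  have "\<bar>d x y - e x y\<bar> \<le> 0 + \<epsilon>" if \<epsilon>: "\<epsilon> > 0" for \<epsilon>
  proof -
    have \<epsilon>8: "\<epsilon> / 8 > 0" using \<epsilon> by simp
    obtain N1 where N1: "\<And>n w a. N1 \<le> n \<Longrightarrow> w \<in> words n \<Longrightarrow> x \<in> Aw w ` T \<Longrightarrow> a < 3 \<Longrightarrow> d x (Aw w (vtx a)) \<le> \<epsilon>/8 + (1/2) ^ n"
      using vertex_approx[OF xy(1) \<epsilon>8] by metis
    obtain N2 where N2: "\<And>n w a. N2 \<le> n \<Longrightarrow> w \<in> words n \<Longrightarrow> y \<in> Aw w ` T \<Longrightarrow> a < 3 \<Longrightarrow> d y (Aw w (vtx a)) \<le> \<epsilon>/8 + (1/2) ^ n"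
      using vertex_approx[OF xy(2) \<epsilon>8] by metis
    obtain N3 where N3: "\<And>n w a. N3 \<le> n \<Longrightarrow> w \<in> words n \<Longrightarrow> x \<in> Aw w ` T \<Longrightarrow> a < 3 \<Longrightarrow> e x (Aw w (vtx a)) \<le> \<epsilon>/8 + (1/2) ^ n"
      using E.vertex_approx[OF xy(1) \<epsilon>8] by metis
    obtain N4 where N4: "\<And>n w a. N4 \<le> n \<Longrightarrow> w \<in> words n \<Longrightarrow> y \<in> Aw w ` T \<Longrightarrow> a < 3 \<Longrightarrow> e y (Aw w (vtx a)) \<le> \<epsilon>/8 + (1/2) ^ n"
      using E.vertex_approx[OF xy(2) \<epsilon>8] by metis
    obtain N5 where N5: "1 * (1/2) ^ N5 < \<epsilon> / 8" by (rule ex_power_less[of "1/2" "\<epsilon>/8" 1]) (use \<epsilon> in auto)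
    define n where "n = Max {N1, N2, N3, N4, N5}"
    have n: "N1 \<le> n" "N2 \<le> n" "N3 \<le> n" "N4 \<le> n" "N5 \<le> n" by (simp_all add: n_def)
    have "(1/2::real) ^ n \<le> (1/2) ^ N5" using n by (intro power_decreasing) auto
    then have h: "(1/2::real) ^ n \<le> \<epsilon> / 8" using N5 by linarith
    obtain w p where w: "w \<in> words n" "p \<in> T" "x = Aw w p" using T_cover_words[OF xy(1)] .
    obtain w' q where w': "w' \<in> words n" "q \<in> T" "y = Aw w' q" using T_cover_words[OF xy(2)] .
    have xw: "x \<in> Aw w ` T" "y \<in> Aw w' ` T" using w w' by auto
    let ?u = "Aw w (vtx 0)" and ?v = "Aw w' (vtx 0)"
    have T: "?u \<in> T" "?v \<in> T" using Aw_in_T w w' vtx_in_T(1) by blast+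
    have "d ?u ?v = e ?u ?v"
      using vertices_le[OF e w(1) w'(1), of 0 0] E.vertices_le[OF bary_metric_axioms w(1) w'(1), of 0 0] by simp
    moreover have "d x ?u \<le> \<epsilon>/4" "d y ?v \<le> \<epsilon>/4" "e x ?u \<le> \<epsilon>/4" "e y ?v \<le> \<epsilon>/4"
      using N1[OF n(1) w(1) xw(1), of 0] N2[OF n(2) w'(1) xw(2), of 0] N3[OF n(3) w(1) xw(1), of 0] N4[OF n(4) w'(1) xw(2), of 0] h
      by auto
    moreover have "d x y \<le> d x ?u + d ?u ?v + d y ?v" "d ?u ?v \<le> d x ?u + d x y + d y ?v"
      using Met.triangle[OF xy(1) T(1) xy(2)] Met.triangle[OF T xy(2)] Met.triangle[OF T(1) xy(1) T(2)]
        Met.triangle[OF xy T(2)] Met.commute[of ?v y] Met.commute[of ?u x] by linarith+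
    moreover have "e x y \<le> e x ?u + e ?u ?v + e y ?v" "e ?u ?v \<le> e x ?u + e x y + e y ?v"
      using E.Met.triangle[OF xy(1) T(1) xy(2)] E.Met.triangle[OF T xy(2)] E.Met.triangle[OF T(1) xy(1) T(2)]
        E.Met.triangle[OF xy T(2)] E.Met.commute[of ?v y] E.Met.commute[of ?u x] by linarith+
    ultimately show ?thesis by linarith
  qed
  then have "\<bar>d x y - e x y\<bar> \<le> 0" by (rule field_le_epsilon)
  then show ?thesis by simp
qed

end

context plane_triangle
begin

lemma bary_metric_dd: "bary_metric v0 v1 v2 dd"
  by unfold_locales (rule geodesic_distance_dd, rule edges_geodesic_dd)

interpretation D: bary_metric v0 v1 v2 dd
  by (rule bary_metric_dd)

section \<open>Points on two sides\<close>

text \<open>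
  Values at the seven vertices of the first subdivision that respect its edges extend to a
  function \<open>F\<close> on its skeleton that respects \<^const>\<open>dd\<close>. The conclusion lists its values on the four
  children that meet the sides from \<open>x\<close> to \<open>y\<close> and from \<open>x\<close> to \<open>z\<close>.
\<close>
lemma labelling:
  assumes P: "(x, y, z) \<in> Perms"
    and c: "\<bar>fx - fxy\<bar> \<le> 1/2" "\<bar>fx - fxz\<bar> \<le> 1/2" "\<bar>fy - fxy\<bar> \<le> 1/2" "\<bar>fy - fyz\<bar> \<le> 1/2"
      "\<bar>fz - fxz\<bar> \<le> 1/2" "\<bar>fz - fyz\<bar> \<le> 1/2" "\<bar>fx - fb\<bar> \<le> 1/2" "\<bar>fy - fb\<bar> \<le> 1/2" "\<bar>fz - fb\<bar> \<le> 1/2"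
      "\<bar>fxy - fb\<bar> \<le> 1/2" "\<bar>fxz - fb\<bar> \<le> 1/2" "\<bar>fyz - fb\<bar> \<le> (1/2::real)"
  obtains F where "\<And>l l' p q. l \<in> Perms \<Longrightarrow> l' \<in> Perms \<Longrightarrow> p \<in> bdry \<Longrightarrow> q \<in> bdry \<Longrightarrow> F (A l' q) - F (A l p) \<le> dd (A l p) (A l' q)"
    "\<And>p. p \<in> T \<Longrightarrow> F (A (x, y, z) p) = bc 0 p * fx + bc 1 p * fxy + bc 2 p * fb"
    "\<And>p. p \<in> T \<Longrightarrow> F (A (y, x, z) p) = bc 0 p * fy + bc 1 p * fxy + bc 2 p * fb"
    "\<And>p. p \<in> T \<Longrightarrow> F (A (x, z, y) p) = bc 0 p * fx + bc 1 p * fxz + bc 2 p * fb"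
    "\<And>p. p \<in> T \<Longrightarrow> F (A (z, x, y) p) = bc 0 p * fz + bc 1 p * fxz + bc 2 p * fb"
proof -
  define f where "f p = (if bc x p = 1 then fx else if bc y p = 1 then fy else if bc z p = 1 then fz
    else if bc z p = 0 then fxy else if bc y p = 0 then fxz else if bc x p = 0 then fyz else fb)" for p
  have lt: "x < 3" "y < 3" "z < 3" "x \<noteq> y" "y \<noteq> z" "x \<noteq> z" using P by (auto simp: Perms_iff)
  have G: "bc a G = 1/3" if "a < 3" for a using that by (auto simp: less_3_cases)
  have fv: "f (vtx x) = fx" "f (vtx y) = fy" "f (vtx z) = fz" "f G = fb"
    "f (midpoint (vtx x) (vtx y)) = fxy" "f (midpoint (vtx x) (vtx z)) = fxz" "f (midpoint (vtx y) (vtx z)) = fyz"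
  proof -
    have ne: "(x = y) = False" "(y = x) = False" "(y = z) = False" "(z = y) = False" "(x = z) = False" "(z = x) = False"
      using lt by auto
    have v: "bc i (vtx j) = (if i = j then 1 else 0)" if "i \<in> {x, y, z}" "j \<in> {x, y, z}" for i j
      by (rule bc_vtx') (use that lt in auto)
    have vv: "bc x (vtx x) = 1" "bc x (vtx y) = 0" "bc x (vtx z) = 0" "bc y (vtx x) = 0" "bc y (vtx y) = 1" "bc y (vtx z) = 0"
      "bc z (vtx x) = 0" "bc z (vtx y) = 0" "bc z (vtx z) = 1" by (simp_all add: v ne)
    show "f (vtx x) = fx" "f (vtx y) = fy" "f (vtx z) = fz" "f G = fb"
      "f (midpoint (vtx x) (vtx y)) = fxy" "f (midpoint (vtx x) (vtx z)) = fxz" "f (midpoint (vtx y) (vtx z)) = fyz"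
      unfolding f_def bc_midpoint vv G[OF lt(1)] G[OF lt(2)] G[OF lt(3)] by simp_all
  qed
  have fv': "f (midpoint (vtx y) (vtx x)) = fxy" "f (midpoint (vtx z) (vtx x)) = fxz" "f (midpoint (vtx z) (vtx y)) = fyz"
    using fv(5-7) by (simp_all add: midpoint_sym)
  have W: "[l] \<in> words 1" if "l \<in> Perms" for l using that by (simp add: words_Cons)
  let ?F = "interp 1 f"
  have F: "?F (A l p) = bc 0 p * f (A l v0) + bc 1 p * f (A l v1) + bc 2 p * f (A l v2)" if "l \<in> Perms" "p \<in> T" for l p
    using interp_Aw[OF W[OF that(1)] that(2), of f] by simp
  have six: "l \<in> {(x, y, z), (x, z, y), (y, x, z), (y, z, x), (z, x, y), (z, y, x)}" if "l \<in> Perms" for l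
    using that P by (auto simp: Perms_def)
  have lab: "\<bar>f (A l (vtx a)) - f (A l (vtx b))\<bar> \<le> 1/2" if l: "l \<in> Perms" and ab: "a < 3" "b < 3" for l a b
  proof -
    have "\<bar>f (A l v0) - f (A l v1)\<bar> \<le> 1/2 \<and> \<bar>f (A l v0) - f (A l v2)\<bar> \<le> 1/2 \<and> \<bar>f (A l v1) - f (A l v2)\<bar> \<le> 1/2"
      using six[OF l] by (elim insertE emptyE; hypsubst; simp only: A_vtx fv fv'; intro conjI; use c in linarith)
    then have "\<bar>f (A l (vtx 0)) - f (A l (vtx 1))\<bar> \<le> 1/2" "\<bar>f (A l (vtx 0)) - f (A l (vtx 2))\<bar> \<le> 1/2"
      "\<bar>f (A l (vtx 1)) - f (A l (vtx 2))\<bar> \<le> 1/2" by simp_all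
    then show ?thesis using ab unfolding less_3_cases by (elim disjE; hypsubst; linarith)
  qed
  show ?thesis
  proof (rule that[of ?F])
    fix l l' p q assume l: "l \<in> Perms" "l' \<in> Perms" and p: "p \<in> bdry" "q \<in> bdry"
    show "?F (A l' q) - ?F (A l p) \<le> dd (A l p) (A l' q)"
    proof (rule D.interp_Lip)
      fix w a b assume "w \<in> words 1" "a < (3::nat)" "b < (3::nat)"
      moreover then obtain l where "w = [l]" "l \<in> Perms" by (auto elim!: words_Suc_ConsE[of _ 0, simplified])
      ultimately show "\<bar>f (Aw w (vtx a)) - f (Aw w (vtx b))\<bar> \<le> (1/2) ^ 1" using lab by simp
    qed (use Sk_I[OF W[OF l(1)] p(1)] Sk_I[OF W[OF l(2)] p(2)] in auto)
  next
    have P4: "(y, x, z) \<in> Perms" "(x, z, y) \<in> Perms" "(z, x, y) \<in> Perms" using P by (auto simp: Perms_def)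
    show "?F (A (x, y, z) p) = bc 0 p * fx + bc 1 p * fxy + bc 2 p * fb" if "p \<in> T" for p
      using F[OF P that] fv by (simp add: A_vtx)
    show "?F (A (y, x, z) p) = bc 0 p * fy + bc 1 p * fxy + bc 2 p * fb" if "p \<in> T" for p
      using F[OF P4(1) that] fv fv' by (simp add: A_vtx)
    show "?F (A (x, z, y) p) = bc 0 p * fx + bc 1 p * fxz + bc 2 p * fb" if "p \<in> T" for p
      using F[OF P4(2) that] fv by (simp add: A_vtx)
    show "?F (A (z, x, y) p) = bc 0 p * fz + bc 1 p * fxz + bc 2 p * fb" if "p \<in> T" for p
      using F[OF P4(3) that] fv fv' by (simp add: A_vtx)
  qed
qed

lemma two_sides_near:
  assumes P: "(x, y, z) \<in> Perms" and r: "0 \<le> \<alpha>" "\<alpha> \<le> 1/2" "0 \<le> \<beta>" "\<beta> \<le> 1/2"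
  shows "\<alpha> + \<beta> \<le> dd (side x y \<alpha>) (side x z \<beta>)"
proof -
  have P': "(x, z, y) \<in> Perms" using P by (auto simp: Perms_def)
  obtain F where F: "\<And>l l' p q. l \<in> Perms \<Longrightarrow> l' \<in> Perms \<Longrightarrow> p \<in> bdry \<Longrightarrow> q \<in> bdry \<Longrightarrow> F (A l' q) - F (A l p) \<le> dd (A l p) (A l' q)"
    "\<And>p. p \<in> T \<Longrightarrow> F (A (x, y, z) p) = bc 0 p * 0 + bc 1 p * (-1/2) + bc 2 p * 0"
    "\<And>p. p \<in> T \<Longrightarrow> F (A (x, z, y) p) = bc 0 p * 0 + bc 1 p * (1/2) + bc 2 p * 0"
    \<comment> \<open>opposite values at the midpoints of the two sides\<close>
    by (rule labelling[OF P, of 0 "-1/2" "1/2" 0 0 0 0]) auto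
  have e: "side x y \<alpha> = A (x, y, z) (side 0 1 (2 * \<alpha>))" "side x z \<beta> = A (x, z, y) (side 0 1 (2 * \<beta>))"
    by (rule side_halves(1))+
  have b: "side 0 1 (2 * \<alpha>) \<in> bdry" "side 0 1 (2 * \<beta>) \<in> bdry" using side_in_bdry r by auto
  then have t: "side 0 1 (2 * \<alpha>) \<in> T" "side 0 1 (2 * \<beta>) \<in> T" using bdry_subset_T by auto
  show ?thesis
    using F(1)[OF P P' b] unfolding e F(2)[OF t(1)] F(3)[OF t(2)] by (simp add: bc_side_01)
qed

lemma two_sides_far:
  assumes P: "(x, y, z) \<in> Perms" and r: "1/2 \<le> \<alpha>" "\<alpha> \<le> 1" "1/2 \<le> \<beta>" "\<beta> \<le> 1"
  shows "1 \<le> dd (side x y \<alpha>) (side x z \<beta>)"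
proof -
  have P': "(y, x, z) \<in> Perms" "(z, x, y) \<in> Perms" using P by (auto simp: Perms_def)
  \<comment> \<open>value \<open>0\<close> on the half side at \<open>y\<close>, value \<open>1\<close> on the half side at \<open>z\<close>\<close>
  obtain F where F: "\<And>l l' p q. l \<in> Perms \<Longrightarrow> l' \<in> Perms \<Longrightarrow> p \<in> bdry \<Longrightarrow> q \<in> bdry \<Longrightarrow> F (A l' q) - F (A l p) \<le> dd (A l p) (A l' q)"
    "\<And>p. p \<in> T \<Longrightarrow> F (A (y, x, z) p) = bc 0 p * 0 + bc 1 p * 0 + bc 2 p * (1/2)"
    "\<And>p. p \<in> T \<Longrightarrow> F (A (z, x, y) p) = bc 0 p * 1 + bc 1 p * 1 + bc 2 p * (1/2)"
    by (rule labelling[OF P, of "1/2" 0 1 0 "1/2" 1 "1/2"]) auto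
  have e: "side x y \<alpha> = A (y, x, z) (side 1 0 (2 * \<alpha> - 1))" "side x z \<beta> = A (z, x, y) (side 1 0 (2 * \<beta> - 1))"
    by (rule side_halves(2))+
  have b: "side 1 0 (2 * \<alpha> - 1) \<in> bdry" "side 1 0 (2 * \<beta> - 1) \<in> bdry" using side_in_bdry r by auto
  then have t: "side 1 0 (2 * \<alpha> - 1) \<in> T" "side 1 0 (2 * \<beta> - 1) \<in> T" using bdry_subset_T by auto
  show ?thesis
    using F(1)[OF P' b] unfolding e F(2)[OF t(1)] F(3)[OF t(2)] by (simp add: bc_side_01)
qed

text \<open>
  A geodesic from the half side next to \<open>y\<close> to a point of the half side next to \<open>x\<close> enters that
  half side through its child, from a point \<open>Z\<close> on one of the two other sides of the child. The
  distance from \<open>Z\<close> is half of a distance between two sides of \<open>T\<close>, known up to \<open>\<epsilon>\<close>; the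
  distance to \<open>Z\<close> is bounded from below by suitable labellings.
\<close>
lemma two_sides_step:
  assumes P: "(x, y, z) \<in> Perms" and r: "1/2 \<le> \<alpha>" "\<alpha> \<le> 1" "0 \<le> \<beta>" "\<beta> \<le> 1/2"
    and IH: "\<And>x y z \<alpha> \<beta>. (x, y, z) \<in> Perms \<Longrightarrow> 0 \<le> \<alpha> \<Longrightarrow> \<alpha> \<le> 1 \<Longrightarrow> 0 \<le> \<beta> \<Longrightarrow> \<beta> \<le> 1 \<Longrightarrow>
      min 1 (\<alpha> + \<beta>) - \<epsilon> \<le> dd (side x y \<alpha>) (side x z \<beta>)" and \<epsilon>: "\<epsilon> \<ge> 0"
  shows "min 1 (\<alpha> + \<beta>) - \<epsilon> / 2 \<le> dd (side x y \<alpha>) (side x z \<beta>)"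
proof -
  consider "\<beta> = 0" | "\<beta> = 1/2" | "0 < \<beta>" "\<beta> < 1/2" using r by linarith
  then show ?thesis
  proof cases
    case 1
    then show ?thesis using dd_side_vertex[of x y \<alpha>] P r \<epsilon> dd_commute[of "side x y \<alpha>"] by (simp add: Perms_iff min_def)
  next
    case 2
    have "1 \<le> dd (side x y \<alpha>) (side x z \<beta>)" by (rule two_sides_far[OF P r(1,2)]) (use 2 in auto)
    then show ?thesis using \<epsilon> by (simp add: min_def)
  next
    case 3
    have P': "(y, x, z) \<in> Perms" "(x, z, y) \<in> Perms" using P by (auto simp: Perms_def)
    define p q where "p = side x y \<alpha>" and "q = side x z \<beta>"
    have ep: "p = A (y, x, z) (side 1 0 (2 * \<alpha> - 1))" and eq: "q = A (x, z, y) (side 0 1 (2 * \<beta>))"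
      unfolding p_def q_def by (rule side_halves)+
    have bp: "side 1 0 (2 * \<alpha> - 1) \<in> bdry" and bq: "side 0 1 (2 * \<beta>) \<in> bdry" using side_in_bdry r by auto
    then have tp: "side 1 0 (2 * \<alpha> - 1) \<in> T" and tq: "side 0 1 (2 * \<beta>) \<in> T" using bdry_subset_T by auto
    have W: "[l] \<in> words 1" if "l \<in> Perms" for l using that by (simp add: words_Cons)
    have sk: "p \<in> Sk 1" "q \<in> Sk 1"
      using Sk_I[OF W[OF P'(1)] bp] Sk_I[OF W[OF P'(2)] bq] by (simp_all add: ep eq)
    \<comment> \<open>the half side that contains \<open>q\<close>, without its ends\<close>
    define S where "S = {A (x, z, y) s |s. s \<in> T \<and> bc 0 s > 0 \<and> bc 1 s > 0 \<and> bc 2 s = 0}"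
    have inS: "A l s \<in> S \<longleftrightarrow> l = (x, z, y) \<and> bc 0 s > 0 \<and> bc 1 s > 0 \<and> bc 2 s = 0" if "l \<in> Perms" "s \<in> T" for l s
    proof
      assume "A l s \<in> S"
      then obtain s' where s': "A l s = A (x, z, y) s'" "s' \<in> T" "bc 0 s' > 0" "bc 1 s' > 0" "bc 2 s' = 0"
        unfolding S_def by blast
      obtain l0 l1 l2 where l: "l = (l0, l1, l2)" by (cases l)
      note un = A_unique[OF that(1)[unfolded l] P'(2) that(2) s'(2) s'(1)[unfolded l]]
      have "l0 = x" "l2 = y" using un s' by auto
      then have "l = (x, z, y)" using that(1) P'(2) by (auto simp: l Perms_iff less_3_cases)
      then show "l = (x, z, y) \<and> bc 0 s > 0 \<and> bc 1 s > 0 \<and> bc 2 s = 0" using un(1) s' by simp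
    qed (use that in \<open>auto simp: S_def\<close>)
    have qS: "q \<in> S" unfolding eq inS[OF P'(2) tq] using 3 by (simp add: bc_side_01)
    have "y \<noteq> x" using P by (auto simp: Perms_iff)
    then have pS: "p \<notin> S" unfolding ep inS[OF P'(1) tp] by simp
    obtain w1 p1 q1 where w1: "w1 \<in> words 1" "p1 \<in> bdry" "q1 \<in> bdry" "Aw w1 p1 \<in> - S" "Aw w1 q1 \<notin> - S"
      "dd p q = dd p (Aw w1 p1) + dd (Aw w1 p1) (Aw w1 q1) + dd (Aw w1 q1) q"
      by (rule D.skeleton_cross[OF sk, of "- S"]) (use pS qS in auto)
    obtain l where l: "w1 = [l]" "l \<in> Perms" using w1(1) by (auto elim!: words_Suc_ConsE[of _ 0, simplified])
    have T1: "p1 \<in> T" "q1 \<in> T" using w1(2,3) bdry_subset_T by auto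
    have lx: "l = (x, z, y)" using w1(5) inS[OF l(2) T1(2)] l(1) by simp
    define Z where "Z = A (x, z, y) p1"
    have tri: "dd p Z + dd Z q \<le> dd p q"
      using w1(6) dd_triangle[of Z "Aw w1 q1" q] A_in_T[OF P'(2)] T1 tq unfolding Z_def l(1) lx eq by simp
    have Zq: "dd Z q = dd p1 (side 0 1 (2 * \<beta>)) / 2"
      unfolding Z_def eq by (rule dd_A[OF P'(2) T1(1) tq])
    have "bc 0 p1 = 0 \<or> bc 1 p1 = 0"
    proof -
      have "\<not> (bc 0 p1 > 0 \<and> bc 1 p1 > 0 \<and> bc 2 p1 = 0)" using w1(4) inS[OF l(2) T1(1)] l(1) lx by simp
      then show ?thesis using w1(2) T1(1) by (auto simp: bdry_def less_3_cases T_iff)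
    qed
    moreover define t where "t = bc 2 p1"
    have t: "0 \<le> t" "t \<le> 1" using bc_nonneg[OF T1(1), of 2] bc_le_1[OF T1(1), of 2] by (auto simp: t_def)
    ultimately consider "bc 1 p1 = 0" "p1 = side 0 2 t" | "bc 0 p1 = 0" "p1 = side 1 2 t"
      using opposite_sideE[OF T1(1), of 1 0 2] opposite_sideE[OF T1(1), of 0 1 2] unfolding t_def by auto
    then have "min 1 (\<alpha> + \<beta>) - \<epsilon> / 2 \<le> dd p Z + dd Z q"
    proof cases
      case 1
      \<comment> \<open>\<open>Z\<close> lies between the vertex \<open>x\<close> and the barycenter\<close>
      have b0: "bc 0 p1 = 1 - t" using bc_sum[of p1] 1(1) by (simp add: t_def)
      obtain F where F: "\<And>l l' p q. l \<in> Perms \<Longrightarrow> l' \<in> Perms \<Longrightarrow> p \<in> bdry \<Longrightarrow> q \<in> bdry \<Longrightarrow> F (A l' q) - F (A l p) \<le> dd (A l p) (A l' q)"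
        "\<And>p. p \<in> T \<Longrightarrow> F (A (y, x, z) p) = bc 0 p * 0 + bc 1 p * 0 + bc 2 p * (1/2)"
        "\<And>p. p \<in> T \<Longrightarrow> F (A (x, z, y) p) = bc 0 p * (1/2) + bc 1 p * (1/2) + bc 2 p * (1/2)"
        by (rule labelling[OF P, of "1/2" 0 "1/2" 0 "1/2" "1/2" "1/2"]) auto
      have "1/2 \<le> dd p Z" using F(1)[OF P'(1,2) bp w1(2)] unfolding ep Z_def F(2)[OF tp] F(3)[OF T1(1)]
        using b0 1(1) by (simp add: bc_side_01 t_def field_simps)
      moreover obtain F where F: "\<And>l l' p q. l \<in> Perms \<Longrightarrow> l' \<in> Perms \<Longrightarrow> p \<in> bdry \<Longrightarrow> q \<in> bdry \<Longrightarrow> F (A l' q) - F (A l p) \<le> dd (A l p) (A l' q)"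
        "\<And>p. p \<in> T \<Longrightarrow> F (A (y, x, z) p) = bc 0 p * (-1/2) + bc 1 p * 0 + bc 2 p * 0"
        "\<And>p. p \<in> T \<Longrightarrow> F (A (x, z, y) p) = bc 0 p * (1/2) + bc 1 p * 0 + bc 2 p * 0"
        by (rule labelling[OF P, of "1/2" 0 0 "-1/2" 0 0 0]) auto
      have "\<alpha> - t/2 \<le> dd p Z" using F(1)[OF P'(1,2) bp w1(2)] unfolding ep Z_def F(2)[OF tp] F(3)[OF T1(1)]
        using b0 1(1) by (simp add: bc_side_01 field_simps)
      moreover have "min 1 (t + 2 * \<beta>) - \<epsilon> \<le> 2 * dd Z q"
        using IH[of 0 2 1 t "2 * \<beta>", folded 1(2)] t r unfolding Zq by (simp add: Perms_iff)
      ultimately show ?thesis by (auto simp: min_def split: if_splits)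
    next
      case 2
      \<comment> \<open>\<open>Z\<close> lies between the midpoint of \<open>x\<close> and \<open>z\<close> and the barycenter\<close>
      have b1: "bc 1 p1 = 1 - t" using bc_sum[of p1] 2(1) by (simp add: t_def)
      obtain F where F: "\<And>l l' p q. l \<in> Perms \<Longrightarrow> l' \<in> Perms \<Longrightarrow> p \<in> bdry \<Longrightarrow> q \<in> bdry \<Longrightarrow> F (A l' q) - F (A l p) \<le> dd (A l p) (A l' q)"
        "\<And>p. p \<in> T \<Longrightarrow> F (A (y, x, z) p) = bc 0 p * 0 + bc 1 p * 0 + bc 2 p * (1/2)"
        "\<And>p. p \<in> T \<Longrightarrow> F (A (x, z, y) p) = bc 0 p * (1/2) + bc 1 p * 1 + bc 2 p * (1/2)"
        by (rule labelling[OF P, of "1/2" 0 1 0 "1/2" 1 "1/2"]) auto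
      have "1 - t/2 \<le> dd p Z" using F(1)[OF P'(1,2) bp w1(2)] unfolding ep Z_def F(2)[OF tp] F(3)[OF T1(1)]
        using b1 2(1) by (simp add: bc_side_01 t_def field_simps)
      moreover have "min 1 (t + (1 - 2 * \<beta>)) - \<epsilon> \<le> 2 * dd Z q"
        using IH[of 1 2 0 t "1 - 2 * \<beta>", folded 2(2) side_rev[of 0 1 "2 * \<beta>"]] t r unfolding Zq by (simp add: Perms_iff)
      ultimately show ?thesis using t r by (auto simp: min_def split: if_splits)
    qed
    then show ?thesis using tri unfolding p_def q_def by linarith
  qed
qed

text \<open>
  Equality holds, since one can pass through the common vertex or through the barycenter; only
  the lower bound requires work. The induction halves the error.
\<close>
lemma two_sides_ge:
  assumes P: "(x, y, z) \<in> Perms" and r: "0 \<le> \<alpha>" "\<alpha> \<le> 1" "0 \<le> \<beta>" "\<beta> \<le> 1"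
  shows "min 1 (\<alpha> + \<beta>) \<le> dd (side x y \<alpha>) (side x z \<beta>)"
proof -
  have *: "min 1 (\<alpha> + \<beta>) - (1/2) ^ k \<le> dd (side x y \<alpha>) (side x z \<beta>)" for k
    using assms
  proof (induction k arbitrary: x y z \<alpha> \<beta>)
    case 0
    have "min 1 (\<alpha> + \<beta>) \<le> 1" by simp
    then show ?case using dd_nonneg[of "side x y \<alpha>" "side x z \<beta>"] unfolding power_0 by linarith
  next
    case (Suc k)
    have h: "(1/2::real) ^ Suc k = (1/2) ^ k / 2" "(1/2::real) ^ k \<ge> 0" by simp_all
    have P': "(x, z, y) \<in> Perms" using Suc.prems(1) by (auto simp: Perms_def)
    consider "\<alpha> \<le> 1/2" "\<beta> \<le> 1/2" | "1/2 \<le> \<alpha>" "1/2 \<le> \<beta>" | "1/2 \<le> \<alpha>" "\<beta> \<le> 1/2" | "1/2 \<le> \<beta>" "\<alpha> \<le> 1/2" by linarith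
    then show ?case
    proof cases
      case 1
      have "\<alpha> + \<beta> \<le> dd (side x y \<alpha>) (side x z \<beta>)"
        by (rule two_sides_near[OF Suc.prems(1,2) 1(1) Suc.prems(4) 1(2)])
      then show ?thesis unfolding h(1) using h(2) min.cobounded2[of 1 "\<alpha> + \<beta>"] by linarith
    next
      case 2
      have "1 \<le> dd (side x y \<alpha>) (side x z \<beta>)"
        by (rule two_sides_far[OF Suc.prems(1) 2(1) Suc.prems(3) 2(2) Suc.prems(5)])
      then show ?thesis unfolding h(1) using h(2) min.cobounded1[of 1 "\<alpha> + \<beta>"] by linarith
    next
      case 3
      show ?thesis unfolding h(1)
        by (rule two_sides_step[OF Suc.prems(1) 3(1) Suc.prems(3,4) 3(2) Suc.IH h(2)])
    next
      case 4
      have "min 1 (\<beta> + \<alpha>) - (1/2) ^ Suc k \<le> dd (side x z \<beta>) (side x y \<alpha>)" unfolding h(1)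
        by (rule two_sides_step[OF P' 4(1) Suc.prems(5,2) 4(2) Suc.IH h(2)])
      then show ?thesis by (simp add: add.commute dd_commute)
    qed
  qed
  show ?thesis
  proof (rule field_le_epsilon)
    fix e :: real assume "e > 0"
    then obtain k where "1 * (1/2) ^ k < e" using ex_power_less[of "1/2" e 1] by force
    then show "min 1 (\<alpha> + \<beta>) \<le> dd (side x y \<alpha>) (side x z \<beta>) + e" using *[of k] by simp
  qed
qed

section \<open>Infinitely many geodesics\<close>

definition via :: "real^2 \<Rightarrow> real^2 \<Rightarrow> real^2 \<Rightarrow> real^2 \<Rightarrow> bool" where
  "via x u v y \<longleftrightarrow> u \<in> T \<and> v \<in> T \<and> dd x y = dd x u + dd u v + dd v y"

text \<open>Some geodesic from \<open>x\<close> to \<open>y\<close> contains an edge of a subdivision.\<close>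
definition edge_between :: "real^2 \<Rightarrow> real^2 \<Rightarrow> bool" where
  "edge_between x y \<longleftrightarrow>
     (\<exists>n w a b. w \<in> words n \<and> a < 3 \<and> b < 3 \<and> a \<noteq> b \<and> via x (Aw w (vtx a)) (Aw w (vtx b)) y)"

lemma via_refine:
  assumes "x \<in> T" "y \<in> T" "via x p q y" "via p u v q"
  shows "via x u v y"
proof -
  have T: "p \<in> T" "q \<in> T" "u \<in> T" "v \<in> T" using assms by (auto simp: via_def)
  have "dd x y \<le> dd x u + dd u y" "dd u y \<le> dd u v + dd v y" "dd x u \<le> dd x p + dd p u" "dd v y \<le> dd v q + dd q y"
    using dd_triangle T assms(1,2) by blast+
  then show ?thesis using assms(3,4) T unfolding via_def by linarith
qed

lemma edge_between_refine:
  "x \<in> T \<Longrightarrow> y \<in> T \<Longrightarrow> via x p q y \<Longrightarrow> edge_between p q \<Longrightarrow> edge_between x y"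
  unfolding edge_between_def using via_refine by meson

lemma via_commute: "via x u v y \<longleftrightarrow> via y v u x"
  unfolding via_def using dd_commute[of x y] dd_commute[of x u] dd_commute[of u v] dd_commute[of v y] by auto

lemma edge_between_commute: "edge_between x y \<Longrightarrow> edge_between y x"
  unfolding edge_between_def via_commute[of y] by metis

lemma edge_between_Aw:
  assumes w: "w \<in> words n" and xy: "x \<in> T" "y \<in> T" and e: "edge_between x y"
  shows "edge_between (Aw w x) (Aw w y)"
proof -
  obtain m u a b where u: "u \<in> words m" "a < 3" "b < 3" "a \<noteq> b" "via x (Aw u (vtx a)) (Aw u (vtx b)) y"
    using e unfolding edge_between_def by blast
  have T: "Aw u (vtx a) \<in> T" "Aw u (vtx b) \<in> T" using Aw_in_T[OF u(1)] by auto
  have "via (Aw w x) (Aw w (Aw u (vtx a))) (Aw w (Aw u (vtx b))) (Aw w y)"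
    using u(5) Aw_in_T[OF w] T xy unfolding via_def
    by (simp add: dd_Aw[OF w] flip: distrib_left)
  then show ?thesis
    unfolding edge_between_def using words_append[OF w u(1)] u(2-4) by (metis Aw_append)
qed

lemma edge_between_A:
  "l \<in> Perms \<Longrightarrow> x \<in> T \<Longrightarrow> y \<in> T \<Longrightarrow> edge_between x y \<Longrightarrow> edge_between (A l x) (A l y)"
  using edge_between_Aw[of "[l]" 1 x y] by (simp add: words_Cons)

lemma edge_between_left: "x \<in> T \<Longrightarrow> y \<in> T \<Longrightarrow> u \<in> T \<Longrightarrow> dd x y = dd x u + dd u y \<Longrightarrow> edge_between x u \<Longrightarrow> edge_between x y"
  by (rule edge_between_refine[of x y x u]) (auto simp: via_def dd_self)

lemma edge_between_right: "x \<in> T \<Longrightarrow> y \<in> T \<Longrightarrow> u \<in> T \<Longrightarrow> dd x y = dd x u + dd u y \<Longrightarrow> edge_between u y \<Longrightarrow> edge_between x y"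
  by (rule edge_between_refine[of x y u y]) (auto simp: via_def dd_self)

lemma edge_between_edge:
  assumes "w \<in> words n" "a < 3" "b < 3" "a \<noteq> b"
  shows "edge_between (Aw w (vtx a)) (Aw w (vtx b))"
proof -
  have "via (Aw w (vtx a)) (Aw w (vtx a)) (Aw w (vtx b)) (Aw w (vtx b))"
    using Aw_in_T[OF assms(1)] by (simp add: via_def dd_self)
  then show ?thesis using assms unfolding edge_between_def by blast
qed

lemma edge_between_vertex_side:
  assumes "a < 3" "b < 3" "a \<noteq> b" "0 < s" "s \<le> 1"
  shows "edge_between (vtx a) (side a b s)"
proof -
  obtain k where "1 * (1/2) ^ k < s" by (rule ex_power_less[of "1/2" s 1]) (use assms in auto)
  then have "(1/2) ^ k \<le> s" by simp
  then show ?thesis using assms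
  proof (induction k arbitrary: a b s)
    case 0
    then have "s = 1" by simp
    then show ?case using edge_between_edge[of "[]" 0 a b] 0 by simp
  next
    case (Suc k)
    obtain c where P: "(a, b, c) \<in> Perms" using third_vertex[OF Suc.prems(2-4)] .
    have W: "[(a, b, c)] \<in> words 1" using P by (simp add: words_Cons)
    show ?case
    proof (cases "2 * s \<le> 1")
      case True
      have "edge_between (vtx 0) (side 0 1 (2 * s))" by (rule Suc.IH) (use Suc.prems True in auto)
      then have "edge_between (A (a, b, c) (vtx 0)) (A (a, b, c) (side 0 1 (2 * s)))"
        using True Suc.prems by (intro edge_between_A[OF P] side_in_T) auto
      then show ?thesis unfolding side_halves(1)[of a b s c] by (simp add: A_vtx)
    next
      case False
      let ?m = "side a b (1/2)"
      have m: "?m = A (a, b, c) (vtx 1)" using side_halves(1)[of a b "1/2" c] by simp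
      have "edge_between (vtx a) ?m" using edge_between_edge[OF W, of 0 1] unfolding m by (simp add: A_vtx)
      moreover have "dd (vtx a) (side a b s) = dd (vtx a) ?m + dd ?m (side a b s)"
        using dd_side_vertex[of a b s] dd_side_vertex[of a b "1/2"] dd_side[of a b "1/2" s] Suc.prems False by simp
      ultimately show ?thesis using Suc.prems by (rule_tac edge_between_left[of _ _ ?m]) (auto intro: side_in_T)
    qed
  qed
qed

lemma edge_between_side:
  assumes "a < 3" "b < 3" "a \<noteq> b" "0 \<le> s" "s < s'" "s' \<le> 1"
  shows "edge_between (side a b s) (side a b s')"
proof -
  obtain k where "1 * (1/2) ^ k < s' - s" by (rule ex_power_less[of "1/2" "s' - s" 1]) (use assms in auto)
  then have "(1/2) ^ k \<le> s' - s" by simp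
  then show ?thesis using assms
  proof (induction k arbitrary: a b s s')
    case 0
    then have "s = 0" "s' = 1" by auto
    then show ?case using edge_between_edge[of "[]" 0 a b] 0 by simp
  next
    case (Suc k)
    obtain c where P: "(a, b, c) \<in> Perms" using third_vertex[OF Suc.prems(2-4)] .
    then have P': "(b, a, c) \<in> Perms" by (auto simp: Perms_def)
    consider "2 * s' \<le> 1" | "1 \<le> 2 * s" | "2 * s < 1" "1 < 2 * s'" by linarith
    then show ?case
    proof cases
      case 1
      have "edge_between (side 0 1 (2 * s)) (side 0 1 (2 * s'))" by (rule Suc.IH) (use Suc.prems 1 in auto)
      then show ?thesis unfolding side_halves(1)[of a b s c] side_halves(1)[of a b s' c]
        using 1 Suc.prems by (intro edge_between_A[OF P] side_in_T) auto
    next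
      case 2
      have "edge_between (side 1 0 (2 * s - 1)) (side 1 0 (2 * s' - 1))" by (rule Suc.IH) (use Suc.prems 2 in auto)
      then show ?thesis unfolding side_halves(2)[of a b s c] side_halves(2)[of a b s' c]
        using 2 Suc.prems by (intro edge_between_A[OF P'] side_in_T) auto
    next
      case 3
      let ?m = "side a b (1/2)"
      have m: "?m = A (a, b, c) (vtx 1)" using side_halves(1)[of a b "1/2" c] by simp
      have "edge_between (vtx 1) (side 1 0 (1 - 2 * s))" by (rule edge_between_vertex_side) (use Suc.prems 3 in auto)
      then have "edge_between (A (a, b, c) (vtx 1)) (A (a, b, c) (side 1 0 (1 - 2 * s)))"
        using 3 Suc.prems by (intro edge_between_A[OF P] side_in_T) auto
      moreover have "side 1 0 (1 - 2 * s) = side 0 1 (2 * s)" using side_rev[of 0 1 "2 * s"] by simp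
      ultimately have "edge_between (side a b s) ?m"
        unfolding m side_halves(1)[of a b s c] by (rule_tac edge_between_commute) simp
      moreover have "dd (side a b s) (side a b s') = dd (side a b s) ?m + dd ?m (side a b s')"
        using dd_side[of a b s s'] dd_side[of a b s "1/2"] dd_side[of a b "1/2" s'] Suc.prems 3 by simp
      ultimately show ?thesis using Suc.prems by (rule_tac edge_between_left[of _ _ ?m]) (auto intro: side_in_T)
    qed
  qed
qed

lemma opposite_dd: "a < 3 \<Longrightarrow> p \<in> T \<Longrightarrow> bc a p = 0 \<Longrightarrow> dd (vtx a) p = 1"
  using D.opposite_eq[of "[]" 0 a p] by simp

lemma bdry_G_child:
  assumes "p \<in> bdry"
  obtains x y z p' where "(x, y, z) \<in> Perms" "p' \<in> T" "p = A (x, y, z) p'" "bc 2 p' = 0"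
proof -
  obtain a where a: "a < 3" "bc a p = 0" "p \<in> T" using assms by (auto simp: bdry_def)
  from opposite_childE[OF a(3,1,2)] show ?thesis using that by metis
qed

text \<open>Every point of the boundary lies opposite to the barycenter in some child.\<close>
lemma bdry_G:
  assumes "p \<in> bdry"
  shows "dd p G = 1/2"
proof -
  obtain x y z p' where p: "(x, y, z) \<in> Perms" "p' \<in> T" "p = A (x, y, z) p'" "bc 2 p' = 0"
    using bdry_G_child[OF assms] .
  have "dd (A (x, y, z) p') (A (x, y, z) (vtx 2)) = dd p' (vtx 2) / 2"
    using p by (intro dd_A) auto
  then show ?thesis using opposite_dd[of 2 p'] p dd_commute[of p' v2] by (simp add: A_vtx)
qed

text \<open>
  In the child that contains \<open>p\<close>, the point \<open>p\<close> lies opposite to the barycenter of \<open>T\<close>. A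
  geodesic between them passes through the barycenter of that child, which is joined to the
  barycenter of \<open>T\<close> by an edge.
\<close>
lemma edge_between_bdry_G:
  assumes "p \<in> bdry"
  shows "edge_between p G"
proof -
  have opp: "edge_between p' (vtx 2)" if p': "p' \<in> T" "bc 2 p' = 0" for p'
  proof -
    have b: "p' \<in> bdry" using p' by (auto simp: bdry_def intro!: exI[of _ 2])
    have P: "(2, 0, 1) \<in> Perms" by (simp add: Perms_def)
    have W: "[(2, 0, 1)] \<in> words 1" using P by (simp add: words_Cons)
    have "edge_between G (vtx 2)" using edge_between_edge[OF W, of 2 0] by (simp add: A_vtx)
    moreover have "dd p' (vtx 2) = dd p' G + dd G (vtx 2)"
      using opposite_dd[of 2 p'] p' bdry_G[OF b] bdry_G[OF vtx_in_bdry, of 2] dd_commute[of p' v2] dd_commute[of G v2] by simp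
    ultimately show ?thesis using p' by (rule_tac edge_between_right[of _ _ G]) auto
  qed
  obtain x y z p' where p: "(x, y, z) \<in> Perms" "p' \<in> T" "p = A (x, y, z) p'" "bc 2 p' = 0"
    using bdry_G_child[OF assms] .
  have "edge_between (A (x, y, z) p') (A (x, y, z) (vtx 2))"
    by (rule edge_between_A[OF p(1,2) _ opp[OF p(2,4)]]) simp
  then show ?thesis using p by (simp add: A_vtx)
qed

text \<open>
  For points on two sides \<open>two_sides_ge\<close> shows that a geodesic passes through the common vertex
  or through the barycenter.
\<close>
lemma edge_between_bdry:
  assumes "p \<in> bdry" "q \<in> bdry" "p \<noteq> q"
  shows "edge_between p q"
proof -
  obtain c where c: "c < 3" "bc c p = 0" and pT: "p \<in> T" using assms(1) by (auto simp: bdry_def)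
  obtain c' where c': "c' < 3" "bc c' q = 0" and qT: "q \<in> T" using assms(2) by (auto simp: bdry_def)
  note r = bc_nonneg[OF pT] bc_le_1[OF pT] bc_nonneg[OF qT] bc_le_1[OF qT]
  show ?thesis
  proof (cases "c = c'")
    case True
    obtain a where a: "a < 3" "c \<noteq> a" using c(1) by (metis less_3_cases zero_neq_one)
    obtain b where P: "(c, a, b) \<in> Perms" using third_vertex[OF c(1) a] .
    have ab: "a < 3" "b < 3" "a \<noteq> b" using P by (auto simp: Perms_iff)
    have p: "p = side a b (bc b p)" and q: "q = side a b (bc b q)"
      using opposite_sideE[OF pT c(2,1), of a b] opposite_sideE[OF qT c'(2,1), of a b] P True by (auto simp: Perms_iff)
    have ne: "bc b p \<noteq> bc b q" using p q assms(3) by metis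
    then consider "bc b p < bc b q" | "bc b q < bc b p" by linarith
    then show ?thesis
    proof cases
      case 1
      then have "edge_between (side a b (bc b p)) (side a b (bc b q))" using ab r by (intro edge_between_side) auto
      then show ?thesis using p q by simp
    next
      case 2
      then have "edge_between (side a b (bc b q)) (side a b (bc b p))" using ab r by (intro edge_between_side) auto
      then show ?thesis using p q by (simp add: edge_between_commute)
    qed
  next
    case False
    obtain x where P0: "(c, c', x) \<in> Perms" using third_vertex[OF c(1) c'(1) False] .
    then have P: "(x, c', c) \<in> Perms" by (auto simp: Perms_iff)
    have lt: "x < 3" "x \<noteq> c" "x \<noteq> c'" using P by (auto simp: Perms_iff)
    define \<alpha> \<beta> where "\<alpha> = bc c' p" and "\<beta> = bc c q"
    have p: "p = side x c' \<alpha>" and q: "q = side x c \<beta>"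
      using opposite_sideE[OF pT c(2,1), of x c'] opposite_sideE[OF qT c'(2,1), of x c] P
      unfolding \<alpha>_def \<beta>_def by (auto simp: Perms_iff)
    have ab: "0 \<le> \<alpha>" "\<alpha> \<le> 1" "0 \<le> \<beta>" "\<beta> \<le> 1" using r c c' by (auto simp: \<alpha>_def \<beta>_def)
    have ge: "min 1 (\<alpha> + \<beta>) \<le> dd p q" unfolding p q by (rule two_sides_ge[OF P ab])
    have dx: "dd p (vtx x) = \<alpha>" "dd (vtx x) q = \<beta>"
      using dd_side_vertex[OF lt(1) c'(1) lt(3) ab(1,2)] dd_side_vertex[OF lt(1) c(1) lt(2) ab(3,4)] dd_commute[of p] p q by auto
    show ?thesis
    proof (cases "\<alpha> + \<beta> \<le> 1")
      case True
      have eq: "dd p q = dd p (vtx x) + dd (vtx x) q"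
        using dd_triangle[OF pT vtx_in_T(1) qT, of x] ge dx True by simp
      have "\<not> (\<alpha> = 0 \<and> \<beta> = 0)" using p q assms(3) by auto
      then consider "\<alpha> > 0" | "\<beta> > 0" using ab by linarith
      then show ?thesis
      proof cases
        case 1
        have "edge_between p (vtx x)" unfolding p
          by (rule edge_between_commute[OF edge_between_vertex_side]) (use 1 lt c' ab in auto)
        then show ?thesis using eq pT qT by (rule_tac edge_between_left[of p q "vtx x"]) auto
      next
        case 2
        have "edge_between (vtx x) q" unfolding q
          by (rule edge_between_vertex_side) (use 2 lt c ab in auto)
        then show ?thesis using eq pT qT by (rule_tac edge_between_right[of p q "vtx x"]) auto
      qed
    next
      case False
      have "dd p q = dd p G + dd G q"
        using dd_triangle[OF pT G_in_T qT] ge bdry_G[OF assms(1)] bdry_G[OF assms(2)] dd_commute[of q G] False by simp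
      then show ?thesis using edge_between_bdry_G[OF assms(1)] pT qT by (rule_tac edge_between_left[of p q G]) auto
    qed
  qed
qed

text \<open>
  A geodesic from \<open>x\<close> to \<open>y\<close> meets the boundaries of two disjoint small cells around its ends.
  One of the links between these points is nontrivial, and its ends lie on the boundary of one
  cell.
\<close>
lemma edge_between_distinct:
  assumes xy: "x \<in> T" "y \<in> T" "x \<noteq> y"
  shows "edge_between x y"
proof -
  obtain K where K: "\<forall>n. \<forall>w\<in>words n. \<forall>p\<in>T. \<forall>q\<in>T. dist (Aw w p) (Aw w q) \<le> (2/3) ^ n * K"
    using mesh by blast
  obtain n where n: "(2 * K) * (2/3) ^ n < dist x y"
    by (rule ex_power_less[of "2/3" "dist x y" "2 * K"]) (use xy in auto)
  obtain w p where w: "w \<in> words n" "p \<in> T" "x = Aw w p" using T_cover_words[OF xy(1)] .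
  obtain u q where u: "u \<in> words n" "q \<in> T" "y = Aw u q" using T_cover_words[OF xy(2)] .
  have disj: "Aw w ` T \<inter> Aw u ` T = {}"
  proof (rule ccontr)
    assume "Aw w ` T \<inter> Aw u ` T \<noteq> {}"
    then obtain p' q' where p': "p' \<in> T" "q' \<in> T" "Aw w p' = Aw u q'" by fastforce
    have "dist x (Aw w p') \<le> (2/3) ^ n * K" "dist y (Aw w p') \<le> (2/3) ^ n * K"
      using K[rule_format, OF w(1,2) p'(1)] K[rule_format, OF u(1,2) p'(2)] unfolding w(3) u(3) p'(3) .
    then show False using n dist_triangle2[of x y "Aw w p'"] by (simp add: algebra_simps)
  qed
  obtain g where g: "D.geodesic_curve g x y" using D.geodesic_curve_exists[OF xy(1,2)] .
  note gD = D.geodesic_curveD[OF g]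
  have "y \<notin> Aw w ` T" using disj u by blast
  then obtain r where r: "0 \<le> r" "r \<le> 1" "g r \<in> Aw w ` bdry"
    by (rule_tac path_meets_bdry[OF gD(1), of 0 1 w]) (use w gD(3,4) in auto)
  have "g r \<notin> Aw u ` T" using disj r(3) bdry_subset_T by blast
  then obtain r' where r': "r \<le> r'" "r' \<le> 1" "g r' \<in> Aw u ` bdry"
    by (rule_tac path_meets_bdry[OF gD(1), of r 1 u]) (use u r gD(4) in auto)
  define P Q where "P = g r" and "Q = g r'"
  obtain p2 q2 where pq2: "p2 \<in> bdry" "P = Aw w p2" "q2 \<in> bdry" "Q = Aw u q2"
    using r(3) r'(3) unfolding P_def Q_def by auto
  then have "P \<in> Aw w ` T" "Q \<in> Aw u ` T" using bdry_subset_T by auto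
  then have "P \<noteq> Q" using disj by auto
  have sk: "P \<in> Sk n" "Q \<in> Sk n"
    using Sk_I[OF w(1) pq2(1)] Sk_I[OF u(1) pq2(3)] pq2(2,4) by auto
  then have PQ: "P \<in> T" "Q \<in> T" using Sk_subset_T by auto
  have "dd x y = dd x Q + dd Q y" "dd x Q = dd x P + dd P Q"
    using gD(6)[of 0 r' 1] gD(6)[of 0 r r'] r r' gD(3,4) unfolding P_def Q_def by auto
  then have v1: "via x P Q y" using PQ by (simp add: via_def)
  obtain w1 p1 q1 where w1: "w1 \<in> words n" "p1 \<in> bdry" "q1 \<in> bdry" "Aw w1 p1 \<in> {P}" "Aw w1 q1 \<notin> {P}"
    "dd P Q = dd P (Aw w1 p1) + dd (Aw w1 p1) (Aw w1 q1) + dd (Aw w1 q1) Q"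
    by (rule D.skeleton_cross[OF sk, of "{P}"]) (use \<open>P \<noteq> Q\<close> in auto)
  have T1: "p1 \<in> T" "q1 \<in> T" using w1(2,3) bdry_subset_T by auto
  then have "via P (Aw w1 p1) (Aw w1 q1) Q" using w1(6) Aw_in_T[OF w1(1)] by (simp add: via_def)
  then have "via x (Aw w1 p1) (Aw w1 q1) y" by (rule via_refine[OF xy(1,2) v1])
  moreover have "p1 \<noteq> q1" using w1(4,5) by auto
  then have "edge_between (Aw w1 p1) (Aw w1 q1)"
    by (intro edge_between_Aw[OF w1(1) T1] edge_between_bdry w1(2,3))
  ultimately show ?thesis by (rule edge_between_refine[OF xy(1,2)])
qed

text \<open>
  Between the ends of an edge one can pass through its midpoint or through the barycenter of a
  cell at the edge; both are half an edge away from both ends.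
\<close>
lemma two_points_between:
  assumes xy: "x \<in> T" "y \<in> T" "x \<noteq> y"
  obtains z z' where "z \<in> T" "z' \<in> T" "z \<noteq> z'" "dd x z = dd x z'"
    "dd x y = dd x z + dd z y" "dd x y = dd x z' + dd z' y"
proof -
  obtain n w a b where w: "w \<in> words n" "a < 3" "b < 3" "a \<noteq> b" and v: "via x (Aw w (vtx a)) (Aw w (vtx b)) y"
    using edge_between_distinct[OF xy] unfolding edge_between_def by blast
  let ?u = "Aw w (vtx a)" and ?v = "Aw w (vtx b)"
  obtain c where P: "(a, b, c) \<in> Perms" using third_vertex[OF w(2-4)] .
  then have P': "(b, a, c) \<in> Perms" by (auto simp: Perms_def)
  note W = words_snoc[OF w(1) P] and W' = words_snoc[OF w(1) P']
  define z z' where "z = Aw w (midpoint (vtx a) (vtx b))" and "z' = Aw w G"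
  have ch: "Aw (w @ [(a, b, c)]) (vtx 0) = ?u" "Aw (w @ [(a, b, c)]) (vtx 1) = z" "Aw (w @ [(a, b, c)]) (vtx 2) = z'"
    "Aw (w @ [(b, a, c)]) (vtx 0) = ?v" "Aw (w @ [(b, a, c)]) (vtx 1) = z" "Aw (w @ [(b, a, c)]) (vtx 2) = z'"
    by (simp_all add: Aw_snoc A_vtx z_def z'_def midpoint_sym)
  have T: "z \<in> T" "z' \<in> T" "?u \<in> T" "?v \<in> T"
    using Aw_in_T[OF W, of "vtx 1"] Aw_in_T[OF W, of "vtx 2"] Aw_in_T[OF w(1)] ch by auto
  have e: "dd ?u z = (1/2) ^ Suc n" "dd ?u z' = (1/2) ^ Suc n" "dd ?v z = (1/2) ^ Suc n" "dd ?v z' = (1/2) ^ Suc n"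
    "dd z z' = (1/2) ^ Suc n" "dd ?u ?v = (1/2) ^ n"
    using dd_edge[OF W, of 0 1] dd_edge[OF W, of 0 2] dd_edge[OF W, of 1 2] dd_edge[OF W', of 0 1] dd_edge[OF W', of 0 2]
      dd_edge[OF w] ch by auto
  have "z \<noteq> z'" using e(5) dd_self[of z] by auto
  have half: "(1/2::real) ^ n = (1/2) ^ Suc n + (1/2) ^ Suc n" by simp
  have main: "dd x m = dd x ?u + (1/2) ^ Suc n" "dd x y = dd x m + dd m y"
    if m: "m \<in> T" "dd ?u m = (1/2) ^ Suc n" "dd ?v m = (1/2) ^ Suc n" for m
  proof -
    have "dd x m \<le> dd x ?u + dd ?u m" "dd m y \<le> dd m ?v + dd ?v y" "dd x y \<le> dd x m + dd m y"
      using dd_triangle T m(1) xy by blast+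
    moreover have "dd x y = dd x ?u + dd ?u ?v + dd ?v y" using v by (simp add: via_def)
    ultimately show "dd x m = dd x ?u + (1/2) ^ Suc n" "dd x y = dd x m + dd m y"
      using m e(6) half dd_commute[of m ?v] by linarith+
  qed
  show ?thesis
    using that[OF T(1,2) \<open>z \<noteq> z'\<close>] main[OF T(1) e(1,3)] main[OF T(2) e(2,4)] by simp
qed

text \<open>
  The part of a geodesic between the distances \<open>2\<^sup>-\<^sup>k\<^sup>-\<^sup>1\<close> and \<open>2\<^sup>-\<^sup>k\<close> from \<open>x\<close>, relative to its
  length, can be rerouted through a point off the geodesic. Different \<open>k\<close> give different images.
\<close>
lemma infinite_geodesics:
  assumes xy: "x \<in> T" "y \<in> T" "x \<noteq> y"
  shows "infinite (geodesic_images T dd x y)"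
proof -
  define L where "L = dd x y"
  have L: "L > 0" using dd_pos[OF xy] by (simp add: L_def)
  obtain g where g: "geodesic_path T dd g x y" and gC: "aligned x (g ` {0..1})" "g ` {0..1} \<subseteq> T" and gr: "\<And>s. s \<in> {0..1} \<Longrightarrow> dd x (g s) = L * s"
    unfolding L_def
    by (rule geodesic_through[of x "{x, y}" y]) (use aligned_pair[OF xy(1,2)] xy dd_self[of x] dd_nonneg[of x y] in auto)
  define C where "C = g ` {0..1}"
  have al: "dd u v = \<bar>dd x u - dd x v\<bar>" if "u \<in> C" "v \<in> C" for u v using gC(1) that unfolding aligned_def C_def by blast
  have CT: "u \<in> T" if "u \<in> C" for u using gC(2) that by (auto simp: C_def)
  have inj: "u = v" if "u \<in> C" "v \<in> C" "dd x u = dd x v" for u v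
    using al[OF that(1,2)] that(3) dd_pos[OF CT[OF that(1)] CT[OF that(2)]] by fastforce
  have CL: "dd x u \<le> L" if "u \<in> C" for u using that gr L by (auto simp: C_def mult_left_le)
  have full: "\<exists>u\<in>C. dd x u = r" if "0 \<le> r" "r \<le> L" for r
  proof -
    have "r / L \<in> {0..1}" using that L by (simp add: divide_le_eq_1)
    then show ?thesis using gr[of "r / L"] L unfolding C_def by auto
  qed
  define R where "R k = L * (1/2) ^ k" for k :: nat
  have R: "0 < R k" "R k \<le> L" "R (Suc k) < R k" for k
    using L by (auto simp: R_def mult_left_le power_le_one)
  have Rmono: "R j \<le> R k" if "k \<le> j" for j k
    unfolding R_def using L that by (intro mult_left_mono power_decreasing) auto
  have "\<exists>z. z \<in> T \<and> z \<notin> C \<and> R (Suc k) < dd x z \<and> dd x z < R k \<and>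
      (\<forall>u\<in>C. dd x u \<le> R (Suc k) \<or> R k \<le> dd x u \<longrightarrow> dd z u = \<bar>dd x z - dd x u\<bar>)" for k
  proof -
    obtain p q where p: "p \<in> C" "dd x p = R (Suc k)" and q: "q \<in> C" "dd x q = R k"
      using full R by (metis less_imp_le)
    have pq: "dd p q = R k - R (Suc k)" using al[OF p(1) q(1)] p q R(3)[of k] by simp
    have ne: "p \<noteq> q" using p q R(3)[of k] by auto
    obtain z z' where z: "z \<in> T" "z' \<in> T" "z \<noteq> z'" "dd p z = dd p z'" "dd p q = dd p z + dd z q" "dd p q = dd p z' + dd z' q"
      using two_points_between[OF CT[OF p(1)] CT[OF q(1)] ne] .
    have pos: "dd x m = R (Suc k) + dd p m" "dd x m = R k - dd m q" if m: "m \<in> T" "dd p q = dd p m + dd m q" for m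
      using dd_triangle[OF xy(1) CT[OF p(1)] m(1)] dd_triangle[OF xy(1) m(1) CT[OF q(1)]] m(2) p q pq by auto
    have "z \<notin> C \<or> z' \<notin> C" using inj z pos[OF z(1,5)] pos[OF z(2,6)] by auto
    then obtain m where m: "m \<in> T" "m \<notin> C" "dd p q = dd p m + dd m q" using z by blast
    note pm = pos[OF m(1,3)]
    have "m \<noteq> p" "m \<noteq> q" using m(2) p q by auto
    then have "dd p m > 0" "dd m q > 0" using dd_pos CT p(1) q(1) m(1) by metis+
    then have strict: "R (Suc k) < dd x m" "dd x m < R k" using pm by auto
    have "dd m u = \<bar>dd x m - dd x u\<bar>" if u: "u \<in> C" "dd x u \<le> R (Suc k) \<or> R k \<le> dd x u" for u
    proof -
      have t: "dd m u \<le> dd m p + dd p u" "dd m u \<le> dd m q + dd q u" "dd x m \<le> dd x u + dd u m" "dd x u \<le> dd x m + dd m u"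
        using dd_triangle CT p(1) q(1) u(1) m(1) xy(1) by blast+
      have "dd p u = \<bar>R (Suc k) - dd x u\<bar>" "dd q u = \<bar>R k - dd x u\<bar>" using al[OF p(1) u(1)] al[OF q(1) u(1)] p q by auto
      then show ?thesis using t u(2) pm strict dd_commute[of m p] dd_commute[of u m] by linarith
    qed
    then show ?thesis using m strict by blast
  qed
  then obtain z where z: "\<And>k. z k \<in> T" "\<And>k. z k \<notin> C" "\<And>k. R (Suc k) < dd x (z k)" "\<And>k. dd x (z k) < R k"
    "\<And>k u. u \<in> C \<Longrightarrow> dd x u \<le> R (Suc k) \<or> R k \<le> dd x u \<Longrightarrow> dd (z k) u = \<bar>dd x (z k) - dd x u\<bar>" by metis
  define C' where "C' k = insert (z k) {u \<in> C. dd x u \<le> R (Suc k) \<or> R k \<le> dd x u}" for k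
  have "x \<in> C" "y \<in> C" using g unfolding C_def geodesic_path_def by (auto intro: image_eqI[of _ _ 0] image_eqI[of _ _ 1])
  have "\<exists>I. I \<in> geodesic_images T dd x y \<and> C' k \<subseteq> I \<and> aligned x I \<and> I \<subseteq> T" for k
  proof -
    have "aligned x {u \<in> C. dd x u \<le> R (Suc k) \<or> R k \<le> dd x u}" using al by (simp add: aligned_def)
    then have 1: "aligned x (C' k)" unfolding C'_def by (rule aligned_insert) (use z(5) in auto)
    have 2: "C' k \<subseteq> T" using CT z(1) by (auto simp: C'_def)
    have 3: "dd x u \<le> dd x y" if "u \<in> C' k" for u
    proof (cases "u = z k")
      case True
      then show ?thesis using z(4)[of k] R(2)[of k] by (simp add: L_def)
    next
      case False
      then show ?thesis using that CL by (auto simp: C'_def L_def)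
    qed
    have 4: "x \<in> C' k" "y \<in> C' k"
      using \<open>x \<in> C\<close> \<open>y \<in> C\<close> dd_self[of x] R(1)[of "Suc k"] R(2)[of k] by (auto simp: C'_def L_def)
    obtain f where f: "geodesic_path T dd f x y" "C' k \<subseteq> f ` {0..1}" "aligned x (f ` {0..1})" "f ` {0..1} \<subseteq> T"
      by (rule geodesic_through[OF 4 1 2]) (use 3 in auto)
    have "f ` {0..1} \<in> geodesic_images T dd x y" using f(1) unfolding geodesic_images_def by blast
    then show ?thesis using f by blast
  qed
  then obtain I where I: "\<And>k. I k \<in> geodesic_images T dd x y" "\<And>k. C' k \<subseteq> I k" "\<And>k. aligned x (I k)" "\<And>k. I k \<subseteq> T" by metis
  have "I j \<noteq> I k" if jk: "j \<noteq> k" for j k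
  proof
    assume eq: "I j = I k"
    obtain c where c: "c \<in> C" "dd x c = dd x (z k)" using full[of "dd x (z k)"] z(4)[of k] R(2)[of k] dd_nonneg[of x "z k"] by force
    have "dd x c \<le> R (Suc j) \<or> R j \<le> dd x c"
    proof (cases "j < k")
      case True
      then show ?thesis using Rmono[of "Suc j" k] z(4)[of k] c(2) by simp
    next
      case False
      then show ?thesis using Rmono[of "Suc k" j] z(3)[of k] c(2) jk by simp
    qed
    then have "c \<in> I k" using c(1) I(2)[of j] eq by (auto simp: C'_def)
    moreover have "z k \<in> I k" using I(2)[of k] by (auto simp: C'_def)
    ultimately have "dd c (z k) = \<bar>dd x c - dd x (z k)\<bar>" using I(3)[of k] unfolding aligned_def by blast
    then have "dd c (z k) = 0" using c(2) by simp
    moreover have "c \<noteq> z k" using c(1) z(2)[of k] by auto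
    ultimately show False using dd_pos[OF CT[OF c(1)] z(1)[of k]] by simp
  qed
  then have "inj I" by (meson injI)
  moreover have "range I \<subseteq> geodesic_images T dd x y" using I(1) by blast
  ultimately show ?thesis using range_inj_infinite infinite_super by blast
qed

end

section \<open>Hausdorff dimension\<close>

text \<open>
  The cylinders given by the words \<open>c i\<close> have total mass below one for the uniform measure on
  the sequences over \<open>I\<close>. A sequence outside all of them is built letter by letter, such that
  the cylinders inside the current one never exhaust its mass.
\<close>
lemma avoid_cylinders:
  fixes I :: "'a set" and c :: "nat \<Rightarrow> 'a list" and N :: real
  assumes I: "finite I" and N: "N = real (card I)" "N > 0"
    and c: "\<And>i. set (c i) \<subseteq> I"
    and sum: "(\<Sum>i. ennreal ((1 / N) ^ length (c i))) < 1"
  shows "\<exists>X. (\<forall>k. X k \<in> I) \<and> (\<forall>i. c i \<noteq> map X [0..<length (c i)])"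
proof -
  \<comment> \<open>the total mass of the cylinders inside the cylinder of \<open>W\<close>\<close>
  define S where "S W = (\<Sum>i. if take (length W) (c i) = W then ennreal ((1 / N) ^ length (c i)) else 0)" for W
  let ?P = "\<lambda>n W. length W = n \<and> set W \<subseteq> I \<and> S W < ennreal ((1 / N) ^ n)"
  have no: "c i \<noteq> W" if "?P n W" for n W i
  proof
    assume eq: "c i = W"
    have "(if take (length W) (c i) = W then ennreal ((1 / N) ^ length (c i)) else 0) \<le> S W"
      unfolding S_def by (rule sum_le_suminf[of _ "{i}", simplified]) auto
    then have "ennreal ((1 / N) ^ n) \<le> S W" using that eq by simp
    with that show False by (simp add: not_le[symmetric])
  qed
  have step: "\<exists>W'. ?P (Suc n) W' \<and> (\<exists>a. W' = W @ [a])" if W: "?P n W" for W n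
  proof (rule ccontr)
    assume neg: "\<nexists>W'. ?P (Suc n) W' \<and> (\<exists>a. W' = W @ [a])"
    have big: "ennreal ((1 / N) ^ Suc n) \<le> S (W @ [a])" if "a \<in> I" for a
    proof -
      have "\<not> ?P (Suc n) (W @ [a])" using neg by blast
      then show ?thesis using W that by (simp add: not_less del: power_Suc)
    qed
    have "ennreal ((1 / N) ^ n) = (\<Sum>a\<in>I. ennreal ((1 / N) ^ Suc n))"
      using N by (simp add: sum_ennreal[symmetric] ennreal_of_nat_eq_real_of_nat ennreal_mult'[symmetric])
    also have "\<dots> \<le> (\<Sum>a\<in>I. S (W @ [a]))" by (rule sum_mono) (rule big)
    also have "\<dots> = (\<Sum>i. \<Sum>a\<in>I. if take (length (W @ [a])) (c i) = W @ [a] then ennreal ((1 / N) ^ length (c i)) else 0)"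
      unfolding S_def by (rule suminf_sum[symmetric]) simp
    also have "\<dots> \<le> S W"
      unfolding S_def
    proof (rule suminf_le)
      fix i
      show "(\<Sum>a\<in>I. if take (length (W @ [a])) (c i) = W @ [a] then ennreal ((1 / N) ^ length (c i)) else 0)
        \<le> (if take (length W) (c i) = W then ennreal ((1 / N) ^ length (c i)) else 0)"
      proof (cases "\<exists>a\<in>I. take (length (W @ [a])) (c i) = W @ [a]")
        case True
        then obtain a where a: "a \<in> I" "take (length (W @ [a])) (c i) = W @ [a]" by blast
        then have "take (length W) (c i) = W"
          by (metis append_eq_conv_conj length_append_singleton lessI less_imp_le_nat min.absorb1 take_take)
        moreover have "(take (length (W @ [b])) (c i) = W @ [b]) = (b = a)" for b
          using a(2) by (metis append1_eq_conv length_append_singleton)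
        ultimately show ?thesis using a(1) I by simp
      next
        case False
        then have "(\<Sum>a\<in>I. if take (length (W @ [a])) (c i) = W @ [a] then ennreal ((1 / N) ^ length (c i)) else 0) = 0"
          by (intro sum.neutral) auto
        then show ?thesis by simp
      qed
    qed auto
    finally show False using W by (meson not_le)
  qed
  have "?P 0 []" using sum by (simp add: S_def)
  then have base: "\<exists>W. ?P 0 W" by blast
  obtain f where f: "\<And>n. ?P n (f n)" "\<And>n. \<exists>a. f (Suc n) = f n @ [a]"
    using dependent_nat_choice[of ?P "\<lambda>n W W'. \<exists>a. W' = W @ [a]", OF base step] by blast
  define X where "X k = last (f (Suc k))" for k
  have fX: "f (Suc k) = f k @ [X k]" for k using f(2)[of k] by (auto simp: X_def)
  have fm: "f n = map X [0..<n]" for n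
  proof (induction n)
    case 0
    then show ?case using f(1)[of 0] by simp
  qed (simp add: fX)
  have "X k \<in> I" for k using f(1)[of "Suc k"] by (simp add: fX)
  moreover have "c i \<noteq> map X [0..<length (c i)]" for i
    using no[OF f(1)[of "length (c i)"], of i] fm by simp
  ultimately show ?thesis by blast
qed

context plane_triangle
begin

interpretation D: bary_metric v0 v1 v2 dd
  by (rule bary_metric_dd)

lemma powr_half_power: "((1/2::real) ^ n) powr s = ((1/2) powr s) ^ n"
  by (simp add: powr_power powr_realpow[symmetric] powr_powr mult.commute)

lemma set_diam_le:
  assumes "\<And>x y. x \<in> U \<Longrightarrow> y \<in> U \<Longrightarrow> dd x y \<le> r" "0 \<le> r"
  shows "set_diam dd U \<le> r"
  using assms unfolding set_diam_def by (auto intro!: cSUP_least)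

lemma set_diam_upper:
  assumes "U \<subseteq> T" "x \<in> U" "y \<in> U"
  shows "dd x y \<le> set_diam dd U"
proof -
  have "bdd_above ((\<lambda>(x, y). dd x y) ` (U \<times> U))"
    using dd_le_4 assms(1) by (intro bdd_aboveI2[of _ _ 4]) auto
  then have "(\<lambda>(x, y). dd x y) (x, y) \<le> (SUP (x, y)\<in>U \<times> U. dd x y)"
    using assms by (intro cSUP_upper) auto
  then show ?thesis using assms by (auto simp: set_diam_def)
qed

lemma set_diam_nonneg: "0 \<le> set_diam dd U" if "U \<subseteq> T"
proof (cases "U = {}")
  case False
  then obtain x where "x \<in> U" by blast
  then show ?thesis using set_diam_upper[OF that, of x x] dd_self[of x] by simp
qed (simp add: set_diam_def)

lemma hausdorff_measure_zero:
  assumes s: "ln 6 / ln 2 < s"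
  shows "hausdorff_measure s T dd = 0"
proof -
  have s0: "0 < s" using s by (rule le_less_trans[rotated]) simp
  have "ln 6 < s * ln 2" using s by (simp add: pos_divide_less_eq)
  then have "6 < 2 powr s" by (simp add: ln_less_cancel_iff[symmetric] ln_powr del: ln_less_cancel_iff)
  then have q: "6 * (1/2) powr s < 1" "0 \<le> 6 * (1/2::real) powr s"
    by (auto simp: powr_divide divide_less_eq)
  have "(INF U\<in>delta_covers T dd \<delta>. \<Sum>i. ennreal (set_diam dd (U i) powr s)) \<le> 0" if \<delta>: "\<delta> > 0" for \<delta>
  proof (rule ennreal_le_epsilon)
    fix e :: real assume e: "0 < e"
    obtain n1 where n1: "4 * (1/2) ^ n1 < \<delta>" by (rule ex_power_less[of "1/2" \<delta> 4]) (use \<delta> in auto)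
    obtain n2 where n2: "4 powr s * (6 * (1/2) powr s) ^ n2 < e" by (rule ex_power_less[OF q(2,1) e])
    define n where "n = max n1 n2"
    have "4 * (1/2::real) ^ n \<le> 4 * (1/2) ^ n1" by (intro mult_left_mono power_decreasing) (auto simp: n_def)
    then have small: "4 * (1/2::real) ^ n \<le> \<delta>" using n1 by linarith
    have "4 powr s * (6 * (1/2) powr s) ^ n \<le> 4 powr s * (6 * (1/2) powr s) ^ n2"
      using q by (intro mult_left_mono power_decreasing) (auto simp: n_def)
    then have sum: "4 powr s * (6 * (1/2) powr s) ^ n \<le> e" using n2 by linarith
    obtain b where b: "bij_betw b {0..<card (words n)} (words n)"
      using ex_bij_betw_nat_finite[OF finite_words] by blast
    define U where "U i = (if i < 6 ^ n then Aw (b i) ` T else {})" for i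
    have bw: "b i \<in> words n" if "i < 6 ^ n" for i
      using bij_betwE[OF b] that by (auto simp: card_words)
    have diam: "dd x y \<le> 4 * (1/2) ^ n" if "x \<in> U i" "y \<in> U i" for x y i
      using that bw[of i] dd_cell_le[of "b i" n] by (auto simp: U_def split: if_splits)
    have "T = (\<Union>i. U i)"
    proof (intro equalityI subsetI)
      fix x assume "x \<in> T"
      then obtain w p where w: "w \<in> words n" "p \<in> T" "x = Aw w p" by (rule T_cover_words)
      have "w \<in> b ` {0..<6 ^ n}" using b w(1) by (simp add: bij_betw_def card_words)
      then obtain i where "i < 6 ^ n" "b i = w" by auto
      then show "x \<in> (\<Union>i. U i)" using w by (auto simp: U_def)
    qed (use bw Aw_in_T in \<open>auto simp: U_def split: if_splits\<close>)
    then have U: "U \<in> delta_covers T dd \<delta>"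
      unfolding delta_covers_def using diam small by fastforce
    have term_le: "set_diam dd (U i) powr s \<le> 4 powr s * ((1/2) powr s) ^ n" for i
    proof -
      have "U i \<subseteq> T" using \<open>T = (\<Union>i. U i)\<close> by blast
      then have "set_diam dd (U i) powr s \<le> (4 * (1/2) ^ n) powr s"
        using set_diam_le[of "U i" "4 * (1/2) ^ n"] diam set_diam_nonneg s0 by (intro powr_mono2) auto
      then show ?thesis by (simp add: powr_mult powr_half_power)
    qed
    have "(\<Sum>i. ennreal (set_diam dd (U i) powr s)) = (\<Sum>i<6 ^ n. ennreal (set_diam dd (U i) powr s))"
      by (rule suminf_finite) (auto simp: U_def set_diam_def)
    also have "\<dots> = ennreal (\<Sum>i<6 ^ n. set_diam dd (U i) powr s)" by (rule sum_ennreal) simp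
    also have "\<dots> \<le> ennreal (\<Sum>i<(6 ^ n :: nat). 4 powr s * ((1/2) powr s) ^ n)"
      by (intro ennreal_leI sum_mono term_le)
    also have "(\<Sum>i<(6 ^ n :: nat). 4 powr s * ((1/2) powr s) ^ n) = 4 powr s * (6 * (1/2) powr s) ^ n"
      by (simp add: power_mult_distrib)
    also have "ennreal \<dots> \<le> ennreal e" using sum by (rule ennreal_leI)
    finally have "(INF U\<in>delta_covers T dd \<delta>. \<Sum>i. ennreal (set_diam dd (U i) powr s)) \<le> ennreal e"
      using U by (meson INF_lower2)
    then show "(INF U\<in>delta_covers T dd \<delta>. \<Sum>i. ennreal (set_diam dd (U i) powr s)) \<le> 0 + ennreal e" by simp
  qed
  then have "hausdorff_measure s T dd \<le> 0"
    unfolding hausdorff_measure_def by (intro SUP_least) auto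
  then show ?thesis by simp
qed

definition inside :: "(real^2) set" where
  "inside = {x. \<forall>a<3. bc a x > 0}"

lemma inside_iff: "x \<in> T \<Longrightarrow> x \<notin> bdry \<longleftrightarrow> x \<in> inside"
  unfolding bdry_def inside_def T_def by (auto simp: less_le)

lemma inside_T: "x \<in> inside \<Longrightarrow> x \<in> T"
  unfolding inside_def T_def by (auto intro: less_imp_le)

lemma inside_midpoint: "x \<in> inside \<Longrightarrow> y \<in> T \<Longrightarrow> midpoint x y \<in> inside"
  unfolding inside_def T_def by (auto simp: bc_midpoint intro!: add_pos_nonneg)

lemma inside_Aw:
  assumes "w \<in> words n" "x \<in> inside"
  shows "Aw w x \<in> inside"
  using assms
proof (induction n arbitrary: w)
  case (Suc n)
  obtain l u where w: "w = l # u" "u \<in> words n" "l \<in> Perms" using words_Suc_ConsE Suc.prems(1) by blast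
  obtain i j k where l: "l = (i, j, k)" by (cases l)
  note P = w(3)[unfolded l]
  have "Aw u x \<in> inside" by (rule Suc.IH[OF w(2) Suc.prems(2)])
  then have p: "bc 0 (Aw u x) > 0" "bc 1 (Aw u x) > 0" "bc 2 (Aw u x) > 0" by (auto simp: inside_def)
  have "bc i (Aw w x) > 0" "bc j (Aw w x) > 0" "bc k (Aw w x) > 0"
    using p unfolding w(1) l Aw.simps bc_A[OF P] by linarith+
  then show ?case unfolding inside_def mem_Collect_eq by (subst Perms_all3[OF P]) simp
qed simp

lemma G_inside: "G \<in> inside"
  by (auto simp: inside_def less_3_cases)

text \<open>The cells that avoid the boundary of \<open>T\<close>, in terms of their vertices.\<close>
definition inner :: "nat \<Rightarrow> (nat \<times> nat \<times> nat) list set" where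
  "inner n = {w \<in> words n. \<forall>a<3. Aw w (vtx a) \<in> inside}"

definition outer :: "nat \<Rightarrow> (nat \<times> nat \<times> nat) list set" where
  "outer n = words n - inner n"

lemma inner_cell:
  assumes w: "w \<in> inner n" and q: "q \<in> T"
  shows "Aw w q \<in> inside"
  unfolding inside_def
proof (intro CollectI allI impI)
  fix c :: nat assume c: "c < 3"
  have v: "bc c (Aw w v0) > 0" "bc c (Aw w v1) > 0" "bc c (Aw w v2) > 0"
    using w c unfolding inner_def inside_def by (auto simp: less_3_cases)
  have eq: "bc c (Aw w q) = bc 0 q * bc c (Aw w v0) + bc 1 q * bc c (Aw w v1) + bc 2 q * bc c (Aw w v2)"
    by (subst Aw_expand, rule bc_affine[OF bc_sum])
  have q': "0 \<le> bc 0 q" "0 \<le> bc 1 q" "0 \<le> bc 2 q" using q by (auto simp: T_iff)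
  have "0 < bc 0 q \<or> 0 < bc 1 q \<or> 0 < bc 2 q" using bc_sum[of q] by linarith
  moreover have "0 \<le> bc 0 q * bc c (Aw w v0)" "0 \<le> bc 1 q * bc c (Aw w v1)" "0 \<le> bc 2 q * bc c (Aw w v2)"
    using v q' by auto
  moreover have "0 < bc 0 q \<Longrightarrow> 0 < bc 0 q * bc c (Aw w v0)" "0 < bc 1 q \<Longrightarrow> 0 < bc 1 q * bc c (Aw w v1)"
    "0 < bc 2 q \<Longrightarrow> 0 < bc 2 q * bc c (Aw w v2)" using v by auto
  ultimately show "bc c (Aw w q) > 0" unfolding eq by linarith
qed

text \<open>
  Below level \<open>0\<close> the last vertex of a cell is a barycenter, which lies off the boundary of \<open>T\<close>,
  and so do the two children at that vertex. Hence at most four children of an outer cell are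
  outer cells.
\<close>
lemma card_outer_step: "card (outer (Suc (Suc n))) \<le> 4 * card (outer (Suc n))"
proof -
  let ?L = "Perms - {(2, 0, 1), (2, 1, 0)}"
  have "outer (Suc (Suc n)) \<subseteq> (\<lambda>(u, l). u @ [l]) ` (outer (Suc n) \<times> ?L)"
  proof
    fix w assume w: "w \<in> outer (Suc (Suc n))"
    then have "w \<in> words (Suc (Suc n))" by (simp add: outer_def)
    then obtain u l where u: "w = u @ [l]" "u \<in> words (Suc n)" "l \<in> Perms" by (rule words_Suc_snocE)
    obtain a where a: "a < 3" "Aw w (vtx a) \<notin> inside" using w by (auto simp: outer_def inner_def)
    have "u \<notin> inner (Suc n)"
      using inner_cell[of u "Suc n" "A l (vtx a)"] A_in_T[OF u(3)] a by (auto simp: u(1) Aw_snoc)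
    moreover have "l \<noteq> (2, y, z)" for y z
    proof
      assume l: "l = (2, y, z)"
      obtain u' l' where u': "u = u' @ [l']" "u' \<in> words n" "l' \<in> Perms" using words_Suc_snocE[OF u(2)] .
      have "Aw u v2 = Aw u' G" by (cases l') (simp add: u' Aw_snoc A_vtx)
      then have "Aw u v2 \<in> inside" using inside_Aw[OF u'(2) G_inside] by simp
      then have "Aw u (midpoint v2 (vtx y)) \<in> inside" "Aw u v2 \<in> inside" "Aw u G \<in> inside"
        using inside_midpoint Aw_in_T[OF u(2)] inside_Aw[OF u(2) G_inside] by (auto simp: Aw_midpoint)
      then show False using a by (auto simp: u(1) l Aw_snoc A_vtx less_3_cases)
    qed
    ultimately show "w \<in> (\<lambda>(u, l). u @ [l]) ` (outer (Suc n) \<times> ?L)"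
      using u by (auto simp: outer_def intro!: rev_image_eqI[of "(u, l)"])
  qed
  then have "card (outer (Suc (Suc n))) \<le> card (outer (Suc n) \<times> ?L)"
    by (rule surj_card_le[rotated]) (simp add: outer_def)
  also have "card ?L = 4" by (simp add: Perms_def)
  then have "card (outer (Suc n) \<times> ?L) = 4 * card (outer (Suc n))" by (simp add: card_cartesian_product)
  finally show ?thesis .
qed

lemma card_inner: "6 ^ Suc n \<le> card (inner (Suc n)) + 6 * 4 ^ n"
proof -
  have "card (outer (Suc n)) \<le> 6 * 4 ^ n"
  proof (induction n)
    case 0
    have "card (outer (Suc 0)) \<le> card (words (Suc 0))" by (intro card_mono) (auto simp: outer_def)
    then show ?case by (simp add: card_words)
  next
    case (Suc n)
    then show ?case using card_outer_step[of n] by simp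
  qed
  moreover have "card (words (Suc n)) = card (inner (Suc n)) + card (outer (Suc n))"
    unfolding outer_def by (subst card_Diff_subset) (auto simp: inner_def intro!: le_add_diff_inverse[symmetric] card_mono)
  ultimately show ?thesis by (simp add: card_words)
qed

lemma inner_subset: "inner n \<subseteq> words n"
  by (auto simp: inner_def)

text \<open>
  All but a fraction of order \<open>(4/6)\<^sup>n\<close> of the \<open>6\<^sup>n\<close> cells of level \<open>n\<close> are inner cells.
\<close>
lemma many_inner:
  assumes "0 < s" "s < ln 6 / ln 2"
  obtains p where "p > 0" "((2::real) ^ p) powr s \<le> real (card (inner p))"
proof -
  define q :: real where "q = 2 powr s"
  have "s * ln 2 < ln 6" using assms(2) by (simp add: pos_less_divide_eq)
  then have q6: "q < 6" unfolding q_def by (simp add: ln_less_cancel_iff[symmetric] ln_powr del: ln_less_cancel_iff)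
  have q0: "0 < q" by (simp add: q_def)
  obtain n1 where n1: "q * (q / 6) ^ n1 < 3" by (rule ex_power_less[of "q/6" 3 q]) (use q0 q6 in auto)
  obtain n2 where n2: "6 * (4 / 6 :: real) ^ n2 < 3" by (rule ex_power_less[of "4/6" 3 6]) auto
  define n where "n = max n1 n2"
  have "q * (q / 6) ^ n \<le> q * (q / 6) ^ n1" using q0 q6 by (intro mult_left_mono power_decreasing) (auto simp: n_def)
  then have "q * (q / 6) ^ n < 3" using n1 by linarith
  then have a: "q ^ Suc n < 3 * 6 ^ n" by (simp add: power_divide divide_less_eq)
  have "6 * (4 / 6 :: real) ^ n \<le> 6 * (4 / 6) ^ n2" by (intro mult_left_mono power_decreasing) (auto simp: n_def)
  then have "6 * (4 / 6 :: real) ^ n < 3" using n2 by linarith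
  then have b: "6 * (4::real) ^ n < 3 * 6 ^ n" by (simp only: power_divide; simp add: divide_less_eq)
  have "real (6 ^ Suc n) \<le> real (card (inner (Suc n)) + 6 * 4 ^ n)" using card_inner[of n] by (rule of_nat_mono)
  then have "q ^ Suc n \<le> real (card (inner (Suc n)))" using a b by simp
  moreover have "((2::real) ^ Suc n) powr s = q ^ Suc n"
    unfolding q_def by (simp only: powr_power powr_realpow[symmetric, of 2 "Suc n"] powr_powr; simp add: mult.commute)
  ultimately show ?thesis using that[of "Suc n"] by simp
qed

text \<open>
  The barycenter lies off all faces, which identifies the parent by induction; the last letter
  can be read off from the other two vertices.
\<close>
lemma cell_word_unique:
  assumes "w \<in> words n" "w' \<in> words n" "\<And>a. a < 3 \<Longrightarrow> Aw w (vtx a) = Aw w' (vtx a)"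
  shows "w = w'"
  using assms
proof (induction n arbitrary: w w')
  case 0
  then show ?case by simp
next
  case (Suc n)
  obtain u l where w: "w = u @ [l]" "u \<in> words n" "l \<in> Perms" using words_Suc_snocE[OF Suc.prems(1)] .
  obtain u' l' where w': "w' = u' @ [l']" "u' \<in> words n" "l' \<in> Perms" using words_Suc_snocE[OF Suc.prems(2)] .
  obtain x y z x' y' z' where l: "l = (x, y, z)" "l' = (x', y', z')" by (cases l, cases l')
  have e: "Aw u (vtx x) = Aw u' (vtx x')" "Aw u (midpoint (vtx x) (vtx y)) = Aw u' (midpoint (vtx x') (vtx y'))" "Aw u G = Aw u' G"
    using Suc.prems(3)[of 0] Suc.prems(3)[of 1] Suc.prems(3)[of 2] by (simp_all add: w w' l Aw_snoc A_vtx)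
  have "\<forall>a<3. bc a G > 0" by (auto simp: less_3_cases)
  then have "u = u'"
    using Aw_unique[OF w(2) w'(2) G_in_T G_in_T e(3)] by (intro Suc.IH[OF w(2) w'(2)]) blast
  then have "vtx x = vtx x'" using Aw_inj[OF w(2) vtx_in_T(1) vtx_in_T(1)] e(1) by simp
  moreover have lt: "x < 3" "x' < 3" using w(3) w'(3) l by (auto simp: Perms_iff)
  ultimately have "x = x'" using bc_vtx'[OF lt(1,1)] bc_vtx'[OF lt] by (auto split: if_splits)
  moreover have "z = z'" using midpoint_shared(1)[OF w(2) w'(2) w(3)[unfolded l] w'(3)[unfolded l] e(2)] .
  ultimately have "l = l'" using w(3) w'(3) l by (auto simp: Perms_def)
  then show ?case using \<open>u = u'\<close> w w' by simp
qed

lemma bdry_closed: "closed bdry"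
proof -
  have "bdry = T \<inter> ((T \<inter> bc 0 -` {0}) \<union> (T \<inter> bc 1 -` {0}) \<union> (T \<inter> bc 2 -` {0}))"
    by (auto simp: bdry_def less_3_cases)
  moreover have "closed (T \<inter> bc a -` {0})" for a
    by (rule continuous_closed_preimage[OF continuous_on_bc compact_imp_closed[OF compact_T]]) simp
  ultimately show ?thesis using compact_imp_closed[OF compact_T] by (metis closed_Int closed_Un)
qed

lemma bdry_gap:
  assumes "compact S" "S \<subseteq> inside"
  obtains \<delta> where "\<delta> > 0" "\<And>x y. x \<in> S \<Longrightarrow> y \<in> bdry \<Longrightarrow> \<delta> \<le> dd x y"
proof (cases "S = {}")
  case True
  then show ?thesis using that[of 1] by simp
next
  case False
  have cb: "compact bdry" using compact_Int_closed[OF compact_T bdry_closed] bdry_subset_T by (simp add: Int_absorb1)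
  have ST: "S \<subseteq> T" using assms(2) inside_T by blast
  have "continuous_on (S \<times> bdry) (\<lambda>z. dd (fst z) (snd z))"
  proof (subst continuous_on_iff, intro ballI allI impI)
    fix z e assume z: "z \<in> S \<times> bdry" and e: "0 < (e::real)"
    obtain x y where xy: "z = (x, y)" "x \<in> T" "y \<in> T" using z ST bdry_subset_T by auto
    have e2: "e / 2 > 0" using e by simp
    obtain \<delta>1 where d1: "\<delta>1 > 0" "\<And>u. u \<in> T \<Longrightarrow> dist x u < \<delta>1 \<Longrightarrow> dd x u < e/2" using dd_near[OF xy(2) e2] by metis
    obtain \<delta>2 where d2: "\<delta>2 > 0" "\<And>u. u \<in> T \<Longrightarrow> dist y u < \<delta>2 \<Longrightarrow> dd y u < e/2" using dd_near[OF xy(3) e2] by metis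
    have "dist (dd (fst z') (snd z')) (dd (fst z) (snd z)) < e" if z': "z' \<in> S \<times> bdry" "dist z' z < min \<delta>1 \<delta>2" for z'
    proof -
      obtain u v where uv: "z' = (u, v)" "u \<in> T" "v \<in> T" using z' ST bdry_subset_T by auto
      have "dist u x \<le> dist z' z" "dist v y \<le> dist z' z" using dist_fst_le[of z' z] dist_snd_le[of z' z] uv xy by auto
      then have "dist x u < \<delta>1" "dist y v < \<delta>2" using z'(2) by (auto simp: dist_commute)
      then have n: "dd x u < e/2" "dd y v < e/2" using d1(2)[OF uv(2)] d2(2)[OF uv(3)] by auto
      have "dd u v \<le> dd u x + dd x y + dd y v" "dd x y \<le> dd x u + dd u v + dd v y"
        using dd_triangle[OF uv(2) xy(2) uv(3)] dd_triangle[OF xy(2,3) uv(3)] dd_triangle[OF xy(2) uv(2) xy(3)]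
          dd_triangle[OF uv(2,3) xy(3)] by linarith+
      then show ?thesis using n dd_commute[of u x] dd_commute[of v y] uv(1) xy(1) by (simp add: dist_real_def)
    qed
    then show "\<exists>\<delta>>0. \<forall>z'\<in>S \<times> bdry. dist z' z < \<delta> \<longrightarrow> dist (dd (fst z') (snd z')) (dd (fst z) (snd z)) < e"
      using d1(1) d2(1) by (intro exI[of _ "min \<delta>1 \<delta>2"]) auto
  qed
  moreover have "compact (S \<times> bdry)" using assms(1) cb by (rule compact_Times)
  moreover have "S \<times> bdry \<noteq> {}" using False vtx_in_bdry by blast
  ultimately obtain z where z: "z \<in> S \<times> bdry" "\<And>z'. z' \<in> S \<times> bdry \<Longrightarrow> dd (fst z) (snd z) \<le> dd (fst z') (snd z')"
    using continuous_attains_inf[of "S \<times> bdry" "\<lambda>z. dd (fst z) (snd z)"] by blast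
  have "fst z \<in> inside" "snd z \<in> bdry" using z(1) assms(2) by auto
  moreover then have "fst z \<in> T" "snd z \<in> T" using inside_T bdry_subset_T by auto
  ultimately have "fst z \<noteq> snd z" "fst z \<in> T" "snd z \<in> T" using inside_iff[of "snd z"] by auto
  then have "dd (fst z) (snd z) > 0" by (intro dd_pos)
  then show ?thesis using that[of "dd (fst z) (snd z)"] z(2) by fastforce
qed

text \<open>
  The point \<open>x\<close> lies in the nested cells that arise by iterating the inner cells \<open>X 0\<close>, \<open>X 1\<close>,
  ... of level \<open>p\<close>.
\<close>
definition address :: "nat \<Rightarrow> (nat \<Rightarrow> (nat \<times> nat \<times> nat) list) \<Rightarrow> real^2 \<Rightarrow> bool" where
  "address p X x \<longleftrightarrow> (\<forall>k. X k \<in> inner p) \<and> (\<forall>k. x \<in> Aw (concat (map X [0..<k])) ` T)"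

lemma concat_words:
  assumes "\<And>k. X k \<in> inner p"
  shows "concat (map X [0..<k]) \<in> words (k * p)"
proof (induction k)
  case (Suc k)
  then show ?case using words_append[OF Suc, of "X k" p] assms[of k] by (simp add: inner_def add.commute)
qed simp

lemma address_exists:
  assumes X: "\<And>k. X k \<in> inner p"
  obtains x where "address p X x" "x \<in> T"
proof -
  let ?F = "\<lambda>k. Aw (concat (map X [0..<k])) ` T"
  have "\<Inter>(range ?F) \<noteq> {}"
  proof (rule compact_nest)
    show "compact (?F k)" for k by (rule compact_cell)
    show "?F k \<noteq> {}" for k using vtx_in_T by blast
    have step: "?F (Suc k) \<subseteq> ?F k" for k
      using Aw_in_T[of "X k" p] X[of k] by (auto simp: Aw_append inner_def)
    show "?F k \<subseteq> ?F m" if "m \<le> k" for m k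
      using that by (rule lift_Suc_antimono_le[of ?F, OF step])
  qed
  then obtain x where x: "\<And>k. x \<in> ?F k" by blast
  then have "x \<in> T" using x[of 0] by simp
  have "address p X x" using X x unfolding address_def by blast
  then show ?thesis using \<open>x \<in> T\<close> by (rule that)
qed

text \<open>
  After \<open>Suc j\<close> letters the points lie in different cells. The next letter of \<open>X\<close> keeps \<open>x\<close> away
  from the boundary of its cell, and a geodesic to \<open>y\<close> has to meet that boundary.
\<close>
lemma address_separated:
  assumes \<delta>: "\<And>w x y. w \<in> inner p \<Longrightarrow> x \<in> Aw w ` T \<Longrightarrow> y \<in> bdry \<Longrightarrow> \<delta> \<le> dd x y"
    and x: "address p X x" and y: "address p Y y"
    and j: "\<And>i. i < j \<Longrightarrow> X i = Y i" "X j \<noteq> Y j"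
  shows "\<delta> * (1/2) ^ (p * Suc j) \<le> dd x y"
proof -
  have X: "\<And>k. X k \<in> inner p" and Y: "\<And>k. Y k \<in> inner p" using x y by (auto simp: address_def)
  let ?V = "concat (map X [0..<Suc j])" and ?V' = "concat (map Y [0..<Suc j])"
  have V: "?V \<in> words (Suc j * p)" and V': "?V' \<in> words (Suc j * p)" using concat_words X Y by blast+
  have "map X [0..<j] = map Y [0..<j]" using j(1) by simp
  then have "concat (map X [0..<j]) = concat (map Y [0..<j])" by (rule arg_cong)
  then have ne: "?V \<noteq> ?V'" using j(2) by simp
  have "x \<in> Aw (concat (map X [0..<Suc (Suc j)])) ` T" using x unfolding address_def by blast
  then obtain x2 where x2: "x2 \<in> T" "x = Aw (?V @ X (Suc j)) x2" by auto
  define x1 where "x1 = Aw (X (Suc j)) x2"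
  have x1: "x1 \<in> Aw (X (Suc j)) ` T" "x1 \<in> T" "x = Aw ?V x1"
    using x2 Aw_in_T[of "X (Suc j)" p x2] X[of "Suc j"] inner_subset by (auto simp: x1_def Aw_append)
  obtain y2 where y2: "y2 \<in> T" "y = Aw ?V' y2" using y unfolding address_def by blast
  have xT: "x \<in> T" "y \<in> T" using Aw_in_T[OF V x1(2)] Aw_in_T[OF V' y2(1)] x1 y2 by auto
  have "\<exists>z\<in>bdry. dd x (Aw ?V z) \<le> dd x y"
  proof (cases "y \<in> Aw ?V ` T")
    case True
    then obtain y1 where y1: "y1 \<in> T" "y = Aw ?V y1" by blast
    have "y1 \<notin> inside"
    proof
      assume ins: "y1 \<in> inside"
      have "Aw ?V y1 = Aw ?V' y2" using y1 y2 by simp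
      from Aw_unique[OF V V' y1(1) y2(1) this] have "?V = ?V'"
        using ins by (intro cell_word_unique[OF V V']) (auto simp: inside_def)
      then show False using ne by contradiction
    qed
    then have "y1 \<in> bdry" using inside_iff[OF y1(1)] by blast
    then show ?thesis using y1(2) by auto
  next
    case False
    obtain g where g: "D.geodesic_curve g x y" using D.geodesic_curve_exists[OF xT] .
    note gD = D.geodesic_curveD[OF g]
    obtain r where r: "0 \<le> r" "r \<le> 1" "g r \<in> Aw ?V ` bdry"
      by (rule path_meets_bdry[OF gD(1), of 0 1 ?V]) (use False x1 gD(3,4) in auto)
    have "dd x y = dd x (g r) + dd (g r) y" using gD(6)[of 0 r 1] r gD(3,4) by simp
    then have "dd x (g r) \<le> dd x y" using dd_nonneg[of "g r" y] by simp
    moreover obtain z where "z \<in> bdry" "g r = Aw ?V z" using r(3) by blast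
    ultimately show ?thesis by metis
  qed
  then obtain z where z: "z \<in> bdry" "dd x (Aw ?V z) \<le> dd x y" by blast
  have "\<delta> \<le> dd x1 z" by (rule \<delta>[OF X x1(1) z(1)])
  moreover have "dd x (Aw ?V z) = (1/2) ^ (Suc j * p) * dd x1 z"
    unfolding x1(3) by (rule dd_Aw[OF V x1(2)]) (use z(1) bdry_subset_T in auto)
  ultimately have "(1/2) ^ (Suc j * p) * \<delta> \<le> dd x y" using z(2)
    by (smt (verit) mult_left_mono zero_le_power zero_le_divide_1_iff zero_le_numeral)
  then show ?thesis by (simp add: mult.commute)
qed

text \<open>
  A set of diameter below \<open>\<delta> 2\<^sup>-\<^sup>p\<^sup>j\<close> meets only points whose addresses share the first \<open>j\<close>
  letters, so it is covered by one cylinder of mass \<open>N\<^sup>-\<^sup>j \<le> 2\<^sup>-\<^sup>p\<^sup>j\<^sup>s\<close>, where \<open>N\<close> is the number of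
  inner cells. If the measure vanished, the cylinders belonging to some cover would have total
  mass below one and would miss a sequence, whose point lies in no set of the cover.
\<close>
lemma hausdorff_measure_pos:
  assumes s: "0 < s" "s < ln 6 / ln 2"
  shows "hausdorff_measure s T dd \<noteq> 0"
proof
  assume zero: "hausdorff_measure s T dd = 0"
  obtain p where p: "p > 0" "((2::real) ^ p) powr s \<le> real (card (inner p))" using many_inner[OF s] .
  define N where "N = real (card (inner p))"
  have "1 < ((2::real) ^ p) powr s" using p(1) s(1) by (intro gr_one_powr) auto
  then have "1 < N" using p(2) by (simp add: N_def)
  then have N0: "0 < N" and N2: "2 \<le> N" by (simp_all add: N_def)
  have fin: "finite (inner p)" using finite_subset[OF inner_subset] by simp
  define S where "S = (\<Union>w\<in>inner p. Aw w ` T)"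
  have "compact S" unfolding S_def by (intro compact_UN fin) (rule compact_cell)
  moreover have "S \<subseteq> inside" unfolding S_def using inner_cell by blast
  ultimately obtain \<delta> where \<delta>: "\<delta> > 0" "\<And>x y. x \<in> S \<Longrightarrow> y \<in> bdry \<Longrightarrow> \<delta> \<le> dd x y" using bdry_gap by metis
  have sep: "\<delta> * (1/2) ^ (p * Suc j) \<le> dd x y"
    if "address p X x" "address p Y y" "\<And>i. i < j \<Longrightarrow> X i = Y i" "X j \<noteq> Y j" for X Y x y j
    by (rule address_separated[OF _ that]) (use \<delta>(2) in \<open>auto simp: S_def\<close>)
  define c0 where "c0 = (2 ^ p / \<delta>) powr s"
  have c0: "c0 > 0" using \<delta>(1) by (simp add: c0_def)
  have "(INF U\<in>delta_covers T dd 1. \<Sum>i. ennreal (set_diam dd (U i) powr s)) \<le> hausdorff_measure s T dd"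
    unfolding hausdorff_measure_def by (rule SUP_upper) simp
  also have "\<dots> < ennreal (1 / (4 * c0))" using zero c0 by simp
  finally obtain U where U: "U \<in> delta_covers T dd 1" "(\<Sum>i. ennreal (set_diam dd (U i) powr s)) < ennreal (1 / (4 * c0))"
    by (auto simp: INF_less_iff)
  have UT: "T = (\<Union>i. U i)" using U(1) by (simp add: delta_covers_def)
  then have Ui: "U i \<subseteq> T" for i by blast
  define diam where "diam i = set_diam dd (U i)" for i
  have diam0: "0 \<le> diam i" for i using set_diam_nonneg[OF Ui] by (simp add: diam_def)
  have dle: "dd x y \<le> diam i" if "x \<in> U i" "y \<in> U i" for x y i using set_diam_upper[OF Ui that] by (simp add: diam_def)
  \<comment> \<open>the last summand is there for sets of diameter \<open>0\<close>, whose points have equal addresses\<close>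
  have "\<exists>j. (j = 0 \<or> diam i < \<delta> * (1/2) ^ (p * j)) \<and> (1/N) ^ j \<le> c0 * diam i powr s + (1/2) ^ (i + 2)" for i
  proof (cases "diam i = 0")
    case True
    have "(1/N) ^ (i + 2) \<le> (1/2) ^ (i + 2)" using N2 by (intro power_mono) (auto simp: field_simps)
    then show ?thesis using True \<delta>(1) by (intro exI[of _ "i + 2"]) simp
  next
    case False
    then have pos: "diam i > 0" using diam0[of i] by simp
    obtain j0 where j0: "\<delta> * (1/2) ^ j0 < diam i" by (rule ex_power_less[of "1/2" "diam i" \<delta>]) (use pos in auto)
    have "j0 \<le> p * Suc j0" using p(1) by (simp add: trans_le_add2)
    then have "(1/2::real) ^ (p * Suc j0) \<le> (1/2) ^ j0" by (intro power_decreasing) auto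
    then have ex: "\<delta> * (1/2) ^ (p * Suc j0) \<le> diam i"
      using j0 \<delta>(1) by (smt (verit) mult_left_mono)
    define j where "j = (LEAST j. \<delta> * (1/2) ^ (p * Suc j) \<le> diam i)"
    have jle: "\<delta> * (1/2) ^ (p * Suc j) \<le> diam i" unfolding j_def by (rule LeastI[of _ j0]) (rule ex)
    have j1: "j = 0 \<or> diam i < \<delta> * (1/2) ^ (p * j)"
    proof (cases j)
      case (Suc k)
      then have "\<not> \<delta> * (1/2) ^ (p * Suc k) \<le> diam i" unfolding j_def by (intro not_less_Least) simp
      then show ?thesis using Suc by simp
    qed simp
    have "(1/N) \<le> (1 / 2 ^ p) powr s"
    proof -
      have "1 / N \<le> 1 / ((2::real) ^ p) powr s" using p(2) N2 by (intro frac_le) (auto simp: N_def)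
      then show ?thesis by (simp add: powr_divide)
    qed
    then have "(1/N) ^ j \<le> ((1 / 2 ^ p) powr s) ^ j" using N2 by (intro power_mono) auto
    also have "\<dots> = ((1 / 2 ^ p) ^ j) powr s"
      by (simp add: powr_power powr_realpow[symmetric] powr_powr mult.commute)
    also have "((1 / 2 ^ p) ^ j :: real) = 2 ^ p * (1/2) ^ (p * Suc j)"
      by (simp add: power_mult power_one_over power_add)
    also have "(2 ^ p * (1/2) ^ (p * Suc j)) powr s \<le> (2 ^ p / \<delta> * diam i) powr s"
    proof (rule powr_mono2)
      have "2 ^ p / \<delta> * (\<delta> * (1/2) ^ (p * Suc j)) \<le> 2 ^ p / \<delta> * diam i"
        using jle \<delta>(1) by (intro mult_left_mono) auto
      then show "2 ^ p * (1/2) ^ (p * Suc j) \<le> 2 ^ p / \<delta> * diam i" using \<delta>(1) by simp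
    qed (use s in auto)
    also have "\<dots> = c0 * diam i powr s" unfolding c0_def by (rule powr_mult)
    finally have "(1/N) ^ j \<le> c0 * diam i powr s + (1/2) ^ (i + 2)" by (smt (verit) zero_le_power zero_le_divide_1_iff zero_le_numeral)
    then show ?thesis using j1 by blast
  qed
  then obtain J where J: "\<And>i. J i = 0 \<or> diam i < \<delta> * (1/2) ^ (p * J i)" "\<And>i. (1/N) ^ J i \<le> c0 * diam i powr s + (1/2) ^ (i + 2)"
    by metis
  have agree: "map X [0..<J i] = map Y [0..<J i]" if X: "address p X x" "x \<in> U i" and Y: "address p Y y" "y \<in> U i" for X Y x y i
  proof (rule ccontr)
    assume "map X [0..<J i] \<noteq> map Y [0..<J i]"
    then have ex: "\<exists>j. j < J i \<and> X j \<noteq> Y j" by auto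
    define j where "j = (LEAST j. j < J i \<and> X j \<noteq> Y j)"
    have j: "j < J i" "X j \<noteq> Y j" using LeastI_ex[OF ex] by (auto simp: j_def)
    have "X k = Y k" if "k < j" for k using not_less_Least[of k "\<lambda>j. j < J i \<and> X j \<noteq> Y j"] that j(1) by (auto simp: j_def[symmetric])
    then have "\<delta> * (1/2) ^ (p * Suc j) \<le> dd x y" using sep[OF X(1) Y(1)] j(2) by blast
    also have "\<dots> \<le> diam i" by (rule dle[OF X(2) Y(2)])
    also have "\<dots> < \<delta> * (1/2) ^ (p * J i)" using J(1)[of i] j(1) by simp
    also have "\<dots> \<le> \<delta> * (1/2) ^ (p * Suc j)" using j(1) \<delta>(1) by (intro mult_left_mono power_decreasing mult_le_mono2) auto
    finally show False by simp
  qed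
  have "inner p \<noteq> {}" using \<open>1 < N\<close> by (auto simp: N_def)
  then obtain w0 where w0: "w0 \<in> inner p" by blast
  have "\<exists>c. length c = J i \<and> set c \<subseteq> inner p \<and> (\<forall>X x. address p X x \<longrightarrow> x \<in> U i \<longrightarrow> c = map X [0..<J i])" for i
  proof (cases "\<exists>X x. address p X x \<and> x \<in> U i")
    case True
    then obtain X x where X: "address p X x" "x \<in> U i" by blast
    have "set (map X [0..<J i]) \<subseteq> inner p" using X(1) by (auto simp: address_def)
    then show ?thesis using agree[OF X] by (intro exI[of _ "map X [0..<J i]"]) auto
  next
    case False
    then show ?thesis using w0 by (intro exI[of _ "replicate (J i) w0"]) auto
  qed
  then obtain c where c: "\<And>i. length (c i) = J i" "\<And>i. set (c i) \<subseteq> inner p"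
    "\<And>i X x. address p X x \<Longrightarrow> x \<in> U i \<Longrightarrow> c i = map X [0..<J i]" by metis
  have "(\<Sum>i. ennreal ((1 / N) ^ length (c i))) < 1"
  proof -
    have "(\<Sum>i. ennreal ((1 / N) ^ length (c i))) \<le> (\<Sum>i. ennreal c0 * ennreal (diam i powr s) + ennreal ((1/2) ^ (i + 2)))"
    proof (rule suminf_le)
      fix i
      have "ennreal ((1 / N) ^ length (c i)) \<le> ennreal (c0 * diam i powr s + (1/2) ^ (i + 2))"
        unfolding c(1) by (rule ennreal_leI[OF J(2)])
      also have "\<dots> = ennreal c0 * ennreal (diam i powr s) + ennreal ((1/2) ^ (i + 2))"
        using c0 by (simp add: ennreal_plus ennreal_mult)
      finally show "ennreal ((1 / N) ^ length (c i)) \<le> ennreal c0 * ennreal (diam i powr s) + ennreal ((1/2) ^ (i + 2))" .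
    qed auto
    also have "\<dots> = (\<Sum>i. ennreal c0 * ennreal (diam i powr s)) + (\<Sum>i. ennreal ((1/2) ^ (i + 2)))"
      by (rule suminf_add[symmetric]) auto
    also have "(\<Sum>i. ennreal c0 * ennreal (diam i powr s)) = ennreal c0 * (\<Sum>i. ennreal (diam i powr s))"
      by (rule ennreal_suminf_cmult)
    also have "(\<Sum>i. ennreal ((1/2) ^ (i + 2))) = ennreal (1/2)"
    proof (rule suminf_ennreal_eq)
      have "(\<lambda>i. (1/2::real) ^ i) sums 2" using geometric_sums[of "1/2::real"] by simp
      from sums_mult[OF this, of "1/4"] show "(\<lambda>i. (1/2::real) ^ (i + 2)) sums (1/2)"
        by (simp add: power_add power2_eq_square mult.commute)
    qed simp
    also have "ennreal c0 * (\<Sum>i. ennreal (diam i powr s)) \<le> ennreal c0 * ennreal (1 / (4 * c0))"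
      using U(2) unfolding diam_def by (intro mult_left_mono) auto
    also have "ennreal c0 * ennreal (1 / (4 * c0)) = ennreal (1/4)" using c0 by (simp add: ennreal_mult[symmetric])
    also have "ennreal (1/4) + ennreal (1/2) = ennreal (3/4)" by (subst ennreal_plus[symmetric]) simp_all
    also have "\<dots> < 1" by (simp add: ennreal_less_one_iff)
    finally show ?thesis by (simp add: add_right_mono)
  qed
  from avoid_cylinders[OF fin N_def N0 c(2) this]
  obtain X where X: "\<And>k. X k \<in> inner p" "\<And>i. c i \<noteq> map X [0..<length (c i)]" by blast
  obtain x where x: "address p X x" "x \<in> T" using address_exists[OF X(1)] .
  then obtain i where "x \<in> U i" using UT by blast
  then show False using c(3)[OF x(1), of i] X(2)[of i] c(1) by simp
qed

lemma hausdorff_dimension_dd: "hausdorff_dimension T dd = ereal (ln 6 / ln 2)"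
proof (rule antisym)
  let ?D = "ln 6 / ln 2 :: real"
  have D0: "?D > 0" by simp
  show "hausdorff_dimension T dd \<le> ereal ?D"
  proof (rule ereal_le_epsilon)
    fix e :: ereal assume e: "0 < e"
    show "hausdorff_dimension T dd \<le> ereal ?D + e"
    proof (cases e)
      case (real r)
      then have "r > 0" using e by simp
      then have pos: "0 < ?D + r" using D0 by linarith
      have "hausdorff_measure (?D + r) T dd = 0" using hausdorff_measure_zero[of "?D + r"] \<open>r > 0\<close> by simp
      then have "hausdorff_dimension T dd \<le> ereal (?D + r)"
        unfolding hausdorff_dimension_def using pos by (intro Inf_lower) auto
      then show ?thesis using real by simp
    qed (use e in auto)
  qed
  show "ereal ?D \<le> hausdorff_dimension T dd"
    unfolding hausdorff_dimension_def
  proof (rule Inf_greatest)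
    fix r assume "r \<in> ereal ` {s. 0 < s \<and> hausdorff_measure s T dd = 0}"
    then obtain s where s: "r = ereal s" "0 < s" "hausdorff_measure s T dd = 0" by auto
    then show "ereal ?D \<le> r" using hausdorff_measure_pos[of s] by (cases "s < ?D") auto
  qed
qed

end

lemma self_similarity_dimension_6: "self_similarity_dimension 6 (1 / 2) = ln 6 / ln 2"
  unfolding self_similarity_dimension_def
proof (rule the_equality)
  have "(1/2::real) powr (ln 6 / ln 2) = 1/6" by (simp add: powr_def ln_div exp_minus)
  then show "real 6 * (1/2) powr (ln 6 / ln 2) = 1" by simp
next
  fix s :: real assume "real 6 * (1/2) powr s = 1"
  then have "(1/2::real) powr s = 1/6" by simp
  then have "ln ((1/2::real) powr s) = ln (1/6)" by (rule arg_cong)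
  then show "s = ln 6 / ln 2" by (simp add: ln_powr ln_div field_simps)
qed

section \<open>The geodesic distance on a triangle\<close>

theorem theorem2p6:
  fixes v0 v1 v2 :: "real^2" and t T :: "(real^2) set"
  assumes t: "t = {v0, v1, v2}"
    and nondegenerate: "\<not> collinear t"
    and T: "T = convex hull t"
  shows "\<exists>d.
      geodesic_distance T d \<and> edges_geodesic t d \<and>
      (\<forall>d'. geodesic_distance T d' \<and> edges_geodesic t d' \<longrightarrow>
            (\<forall>x\<in>T. \<forall>y\<in>T. d' x y = d x y)) \<and>
      (compact_space (Metric_space.mtopology T d) \<and>
       Metric_space.mtopology T d homeomorphic_space top_of_set T) \<and>
      (\<forall>n. \<forall>c\<in>bary_subdivision n t. \<forall>x\<in>c. \<forall>y\<in>convex hull (c - {x}).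
            d x y = (1 / 2) ^ n) \<and>
      (\<forall>x\<in>T. \<forall>y\<in>T. x \<noteq> y \<longrightarrow> infinite (geodesic_images T d x y)) \<and>
      (\<exists>f. self_similar_set T d 6 f (1 / 2)) \<and>
      hausdorff_dimension T d = ereal (ln 6 / ln 2) \<and>
      self_similarity_dimension 6 (1 / 2) = ln 6 / ln 2"
proof -
  interpret K: plane_triangle v0 v1 v2
    by unfold_locales (use nondegenerate t in simp)
  interpret K: bary_metric v0 v1 v2 K.dd by (rule K.bary_metric_dd)
  have tK: "t = K.tri" by (simp add: t K.tri_def)
  have TK: "T = K.T" by (simp add: T tK K.hull_tri)
  have unique: "d' x y = K.dd x y"
    if "geodesic_distance K.T d'" "edges_geodesic K.tri d'" "x \<in> K.T" "y \<in> K.T" for d' x y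
  proof -
    have "bary_metric v0 v1 v2 d'" by unfold_locales (rule that(1), rule that(2))
    then show ?thesis by (rule bary_metric.distance_unique[OF _ K.bary_metric_dd that(3,4)])
  qed
  have compact: "compact_space (Metric_space.mtopology K.T K.dd)"
    using K.compact_T by (simp add: K.mtopology_dd compact_space_subtopology)
  have opposite: "K.dd x y = (1 / 2) ^ n"
    if c: "c \<in> bary_subdivision n K.tri" "x \<in> c" "y \<in> convex hull (c - {x})" for n c x y
  proof -
    obtain w where w: "w \<in> words n" "c = K.Aw w ` K.tri"
      using c(1) unfolding K.bary_subdivision_eq by blast
    obtain a where a: "a < 3" "x = K.Aw w (K.vtx a)"
      using c(2) w(2) K.tri_eq by auto
    obtain b b' where b: "b < 3" "b' < 3" "a \<noteq> b" "a \<noteq> b'" "\<And>e. e < 3 \<Longrightarrow> e = a \<or> e = b \<or> e = b'"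
    proof -
      consider "a = 0" | "a = 1" | "a = 2" using a(1) by linarith
      then show ?thesis
        by cases (rule that[of 1 2] that[of 0 2] that[of 0 1]; linarith)+
    qed
    have "c - {x} \<subseteq> {K.Aw w (K.vtx b), K.Aw w (K.vtx b')}"
      unfolding w(2) a(2) K.tri_eq using b(5) by auto
    then have "y \<in> closed_segment (K.Aw w (K.vtx b)) (K.Aw w (K.vtx b'))"
      using c(3) hull_mono unfolding segment_convex_hull by blast
    then obtain r where r: "0 \<le> r" "r \<le> 1" "y = K.Aw w (K.side b b' r)"
      unfolding in_segment K.Aw_side linepath_def by blast
    have "K.bc a (K.side b b' r) = 0" using K.bc_side[OF b(1,2) a(1)] b(3,4) by simp
    then show ?thesis using K.opposite_eq[OF w(1) a(1) K.side_in_T[OF b(1,2) r(1,2)]] a(2) r(3) by simp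
  qed
  have "self_similar_set K.T K.dd 6 (\<lambda>i. K.A ([(0,1,2), (0,2,1), (1,0,2), (1,2,0), (2,0,1), (2,1,0)] ! i)) (1/2)"
    (is "self_similar_set _ _ _ (\<lambda>i. K.A (?L ! i)) _")
  proof -
    have Perms: "Perms = (!) ?L ` {..<6}"
    proof -
      have "Perms = set ?L" by (simp add: Perms_def)
      also have "\<dots> = (!) ?L ` {..<6}" unfolding set_conv_nth by auto
      finally show ?thesis .
    qed
    have cover: "K.T = (\<Union>i<6. K.A (?L ! i) ` K.T)"
    proof -
      have "K.T = (\<Union>l\<in>Perms. K.A l ` K.T)"
      proof
        show "K.T \<subseteq> (\<Union>l\<in>Perms. K.A l ` K.T)" by (rule subsetI, erule K.T_cover) blast
        show "(\<Union>l\<in>Perms. K.A l ` K.T) \<subseteq> K.T" using K.A_in_T by blast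
      qed
      then show ?thesis unfolding Perms by simp
    qed
    have scale: "K.dd (K.A (?L ! i) x) (K.A (?L ! i) y) = 1 / 2 * K.dd x y"
      if "i < 6" "x \<in> K.T" "y \<in> K.T" for i x y
    proof -
      have "?L ! i \<in> Perms" using that(1) unfolding Perms by blast
      then show ?thesis using K.dd_A[of "?L ! i" x y] that by simp
    qed
    have "K.T \<noteq> {}" using K.vtx_in_T by blast
    then show ?thesis
      unfolding self_similar_set_def
      by (intro conjI allI ballI impI K.Metric_space_dd compact cover scale) simp_all
  qed
  then have similar: "\<exists>f. self_similar_set K.T K.dd 6 f (1/2)"
    by (rule exI[of "\<lambda>f. self_similar_set K.T K.dd 6 f (1/2)"])
  show ?thesis
    unfolding tK TK
  proof (intro exI[of _ K.dd] conjI allI ballI impI)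
    show "geodesic_distance K.T K.dd" by (rule K.geodesic_distance_dd)
    show "edges_geodesic K.tri K.dd" by (rule K.edges_geodesic_dd)
    show "d' x y = K.dd x y"
      if "geodesic_distance K.T d' \<and> edges_geodesic K.tri d'" "x \<in> K.T" "y \<in> K.T" for d' x y
      using unique that by blast
    show "Metric_space.mtopology K.T K.dd homeomorphic_space top_of_set K.T"
      by (simp add: K.mtopology_dd homeomorphic_space_refl)
    show "infinite (geodesic_images K.T K.dd x y)" if "x \<in> K.T" "y \<in> K.T" "x \<noteq> y" for x y
      using that by (rule K.infinite_geodesics)
  qed (rule compact similar K.hausdorff_dimension_dd self_similarity_dimension_6 opposite; assumption?)+
qed

end
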